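(* Let $0<\zeta<\pi$ and let $N$ be an arbitrary non-negative integer. Let $\lambda$ and $\nu$ be complex numbers satisfying $\left| \Re\lambda - \frac{1}{2} \right| < N + \frac{1}{2}$ and $\Re\nu > N - \Re\lambda$. Put $\gamma _{\lambda,\nu, n} = (\nu + \lambda - n)\zeta - (\lambda - n)\tfrac{\pi }{2}$. Then $$C_\nu ^{(\lambda )} (\cos \zeta ) = \frac{2}{\Gamma (\lambda )(2\sin\zeta)^\lambda }\left( \sum_{n = 0}^{N - 1}a_n \left( \lambda - \tfrac{1}{2} \right)\frac{\Gamma (\nu + \lambda - n)}{\Gamma (\nu + 1)}\frac{\cos (\gamma _{\lambda,\nu, n} )}{\sin ^n \zeta } + R_N^{(C)} (\zeta ,\lambda ,\nu ) \right),$$ where the remainder term satisfies the estimate $$\left| R_N^{(C)} (\zeta ,\lambda ,\nu ) \right| \le \left|\frac{\sin (\pi \lambda )}{\sin (\pi \Re\lambda )}\right| \left| a_N \left( \Re\lambda - \tfrac{1}{2} \right) \right|\frac{\Gamma (\Re\nu+\Re\lambda - N)}{\left| {\Gamma (\nu + 1)} \right|}\frac{\cosh (\Im (\gamma _{\lambda ,\nu ,N} ))}{\sin ^N \zeta}.$$ With the modified conditions $\left| \Re\lambda - \frac{1}{2} \right| < N + \frac{1}{2}$ and $\Re\nu > N - \Re\lambda +1$, one also has $$\begin{aligned}\left| R_N^{(C)} (\zeta ,\lambda ,\nu ) \right| \le \; & \left|\frac{\sin (\pi \lambda )}{\sin (\pi \Re\lambda )}\right|\left| a_N \left( \Re\lambda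 - \tfrac{1}{2} \right) \right|\frac{\Gamma (\Re\nu+\Re\lambda - N)}{\left| \Gamma (\nu + 1) \right|}\frac{\left| \cos (\gamma _{\lambda ,\nu ,N} )\right|}{\sin ^N \zeta } \\ & + \left|\frac{\sin (\pi \lambda )}{\sin (\pi \Re\lambda )}\right|\left| a_{N + 1} \left( \Re\lambda - \tfrac{1}{2} \right) \right|\frac{\Gamma (\Re\nu+\Re\lambda - N - 1)}{\left| \Gamma (\nu + 1) \right|}\frac{\left| \sin (\gamma _{\lambda ,\nu ,N} ) \right|}{\sin ^{N + 1} \zeta } .\end{aligned}$$ If $\Re\lambda $ is an integer, then the limiting values have to be taken in these bounds.
   Context: The Gegenbauer function is defined for $-1<x<1$ by $$C_\nu ^{(\lambda )} (x) = \frac{\sqrt\pi\, \Gamma (\nu + 2\lambda )}{\Gamma (\lambda )\Gamma (\nu + 1)\left(2\sqrt{1-x^2}\right)^{\lambda - \frac{1}{2}} }\mathsf{P}_{\nu + \lambda - \frac{1}{2}}^{\frac{1}{2} - \lambda } (x),$$ where $\mathsf{P}_\nu ^\mu (x) = \left( \frac{1 + x}{1 - x} \right)^{\mu /2} \mathbf{F}\left(\nu+1,-\nu;1-\mu;\tfrac{1-x}{2}\right)$ is the Ferrers function of the first kind and $\mathbf{F}(a,b;c;w)=\sum_{n\ge 0}\frac{(a)_n(b)_n}{\Gamma(c+n)\,n!}w^n$ ($|w|<1$) is the regularised hypergeometric function. $1/\Gamma$ is $0$ at the poles of $\Gamma$ (when $1/\Gamma(\lambda)=0$, the assertion is that the expansion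 holds with some remainder satisfying the bounds). $a_n (\mu ) = \frac{(4\mu ^2 - 1^2 )(4\mu ^2 - 3^2 ) \cdots (4\mu ^2 - (2n - 1)^2 )}{8^n n!}$. "Limiting value" means that $|a_k(\Re\lambda-\frac12)|/|\sin(\pi\Re\lambda)|$ is replaced by $\lim_{x\to\Re\lambda}|a_k(x-\frac12)|/|\sin(\pi x)|$. *)

theory Defs
  imports "HOL-Analysis.Analysis"
begin

definition hyp2f1_reg :: "complex \<Rightarrow> complex \<Rightarrow> complex \<Rightarrow> complex \<Rightarrow> complex" where
  "hyp2f1_reg a b c w =
     (\<Sum>n. pochhammer a n * pochhammer b n * rGamma (c + of_nat n) / fact n * w ^ n)"

definition ferrers_P :: "complex \<Rightarrow> complex \<Rightarrow> real \<Rightarrow> complex" where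
  "ferrers_P \<nu> \<mu> x =
     of_real ((1 + x) / (1 - x)) powr (\<mu> / 2) *
     hyp2f1_reg (\<nu> + 1) (- \<nu>) (1 - \<mu>) (of_real ((1 - x) / 2))"

text \<open>The reciprocals of the Gamma function are written with \<^const>\<open>rGamma\<close>, which is
  \<open>0\<close> at the poles.\<close>

definition gegenbauer_C :: "complex \<Rightarrow> complex \<Rightarrow> real \<Rightarrow> complex" where
  "gegenbauer_C \<nu> l x =
     of_real (sqrt pi) * Gamma (\<nu> + 2 * l) * rGamma l * rGamma (\<nu> + 1) /
     of_real (2 * sqrt (1 - x\<^sup>2)) powr (l - 1 / 2) *
     ferrers_P (\<nu> + l - 1 / 2) (1 / 2 - l) x"

definition acoef :: "nat \<Rightarrow> 'a::field_char_0 \<Rightarrow> 'a" where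
  "acoef n \<mu> = (\<Prod>k = 1..n. 4 * \<mu>\<^sup>2 - (2 * of_nat k - 1)\<^sup>2) / (8 ^ n * fact n)"

text \<open>The quotient \<open>|a\<^sub>k(x - 1/2)| / |sin (\<pi>x)|\<close>, with its limiting value at the integers.\<close>

definition acoef_sin_ratio :: "nat \<Rightarrow> real \<Rightarrow> real" where
  "acoef_sin_ratio k x =
     (if x \<in> \<int> then Lim (at x) (\<lambda>t. \<bar>acoef k (t - 1 / 2)\<bar> / \<bar>sin (pi * t)\<bar>)
      else \<bar>acoef k (x - 1 / 2)\<bar> / \<bar>sin (pi * x)\<bar>)"

definition gamma_phase :: "real \<Rightarrow> complex \<Rightarrow> complex \<Rightarrow> nat \<Rightarrow> complex" where
  "gamma_phase \<zeta> l \<nu> n =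
     (\<nu> + l - of_nat n) * of_real \<zeta> - (l - of_nat n) * of_real (pi / 2)"

end

theory Submission
  imports Defs "HOL-Complex_Analysis.Complex_Analysis"
begin

text \<open>
  Write \<open>s = \<nu> + \<lambda>\<close> and \<open>w\<^sub>\<plusminus> = (1 \<plusminus> i cot \<zeta>) / 2\<close>. For real \<open>1 < \<lambda> < 1 + Re s\<close> the Ferrers function is
  given by the Mehler--Dirichlet integral of \<open>e\<^sup>i\<^sup>s\<^sup>\<phi> (cos \<phi> - cos \<zeta>)\<^bsup>\<lambda>-1\<^esup>\<close> over \<open>[-\<zeta>, \<zeta>]\<close>. Moving the
  contour to the vertical half-lines \<open>\<plusminus>\<zeta> + i y\<close>, \<open>y > 0\<close>, turns it into the two integrals
  \<open>J\<^sub>\<plusminus> = \<integral> (1 - e\<^bsup>-y\<^esup>)\<^bsup>\<lambda>-1\<^esup> e\<^bsup>-sy\<^esup> (1 + w\<^sub>\<plusminus> (e\<^sup>y - 1))\<^bsup>\<lambda>-1\<^esup> dy\<close>, and the identity extends to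
  \<open>0 < Re \<lambda> < 1 + Re s\<close> by analytic continuation in \<open>\<lambda>\<close>.

  For \<open>0 < \<lambda> < 1\<close> the last factor of the integrand is \<open>\<integral> q\<^bsup>-\<lambda>\<^esup> e\<^bsup>-q\<^esup> exp (- w\<^sub>\<plusminus> (e\<^sup>y - 1) q) dq / \<Gamma>(1 - \<lambda>)\<close>.
  Subtracting from the inner exponential its Taylor polynomial of degree \<open>N - 1\<close> produces exactly
  the first \<open>N\<close> terms of the expansion, and leaves a double integral which converges for
  \<open>-N < Re \<lambda> < N + 1\<close> and is holomorphic there; so the formula holds in the whole strip.
  Since \<open>Re w\<^sub>\<plusminus> > 0\<close>, the Taylor remainder of \<open>e\<^bsup>-x\<^esup>\<close> is at most \<open>|x|\<^sup>N / N!\<close> and the double integral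
  of this majorant is a product of Gamma functions; this gives the first bound. The second one
  splits \<open>e\<^bsup>i\<gamma>\<^esup> B\<^sub>+ + e\<^bsup>-i\<gamma>\<^esup> B\<^sub>-\<close> as \<open>cos \<gamma> (B\<^sub>+ + B\<^sub>-) + i sin \<gamma> (B\<^sub>+ - B\<^sub>-)\<close> and uses a Lipschitz
  bound for the normalised Taylor remainder.
\<close>

text \<open>The two representations hold on ranges that do not meet: the contour argument needs
  \<lambda> > 1, so that the integrand vanishes at the branch points, and the inner Laplace integral
  needs \<lambda> < 1, so that Euler's integral for \<open>Gamma (1 - \<lambda>)\<close> converges.
  Holomorphy in \<lambda> is the bridge between them.

  The bounds owe their form to the reflection formula. It turns (\<lambda>)_n (1 - \<lambda>)_n into
  sin(\<pi>\<lambda>)/\<pi> times Gamma(\<lambda> + n) Gamma(n + 1 - \<lambda>). Estimating the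
  remainder replaces \<lambda> by Re \<lambda> in the two Gamma factors but leaves the sine alone,
  and this is the quotient of sines times |a_N(Re \<lambda> - 1/2)|. The Gamma product is finite and
  continuous in the open strip, hence it is also the limiting value at the integers.

  The Beta integral in the majorant has the denominator Gamma(Re s + Re \<lambda>), while the
  expansion carries the factor Gamma(s + \<lambda>). As |Gamma(z)| <= Gamma(Re z), the two cancel
  without loss of a constant.\<close>

section \<open>Integrals depending holomorphically on an exponent\<close>

text \<open>The numbers \<plusminus>Re w \<plusminus> Im w are the real parts of d w for d =
  \<plusminus>1 \<plusminus> i, and the largest of them is |Re w| + |Im w| >= |w|. Moduli of
  holomorphic exponentials thus replace exp(r |w|), and these can be read as integrands at shifted
  parameters.\<close>

lemma exp_cmod_le_sum_exp_directions:
  fixes w :: complex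
  assumes "0 \<le> r"
  shows "exp (r * cmod w) \<le> (\<Sum>d\<in>{Complex 1 1, Complex 1 (-1), Complex (-1) 1, Complex (-1) (-1)}.
           cmod (exp (of_real r * d * w)))"
proof -
  have "r * cmod w \<le> r * \<bar>Re w\<bar> + r * \<bar>Im w\<bar>"
    using mult_left_mono[OF cmod_le[of w] assms] by (simp add: distrib_left)
  then have "exp (r * cmod w) \<le> exp (r * \<bar>Re w\<bar> + r * \<bar>Im w\<bar>)" by simp
  also have "\<dots> \<le> exp (r * Re w - r * Im w) + exp (r * Re w + r * Im w)
      + exp (- (r * Re w) - r * Im w) + exp (- (r * Re w) + r * Im w)"
    by (auto simp: abs_if intro: order_trans[OF _ add_increasing] add_increasing add_increasing2)
  also have "\<dots> = (\<Sum>d\<in>{Complex 1 1, Complex 1 (-1), Complex (-1) 1, Complex (-1) (-1)}.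
           cmod (exp (of_real r * d * w)))"
    by (simp add: algebra_simps)
  finally show ?thesis .
qed

text \<open>The difference quotient costs a factor |w|. The inequality \<delta>|w| <=
  exp(\<delta>|w|) absorbs it, which doubles the rate to 2\<delta>.\<close>

lemma norm_exp_difference_quotient_le:
  fixes w h :: complex
  assumes h: "h \<noteq> 0" "cmod h < \<delta>"
  shows "cmod ((exp (h * w) - 1) / h) \<le>
    (\<Sum>d\<in>{Complex 1 1, Complex 1 (-1), Complex (-1) 1, Complex (-1) (-1)}.
       cmod (exp (of_real (2 * \<delta>) * d * w))) / \<delta>"
proof -
  have d: "0 < \<delta>" using h norm_ge_zero[of h] by linarith
  have "cmod (exp (h * w) - 1) \<le> exp \<bar>Re (h * w)\<bar> * cmod (h * w)"
    using Taylor_exp[of "h * w" 0] by simp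
  also have "\<dots> \<le> exp (\<delta> * cmod w) * cmod (h * w)"
  proof (rule mult_right_mono)
    have "\<bar>Re (h * w)\<bar> \<le> cmod h * cmod w"
      using abs_Re_le_cmod[of "h * w"] by (simp only: norm_mult)
    also have "\<dots> \<le> \<delta> * cmod w" using h by (intro mult_right_mono) auto
    finally show "exp \<bar>Re (h * w)\<bar> \<le> exp (\<delta> * cmod w)" by simp
  qed simp
  finally have "cmod ((exp (h * w) - 1) / h) \<le> exp (\<delta> * cmod w) * cmod w"
    using h by (simp add: norm_divide norm_mult field_simps)
  also have "\<dots> \<le> exp (\<delta> * cmod w) * (exp (\<delta> * cmod w) / \<delta>)"
  proof (rule mult_left_mono)
    have "\<delta> * cmod w \<le> exp (\<delta> * cmod w)"
      using exp_ge_add_one_self[of "\<delta> * cmod w"] by linarith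
    then show "cmod w \<le> exp (\<delta> * cmod w) / \<delta>"
      using d by (simp add: field_simps)
  qed simp
  also have "\<dots> = exp (2 * \<delta> * cmod w) / \<delta>"
    by (simp add: exp_add[symmetric])
  also have "\<dots> \<le> (\<Sum>d\<in>{Complex 1 1, Complex 1 (-1), Complex (-1) 1, Complex (-1) (-1)}.
       cmod (exp (of_real (2 * \<delta>) * d * w))) / \<delta>"
    using d by (intro divide_right_mono exp_cmod_le_sum_exp_directions) auto
  finally show ?thesis .
qed

text \<open>No majorant has to be supplied: the difference quotients at z are dominated by the
  moduli of the integrand at four points around z, which are integrable by hypothesis. Later proofs
  of holomorphy thereby reduce to integrability on an open set.\<close>

lemma holomorphic_on_integral_exp:
  fixes f g :: "'a \<Rightarrow> complex"
  assumes S: "open S"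
    and [measurable]: "f \<in> borel_measurable M" "g \<in> borel_measurable M"
    and int: "\<And>z. z \<in> S \<Longrightarrow> integrable M (\<lambda>x. f x * exp (z * g x))"
  shows "(\<lambda>z. \<integral>x. f x * exp (z * g x) \<partial>M) holomorphic_on S"
proof -
  have *: "\<exists>F'. ((\<lambda>z. \<integral>x. f x * exp (z * g x) \<partial>M) has_field_derivative F') (at z)" if zS: "z \<in> S" for z
  proof -
    obtain e where e: "0 < e" "ball z e \<subseteq> S"
      using openE[OF S zS] .
    \<comment> \<open>The four points lie at distance 2 \<delta> sqrt 2 from z, which is less than
      e.\<close>
    define \<delta> where "\<delta> = e / 4"
    have d: "0 < \<delta>" using e by (simp add: \<delta>_def)
    have zero: "(0::complex) \<in> ball 0 \<delta>" using d by simp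
    define V where "V = {Complex 1 1, Complex 1 (-1), Complex (-1) 1, Complex (-1) (-1)}"
    have V: "z + of_real (2 * \<delta>) * v \<in> S" if "v \<in> V" for v
    proof -
      have "cmod v = sqrt 2" using that by (auto simp: V_def complex_norm)
      moreover have "sqrt 2 < 2" by (simp add: real_less_lsqrt)
      ultimately have "cmod (of_real (2 * \<delta>) * v) < e"
        using d e by (simp add: norm_mult \<delta>_def)
      then show ?thesis using e(2) by (auto simp: dist_norm subset_iff)
    qed
    define D where "D x = (\<Sum>v\<in>V. cmod (f x * exp ((z + of_real (2 * \<delta>) * v) * g x))) / \<delta>" for x
    have intD: "integrable M D"
      unfolding D_def by (intro integrable_divide Bochner_Integration.integrable_sum integrable_norm int V)
    have dom: "cmod (f x * (exp (h * g x) - 1) / h * exp (z * g x)) \<le> D x"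
      if h: "h \<noteq> 0" "cmod h < \<delta>" for x h
    proof -
      have "cmod (f x * exp (z * g x)) * cmod ((exp (h * g x) - 1) / h) \<le>
          cmod (f x * exp (z * g x)) * ((\<Sum>v\<in>V. cmod (exp (of_real (2 * \<delta>) * v * g x))) / \<delta>)"
        unfolding V_def by (rule mult_left_mono[OF norm_exp_difference_quotient_le[OF h]]) simp
      also have "\<dots> = (\<Sum>v\<in>V. cmod (f x * exp (z * g x) * exp (of_real (2 * \<delta>) * v * g x))) / \<delta>"
        by (simp only: times_divide_eq_right sum_distrib_left norm_mult)
      also have "(\<lambda>v. f x * exp (z * g x) * exp (of_real (2 * \<delta>) * v * g x)) =
          (\<lambda>v. f x * exp ((z + of_real (2 * \<delta>) * v) * g x))"
        by (rule ext) (simp add: distrib_right exp_add)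
      finally have "cmod (f x * exp (z * g x)) * cmod ((exp (h * g x) - 1) / h) \<le> D x"
        unfolding D_def .
      then show ?thesis by (simp add: norm_mult norm_divide mult_ac)
    qed
    \<comment> \<open>Restricting h to a ball makes the domination valid for every term of a
      sequence. The ball is open, so the limit is the one at 0.\<close>
    have "((\<lambda>h. ((\<integral>x. f x * exp ((z + h) * g x) \<partial>M) - (\<integral>x. f x * exp (z * g x) \<partial>M)) / h)
        \<longlongrightarrow> (\<integral>x. f x * g x * exp (z * g x) \<partial>M)) (at 0 within ball 0 \<delta>)"
      unfolding tendsto_at_iff_sequentially o_def
    proof (intro allI impI)
      fix X :: "nat \<Rightarrow> complex"
      assume X: "\<forall>i. X i \<in> ball 0 \<delta> - {0}" "X \<longlonglongrightarrow> 0"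
      have "(\<lambda>i. \<integral>x. f x * (exp (X i * g x) - 1) / X i * exp (z * g x) \<partial>M)
          \<longlonglongrightarrow> (\<integral>x. f x * g x * exp (z * g x) \<partial>M)"
      proof (rule integral_dominated_convergence[where w = D])
        show "AE x in M. (\<lambda>i. f x * (exp (X i * g x) - 1) / X i * exp (z * g x))
            \<longlonglongrightarrow> f x * g x * exp (z * g x)"
        proof (rule AE_I2)
          fix x
          have "((\<lambda>h. exp (h * g x)) has_field_derivative g x) (at 0)"
            by (auto intro!: derivative_eq_intros)
          then have "((\<lambda>h. (exp (h * g x) - 1) / h) \<longlongrightarrow> g x) (at 0)"
            by (simp add: DERIV_def)
          moreover have "filterlim X (at 0) sequentially"
            using X by (auto simp: filterlim_at)
          ultimately have "(\<lambda>i. (exp (X i * g x) - 1) / X i) \<longlonglongrightarrow> g x"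
            by (rule filterlim_compose)
          then have "(\<lambda>i. f x * ((exp (X i * g x) - 1) / X i) * exp (z * g x))
              \<longlonglongrightarrow> f x * g x * exp (z * g x)"
            by (intro tendsto_intros)
          then show "(\<lambda>i. f x * (exp (X i * g x) - 1) / X i * exp (z * g x))
            \<longlonglongrightarrow> f x * g x * exp (z * g x)" by simp
        qed
        show "AE x in M. norm (f x * (exp (X i * g x) - 1) / X i * exp (z * g x)) \<le> D x" for i
          using X(1)[rule_format, of i] by (intro AE_I2 dom) auto
        show "integrable M D" by (rule intD)
        show "(\<lambda>x. f x * g x * exp (z * g x)) \<in> borel_measurable M" by measurable
        show "(\<lambda>x. f x * (exp (X i * g x) - 1) / X i * exp (z * g x)) \<in> borel_measurable M" for i
          by measurable
      qed
      moreover have "(\<integral>x. f x * (exp (X i * g x) - 1) / X i * exp (z * g x) \<partial>M) =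
          ((\<integral>x. f x * exp ((z + X i) * g x) \<partial>M) - (\<integral>x. f x * exp (z * g x) \<partial>M)) / X i" for i
      proof -
        have "cmod (X i) < e" "X i \<noteq> 0" using X(1)[rule_format, of i] d by (auto simp: \<delta>_def)
        then have "z + X i \<in> S" using e(2) by (auto simp: dist_norm subset_iff)
        then have "(\<integral>x. f x * exp ((z + X i) * g x) \<partial>M) - (\<integral>x. f x * exp (z * g x) \<partial>M) =
          (\<integral>x. f x * exp ((z + X i) * g x) - f x * exp (z * g x) \<partial>M)"
          using int \<open>z \<in> S\<close> by (intro Bochner_Integration.integral_diff[symmetric]) auto
        then have "((\<integral>x. f x * exp ((z + X i) * g x) \<partial>M) - (\<integral>x. f x * exp (z * g x) \<partial>M)) / X i =
          (\<integral>x. (f x * exp ((z + X i) * g x) - f x * exp (z * g x)) / X i \<partial>M)"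
          by (simp only: integral_divide_zero)
        also have "\<dots> = (\<integral>x. f x * (exp (X i * g x) - 1) / X i * exp (z * g x) \<partial>M)"
          by (intro Bochner_Integration.integral_cong refl)
             (simp add: algebra_simps exp_add diff_divide_distrib)
        finally show ?thesis by (rule sym)
      qed
      ultimately show "(\<lambda>i. ((\<integral>x. f x * exp ((z + X i) * g x) \<partial>M) - (\<integral>x. f x * exp (z * g x) \<partial>M)) / X i)
          \<longlonglongrightarrow> (\<integral>x. f x * g x * exp (z * g x) \<partial>M)" by (simp only:)
    qed
    then show ?thesis
      unfolding at_within_open[OF zero open_ball] DERIV_def by (rule exI)
  qed
  show ?thesis
    unfolding holomorphic_on_open[OF S] by (rule ballI) (rule *)
qed

section \<open>Laplace and Beta integrals on the half-line\<close>

text \<open>The identity theorem, with the midpoint of the interval as accumulation point. Each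
  continuation below starts from a real parameter, where real substitutions are available.\<close>

lemma analytic_continuation_real_interval:
  fixes f g :: "complex \<Rightarrow> complex" and a b :: real
  assumes "f holomorphic_on S" "g holomorphic_on S" "open S" "connected S"
    and "a < b" and sub: "\<And>x. a < x \<Longrightarrow> x < b \<Longrightarrow> of_real x \<in> S"
    and eq: "\<And>x. a < x \<Longrightarrow> x < b \<Longrightarrow> f (of_real x) = g (of_real x)"
    and "w \<in> S"
  shows "f w = g w"
proof -
  define c where "c = (a + b) / 2"
  have c: "a < c" "c < b" using \<open>a < b\<close> by (auto simp: c_def)
  have "of_real c islimpt (complex_of_real ` {a<..<b})"
    unfolding islimpt_approachable
  proof (intro allI impI)
    fix e :: real assume "0 < e"
    define y where "y = c + min (e / 2) ((b - c) / 2)"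
    have "y \<in> {a<..<b}" "y \<noteq> c" "\<bar>y - c\<bar> < e"
      using c \<open>0 < e\<close> by (auto simp: y_def min_def field_simps)
    then show "\<exists>x'\<in>complex_of_real ` {a<..<b}. x' \<noteq> of_real c \<and> dist x' (of_real c) < e"
      by (intro bexI[of _ "of_real y"]) (auto simp: dist_norm simp flip: of_real_diff)
  qed
  then have "f w - g w = 0"
    using assms c
    by (intro analytic_continuation[of "\<lambda>z. f z - g z" S "complex_of_real ` {a<..<b}" "of_real c" w])
       (auto intro!: holomorphic_intros)
  then show ?thesis by simp
qed

lemma powr_complex_of_real_eq_exp:
  "0 < x \<Longrightarrow> complex_of_real x powr a = exp (a * of_real (ln x))"
  by (simp add: powr_def Ln_of_real)

text \<open>The half-line is built into the measure, so that the double integrals live on a genuine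
  product measure and Fubini applies without indicator functions.\<close>

abbreviation lpos :: "real measure" where
  "lpos \<equiv> restrict_space lborel {0<..}"

lemma space_lpos: "space lpos = {0<..}"
  by (simp add: space_restrict_space)

lemma sigma_finite_lpos: "sigma_finite_measure lpos"
  by (intro sigma_finite_measure_restrict_space sigma_finite_lborel) auto

interpretation lpos: sigma_finite_measure lpos
  by (rule sigma_finite_lpos)

interpretation lpos2: pair_sigma_finite lpos lpos ..

lemma borel_measurable_lpos: "f \<in> borel_measurable borel \<Longrightarrow> f \<in> borel_measurable lpos"
  by (simp add: measurable_restrict_space1)

text \<open>Euler's integrals and the substitution rule come as gauge integrals; this and the next
  lemma carry them over to \<open>lpos\<close>.\<close>

lemma integrable_lpos_iff_absolutely_integrable:
  fixes f :: "real \<Rightarrow> 'a::euclidean_space"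
  assumes [measurable]: "f \<in> borel_measurable borel"
  shows "integrable lpos f \<longleftrightarrow> f absolutely_integrable_on {0<..}"
  by (simp add: integrable_restrict_space set_integrable_def integrable_completion)

lemma integral_lpos_eq_integral:
  fixes f :: "real \<Rightarrow> 'a::euclidean_space"
  assumes [measurable]: "f \<in> borel_measurable borel" and "f absolutely_integrable_on {0<..}"
  shows "integral\<^sup>L lpos f = integral {0<..} f"
proof -
  have "integral\<^sup>L lpos f = set_lebesgue_integral lebesgue {0<..} f"
    by (simp add: integral_restrict_space set_lebesgue_integral_def integral_completion)
  then show ?thesis using assms(2) by (simp add: set_lebesgue_integral_eq_integral(2))
qed

lemma integrable_Gamma_Laplace:
  fixes a z :: complex
  assumes "0 < Re a" "0 < Re z"
  shows "integrable lpos (\<lambda>q. of_real q powr (a - 1) * exp (- z * of_real q))"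
proof -
  have "integrable lpos (\<lambda>t. complex_of_real t powr (a - 1) / of_real (exp (Re z * t)))"
    using absolutely_integrable_Gamma_integral[OF assms]
    by (subst integrable_lpos_iff_absolutely_integrable) auto
  then show ?thesis
    by (rule Bochner_Integration.integrable_bound)
       (auto intro!: borel_measurable_lpos simp: norm_mult norm_divide exp_minus field_simps)
qed

text \<open>For real z > 0 the substitution q -> z q reduces the integral to Euler's integral at z =
  1. Both sides are holomorphic in the right half-plane.\<close>

lemma integral_Gamma_Laplace:
  fixes a z :: complex
  assumes a: "0 < Re a" and z: "0 < Re z"
  shows "(\<integral>q. of_real q powr (a - 1) * exp (- z * of_real q) \<partial>lpos) = Gamma a * z powr (- a)"
proof -
  define L where "L z = (\<integral>q. of_real q powr (a - 1) * exp (z * - of_real q) \<partial>lpos)" for z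
  have hol: "L holomorphic_on {z. 0 < Re z}"
    unfolding L_def using a integrable_Gamma_Laplace[OF a]
    by (intro holomorphic_on_integral_exp) (auto intro!: borel_measurable_lpos open_halfspace_Re_gt)
  have L1: "L 1 = Gamma a"
  proof -
    have "L 1 = (\<integral>q. of_real q powr (a - 1) / of_real (exp q) \<partial>lpos)"
      unfolding L_def by (intro Bochner_Integration.integral_cong) (auto simp: exp_minus field_simps exp_of_real[symmetric])
    also have "\<dots> = integral {0<..} (\<lambda>q. of_real q powr (a - 1) / of_real (exp q))"
      using absolutely_integrable_Gamma_integral'[OF a] by (intro integral_lpos_eq_integral) auto
    also have "\<dots> = Gamma a" using Gamma_integral_complex'[OF a] by (rule integral_unique)
    finally show ?thesis .
  qed
  have Lr: "L (of_real r) = Gamma a * of_real r powr (- a)" if r: "0 < r" for r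
  proof -
    \<comment> \<open>The affine substitution is one on the whole line; the indicator is unchanged
      by it because r > 0.\<close>
    let ?f = "\<lambda>q. indicator {0<..} q *\<^sub>R (of_real q powr (a - 1) * exp (- complex_of_real q))"
    have "Gamma a = (\<integral>q. ?f q \<partial>lborel)"
      unfolding L1[symmetric] L_def by (simp add: integral_restrict_space)
    also have "\<dots> = r *\<^sub>R (\<integral>q. ?f (0 + r * q) \<partial>lborel)"
      using r lborel_integral_real_affine[of r ?f 0] by simp
    also have "(\<integral>q. ?f (0 + r * q) \<partial>lborel) =
        (\<integral>q. of_real r powr (a - 1) * (indicator {0<..} q *\<^sub>R (of_real q powr (a - 1) * exp (of_real r * - complex_of_real q))) \<partial>lborel)"
      using r by (intro Bochner_Integration.integral_cong refl)
        (auto simp: indicator_def zero_less_mult_iff powr_complex_of_real_eq_exp ln_mult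
          algebra_simps simp flip: of_real_mult exp_add)
    also have "\<dots> = of_real r powr (a - 1) * L (of_real r)"
      unfolding L_def by (simp only: integral_mult_right_zero) (simp add: integral_restrict_space)
    finally have "Gamma a = of_real r powr a * L (of_real r)"
      using r by (simp add: powr_diff scaleR_conv_of_real)
    then show ?thesis using r by (simp add: powr_minus field_simps)
  qed
  have "L z = Gamma a * z powr (- a)"
    by (rule analytic_continuation_real_interval[of L "{z. 0 < Re z}" _ 0 1])
       (use z hol Lr in \<open>auto intro!: holomorphic_intros open_halfspace_Re_gt convex_connected
          convex_halfspace_Re_gt simp: complex_nonpos_Reals_iff\<close>)
  then show ?thesis by (simp add: L_def)
qed

lemma Gamma_real_eq_integral:
  fixes a :: real
  assumes "0 < a"
  shows "integrable lpos (\<lambda>q. q powr (a - 1) * exp (- q))"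
    and "(\<integral>q. q powr (a - 1) * exp (- q) \<partial>lpos) = Gamma a"
proof -
  have *: "complex_of_real (q powr (a - 1) * exp (- q)) =
      of_real q powr (of_real a - 1) * exp (- 1 * of_real q)" if "q \<in> space lpos" for q
    using that by (simp add: space_lpos powr_of_real[symmetric] exp_of_real[symmetric])
  have "integrable lpos (\<lambda>q. complex_of_real (q powr (a - 1) * exp (- q)))"
    using integrable_Gamma_Laplace[of "of_real a" 1] assms
    by (subst Bochner_Integration.integrable_cong[OF refl *]) auto
  then show "integrable lpos (\<lambda>q. q powr (a - 1) * exp (- q))"
    by (simp only: complex_of_real_integrable_eq)
  have "complex_of_real (\<integral>q. q powr (a - 1) * exp (- q) \<partial>lpos) =
      (\<integral>q. complex_of_real (q powr (a - 1) * exp (- q)) \<partial>lpos)"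
    by (rule integral_complex_of_real[symmetric])
  also have "\<dots> = of_real (Gamma a)"
    using integral_Gamma_Laplace[of "of_real a" 1] assms
    by (subst Bochner_Integration.integral_cong[OF refl *]) (auto simp: Gamma_complex_of_real)
  finally show "(\<integral>q. q powr (a - 1) * exp (- q) \<partial>lpos) = Gamma a" by simp
qed

text \<open>The triangle inequality in Euler's integral, since |q^(z-1)| = q^(Re z - 1). It is
  applied to Gamma(s + \<lambda>) in front of the remainder.\<close>

lemma norm_Gamma_le_Gamma_Re:
  assumes "0 < Re z"
  shows "cmod (Gamma z) \<le> Gamma (Re z)"
proof -
  have "Gamma z = (\<integral>q. of_real q powr (z - 1) * exp (- 1 * of_real q) \<partial>lpos)"
    using integral_Gamma_Laplace[OF assms, of 1] by simp
  also have "cmod \<dots> \<le> (\<integral>q. cmod (of_real q powr (z - 1) * exp (- 1 * of_real q)) \<partial>lpos)"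
    by (rule integral_norm_bound)
  also have "\<dots> = (\<integral>q. q powr (Re z - 1) * exp (- q) \<partial>lpos)"
    by (intro Bochner_Integration.integral_cong refl)
       (auto simp: space_lpos norm_mult norm_powr_real_powr)
  finally show ?thesis using Gamma_real_eq_integral(2)[OF assms] by simp
qed

text \<open>The substitution t = 1 - exp(-y) in Euler's Beta integral: dt = exp(-y) dy completes (1
  - t)^(b-1) to exp(-b y).\<close>

lemma
  fixes a b :: real
  assumes a: "0 < a" and b: "0 < b"
  shows integrable_Beta_exp: "integrable lpos (\<lambda>y. (1 - exp (- y)) powr (a - 1) * exp (- b * y))"
    and integral_Beta_exp: "(\<integral>y. (1 - exp (- y)) powr (a - 1) * exp (- b * y) \<partial>lpos) = Beta a b"
proof -
  let ?f = "\<lambda>t::real. t powr (a - 1) * (1 - t) powr (b - 1)"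
  let ?g = "\<lambda>y::real. 1 - exp (- y)"
  have im: "?g ` {0<..} = {0<..<1}"
  proof safe
    fix t :: real assume "t \<in> {0<..<1}"
    then show "t \<in> ?g ` {0<..}"
      by (intro image_eqI[of _ _ "- ln (1 - t)"]) (auto simp: ln_less_zero_iff)
  qed auto
  have "(?f has_integral Beta a b) {0<..<1}"
    using has_integral_Beta_real[OF a b] by (simp add: has_integral_Icc_iff_Ioo)
  then have "?f absolutely_integrable_on {0<..<1} \<and> integral {0<..<1} ?f = Beta a b"
    by (auto intro!: nonnegative_absolutely_integrable_1 simp: integral_unique has_integral_integrable)
  then have "(\<lambda>x. \<bar>exp (- x)\<bar> *\<^sub>R ?f (?g x)) absolutely_integrable_on {0<..} \<and>
      integral {0<..} (\<lambda>x. \<bar>exp (- x)\<bar> *\<^sub>R ?f (?g x)) = Beta a b"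
    unfolding im[symmetric]
    by (subst has_absolute_integral_change_of_variables_real)
       (auto intro!: derivative_eq_intros inj_onI)
  moreover have eq: "\<bar>exp (- x)\<bar> *\<^sub>R ?f (?g x) = (1 - exp (- x)) powr (a - 1) * exp (- b * x)" for x
    by (simp add: exp_powr_real[symmetric] powr_def algebra_simps flip: exp_add)
  ultimately have *: "(\<lambda>y. (1 - exp (- y)) powr (a - 1) * exp (- b * y)) absolutely_integrable_on {0<..}"
     "integral {0<..} (\<lambda>y. (1 - exp (- y)) powr (a - 1) * exp (- b * y)) = Beta a b" unfolding eq by blast+
  show "integrable lpos (\<lambda>y. (1 - exp (- y)) powr (a - 1) * exp (- b * y))"
    using *(1) by (subst integrable_lpos_iff_absolutely_integrable) auto
  show "(\<integral>y. (1 - exp (- y)) powr (a - 1) * exp (- b * y) \<partial>lpos) = Beta a b"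
    using * by (subst integral_lpos_eq_integral) auto
qed

section \<open>Taylor remainders of the exponential\<close>

text \<open>The division by \<open>w ^ N\<close> makes \<open>exp_rem (N + 1)\<close> an antiderivative of \<open>- exp_rem N\<close> in \<open>r\<close>,
  so that both estimates below follow by integrating from \<open>0\<close>.\<close>

definition exp_rem :: "nat \<Rightarrow> complex \<Rightarrow> real \<Rightarrow> complex" where
  "exp_rem N w r = (exp (- w * of_real r) - (\<Sum>n<N. (- w * of_real r) ^ n / fact n)) / w ^ N"

lemma exp_rem_0_right: "exp_rem (Suc N) w 0 = 0"
  unfolding exp_rem_def sum.lessThan_Suc_shift by simp

lemma has_field_derivative_power_divide_fact:
  fixes x :: "'a :: real_normed_field"
  shows "((\<lambda>x. x ^ Suc n / fact (Suc n)) has_field_derivative x ^ n / fact n) (at x)"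
proof -
  have "((\<lambda>x. x ^ Suc n / fact (Suc n)) has_field_derivative
      of_nat (Suc n) * x ^ n / fact (Suc n)) (at x)"
    using DERIV_cdivide[OF DERIV_power[OF DERIV_ident, of "Suc n" x UNIV], of "fact (Suc n)"]
    by (simp del: power_Suc fact_Suc of_nat_Suc)
  also have "of_nat (Suc n) * x ^ n / fact (Suc n) = x ^ n / fact n"
    by (simp add: field_simps del: of_nat_Suc)
  finally show ?thesis .
qed

lemma has_vector_derivative_exp_rem:
  assumes "w \<noteq> 0"
  shows "(exp_rem (Suc N) w has_vector_derivative - exp_rem N w r) (at r)"
proof -
  have "((\<lambda>r. \<Sum>n<Suc N. (- w * of_real r) ^ n / fact n) has_vector_derivative
      (- w * (\<Sum>n<N. (- w * of_real r) ^ n / fact n))) (at r)"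
  proof -
    have *: "((\<lambda>r. (- w * of_real r) ^ Suc n / fact (Suc n)) has_vector_derivative
      (- w * ((- w * of_real r) ^ n / fact n))) (at r)" for n
    proof -
      have "((\<lambda>x. (- w * x) ^ Suc n / fact (Suc n)) has_field_derivative
        (- w * ((- w * of_real r) ^ n / fact n))) (at (of_real r))"
        using DERIV_chain2[OF has_field_derivative_power_divide_fact[of n "- w * of_real r"]
            DERIV_cmult[OF DERIV_ident, of "- w"]] by (simp del: power_Suc fact_Suc add: mult.commute)
      then show ?thesis by (rule has_vector_derivative_real_field)
    qed
    have "((\<lambda>r. (- w * of_real r) ^ 0 / fact 0 + (\<Sum>n<N. (- w * of_real r) ^ Suc n / fact (Suc n)))
        has_vector_derivative 0 + (\<Sum>n<N. - w * ((- w * of_real r) ^ n / fact n))) (at r)"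
      by (intro has_vector_derivative_add has_vector_derivative_sum *) simp
    then show ?thesis
      unfolding sum.lessThan_Suc_shift sum_distrib_left by (simp only: add_0)
  qed
  moreover have "((\<lambda>r. exp (- w * of_real r)) has_vector_derivative (- w * exp (- w * of_real r))) (at r)"
  proof -
    have "((\<lambda>x. exp (- w * x)) has_field_derivative (- w * exp (- w * of_real r))) (at (of_real r))"
      by (rule derivative_eq_intros refl | simp)+
    then show ?thesis by (rule has_vector_derivative_real_field)
  qed
  ultimately have "((\<lambda>r. exp (- w * of_real r) - (\<Sum>n<Suc N. (- w * of_real r) ^ n / fact n))
      has_vector_derivative (- w * exp (- w * of_real r) - - w * (\<Sum>n<N. (- w * of_real r) ^ n / fact n))) (at r)"
    by (rule has_vector_derivative_diff[rotated])
  then have "((\<lambda>r. (exp (- w * of_real r) - (\<Sum>n<Suc N. (- w * of_real r) ^ n / fact n)) / w ^ Suc N)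
      has_vector_derivative (- w * exp (- w * of_real r) - - w * (\<Sum>n<N. (- w * of_real r) ^ n / fact n)) / w ^ Suc N) (at r)"
    by (rule has_vector_derivative_divide)
  moreover have "(- w * exp (- w * of_real r) - - w * (\<Sum>n<N. (- w * of_real r) ^ n / fact n)) / w ^ Suc N
      = - exp_rem N w r"
    using assms by (simp add: exp_rem_def field_simps)
  ultimately show ?thesis
    unfolding exp_rem_def[abs_def] by simp
qed

lemma continuous_on_exp_rem: "continuous_on A (exp_rem N w)"
  unfolding exp_rem_def[abs_def] divide_inverse by (intro continuous_intros)

text \<open>The induction starts from |exp(-w r)| <= 1. Owing to the normalisation the bound does
  not involve w, so one majorant serves both edges of the contour.\<close>

lemma norm_exp_rem_le:
  assumes "0 < Re w" "0 \<le> r"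
  shows "cmod (exp_rem N w r) \<le> r ^ N / fact N"
  using assms(2)
proof (induction N arbitrary: r)
  case 0
  then show ?case using assms(1) by (simp add: exp_rem_def)
next
  case (Suc N)
  have w: "w \<noteq> 0" using assms by auto
  show ?case
  proof (cases "r = 0")
    case False
    have "cmod (exp_rem (Suc N) w r - exp_rem (Suc N) w 0) \<le> r ^ Suc N / fact (Suc N) - 0 ^ Suc N / fact (Suc N)"
    proof (rule differentiable_bound_general)
      show "((\<lambda>x. x ^ Suc N / fact (Suc N)) has_vector_derivative x ^ N / fact N) (at x)" for x :: real
        unfolding has_real_derivative_iff_has_vector_derivative[symmetric]
        by (rule has_field_derivative_power_divide_fact)
      show "(exp_rem (Suc N) w has_vector_derivative - exp_rem N w x) (at x)" for x
        by (rule has_vector_derivative_exp_rem[OF w])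
      show "cmod (- exp_rem N w x) \<le> x ^ N / fact N" if "0 < x" for x
        using Suc.IH[of x] that by simp
    qed (use Suc.prems False in \<open>auto intro!: continuous_on_exp_rem continuous_intros\<close>)
    then show ?thesis by (simp add: exp_rem_0_right)
  qed (simp add: exp_rem_0_right)
qed

text \<open>Comparing two values of w gains a power of r: the exponent N + 1 is the source of the
  coefficient with index N + 1 in the second bound.\<close>

lemma norm_exp_rem_diff_le:
  assumes "0 < Re w" "0 < Re w'" "0 \<le> r"
  shows "cmod (exp_rem N w r - exp_rem N w' r) \<le> cmod (w - w') * r ^ Suc N / fact (Suc N)"
  using assms(3)
proof (induction N arbitrary: r)
  case 0
  \<comment> \<open>On the closed left half-plane, which is convex, exp has derivative of modulus at
    most 1, hence Lipschitz constant 1.\<close>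
  have "cmod (exp (- w * of_real r) - exp (- w' * of_real r)) \<le> 1 * cmod (- w * of_real r - - w' * of_real r)"
  proof (rule field_differentiable_bound[of "{z. Re z \<le> 0}"])
    show "(exp has_field_derivative exp z) (at z within {z. Re z \<le> 0})" for z :: complex
      by (rule DERIV_subset[OF DERIV_exp]) auto
  qed (use assms 0 in \<open>auto simp: convex_halfspace_Re_le mult_nonneg_nonneg\<close>)
  also have "\<dots> = cmod ((w' - w) * of_real r)" by (simp add: algebra_simps)
  finally show ?case using 0 by (simp add: exp_rem_def norm_mult norm_minus_commute)
next
  case (Suc N)
  have w: "w \<noteq> 0" "w' \<noteq> 0" using assms by auto
  define F where "F r = exp_rem (Suc N) w r - exp_rem (Suc N) w' r" for r
  show ?case
  proof (cases "r = 0")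
    case False
    have "cmod (F r - F 0) \<le> cmod (w - w') * r ^ Suc (Suc N) / fact (Suc (Suc N)) -
        cmod (w - w') * 0 ^ Suc (Suc N) / fact (Suc (Suc N))"
    proof (rule differentiable_bound_general)
      show "((\<lambda>x. cmod (w - w') * x ^ Suc (Suc N) / fact (Suc (Suc N))) has_vector_derivative
          cmod (w - w') * x ^ Suc N / fact (Suc N)) (at x)" for x :: real
        unfolding has_real_derivative_iff_has_vector_derivative[symmetric]
        using DERIV_cmult[OF has_field_derivative_power_divide_fact[of "Suc N" x], of "cmod (w - w')"]
        by (simp only: times_divide_eq_right)
      show "(F has_vector_derivative - exp_rem N w x - - exp_rem N w' x) (at x)" for x
        unfolding F_def by (intro has_vector_derivative_diff has_vector_derivative_exp_rem w)
      show "cmod (- exp_rem N w x - - exp_rem N w' x) \<le> cmod (w - w') * x ^ Suc N / fact (Suc N)"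
        if "0 < x" for x
        using Suc.IH[of x] that by (simp add: norm_minus_commute)
    qed (use Suc.prems False in \<open>auto intro!: continuous_on_exp_rem continuous_intros simp: F_def\<close>)
    then show ?thesis by (simp add: exp_rem_0_right F_def)
  qed (simp add: exp_rem_0_right)
qed

section \<open>The regularised hypergeometric function\<close>

lemma tendsto_add_nat_div_Suc: "(\<lambda>k. (A + real k) / (real k + 1)) \<longlonglongrightarrow> 1"
proof -
  have "(\<lambda>k. 1 + (A - 1) * inverse (real (Suc k))) \<longlonglongrightarrow> 1 + (A - 1) * 0"
    by (intro tendsto_intros LIMSEQ_inverse_real_of_nat)
  moreover have "1 + (A - 1) * inverse (real (Suc k)) = (A + real k) / (real k + 1)" for k
    by (simp add: field_simps)
  ultimately show ?thesis by simp
qed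

text \<open>This is a majorant for the hypergeometric series from its m-th term on. The factor
  \<open>fact k\<close> in the denominator takes the place of Gamma(c + k + m), and the shift m
  deals with c of small or negative real part.\<close>

lemma summable_pochhammer_ratio:
  fixes a b :: complex and x :: real
  assumes x: "0 \<le> x" "x < 1"
  shows "summable (\<lambda>k. cmod (pochhammer a (k + m)) * cmod (pochhammer b (k + m)) / (fact k * fact (k + m)) * x ^ k)"
    (is "summable ?t")
proof -
  \<comment> \<open>An upper bound for the ratio of consecutive terms; it tends to x, so it is
    finally below the midpoint (1 + x)/2 of x and 1.\<close>
  define q where "q k = (cmod (a + of_nat m) + real k) / (real k + 1) *
      ((cmod (b + of_nat m) + real k) / (real k + 1)) * x" for k
  have "q \<longlonglongrightarrow> 1 * 1 * x"
    unfolding q_def by (intro tendsto_intros tendsto_add_nat_div_Suc)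
  then have "eventually (\<lambda>k. q k < (1 + x) / 2) sequentially"
    using x by (intro order_tendstoD(2)) auto
  then obtain K where K: "\<And>k. k \<ge> K \<Longrightarrow> q k < (1 + x) / 2"
    by (auto simp: eventually_sequentially)
  show ?thesis
  proof (rule summable_ratio_test[of "(1 + x) / 2" K])
    fix k assume k: "k \<ge> K"
    have tri: "cmod (c + of_nat (k + m)) \<le> cmod (c + of_nat m) + real k" for c
      using norm_triangle_ineq[of "c + of_nat m" "of_nat k"] by (simp add: algebra_simps)
    have poch: "cmod (pochhammer c (Suc k + m)) = cmod (pochhammer c (k + m)) * cmod (c + of_nat (k + m))" for c
      by (simp add: pochhammer_Suc norm_mult)
    have facts: "fact (Suc k) = (real k + 1) * fact k" "fact (Suc k + m) = (real (k + m) + 1) * fact (k + m)"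
      by (simp_all add: algebra_simps)
    have "?t (Suc k) = cmod (a + of_nat (k + m)) / (real k + 1) *
        (cmod (b + of_nat (k + m)) / (real (k + m) + 1)) * x * ?t k"
      unfolding poch facts power_Suc times_divide_times_eq times_divide_eq_left times_divide_eq_right
      by (simp only: mult_ac divide_divide_eq_left)
    also have "\<dots> \<le> q k * ?t k"
      unfolding q_def using x
      by (intro mult_right_mono mult_mono frac_le tri) (auto intro!: mult_nonneg_nonneg divide_nonneg_nonneg)
    also have "\<dots> \<le> (1 + x) / 2 * ?t k"
      using K[OF k] x by (intro mult_right_mono) auto
    finally have "?t (Suc k) \<le> (1 + x) / 2 * ?t k" .
    moreover have "0 \<le> ?t j" for j using x by simp
    ultimately show "norm (?t (Suc k)) \<le> (1 + x) / 2 * norm (?t k)"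
      unfolding real_norm_def by (simp only: abs_of_nonneg)
  qed (use x in auto)
qed

lemma fact_le_norm_pochhammer:
  assumes "1 \<le> Re c"
  shows "fact k \<le> cmod (pochhammer c k)"
proof (induction k)
  case (Suc k)
  have le: "real (Suc k) \<le> cmod (c + of_nat k)"
    using complex_Re_le_cmod[of "c + of_nat k"] assms by simp
  show ?case
    using mult_mono[OF Suc.IH le] by (simp add: pochhammer_Suc norm_mult mult.commute)
qed simp

text \<open>A single summable majorant on a disc around c yields both the convergence of the series
  and its holomorphy in c. It rests on rGamma(z + m) = (z + m)_k rGamma(z + m + k): the left side is
  bounded on the disc and the Pochhammer symbol is at least k!.\<close>

lemma hyp2f1_reg_locally_dominated:
  fixes a b c w :: complex
  assumes "cmod w < 1"
  obtains M where "summable M" "\<forall>\<^sub>F n in sequentially. \<forall>z\<in>cball c 1.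
    cmod (pochhammer a n * pochhammer b n * rGamma (z + of_nat n) / fact n * w ^ n) \<le> M n"
proof -
  \<comment> \<open>On the disc Re z >= Re c - 1, so this m gives Re (z + m) >= 1.\<close>
  obtain m :: nat where m: "2 - Re c \<le> real m" using real_arch_simple by blast
  have "compact ((\<lambda>z. rGamma (z + of_nat m)) ` cball c 1)"
    by (intro compact_continuous_image holomorphic_on_imp_continuous_on holomorphic_intros compact_cball)
  then obtain B where B: "\<And>z. z \<in> cball c 1 \<Longrightarrow> cmod (rGamma (z + of_nat m)) \<le> B"
    using compact_imp_bounded bounded_iff by (metis imageI)
  define t where "t k = cmod (pochhammer a (k + m)) * cmod (pochhammer b (k + m)) /
      (fact k * fact (k + m)) * cmod w ^ k" for k
  define M where "M n = B * cmod w ^ m * t (n - m)" for n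
  have "summable t" unfolding t_def using assms by (intro summable_pochhammer_ratio) auto
  then have "summable (\<lambda>k. M (k + m))" unfolding M_def by (simp add: summable_mult)
  then have "summable M" by (rule summable_iff_shift[THEN iffD1])
  moreover have "cmod (pochhammer a n * pochhammer b n * rGamma (z + of_nat n) / fact n * w ^ n) \<le> M n"
    if n: "n \<ge> m" and z: "z \<in> cball c 1" for n z
  proof -
    define k where "k = n - m"
    have nk: "n = k + m" using n by (simp add: k_def)
    have "Re c - 1 \<le> Re z" using z abs_Re_le_cmod[of "c - z"] by (auto simp: dist_norm)
    then have f: "fact k \<le> cmod (pochhammer (z + of_nat m) k)"
      using m by (intro fact_le_norm_pochhammer) simp
    have "rGamma (z + of_nat m) = pochhammer (z + of_nat m) k * rGamma (z + of_nat n)"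
      using pochhammer_rGamma[of "z + of_nat m" k] by (simp add: nk algebra_simps)
    then have "fact k * cmod (rGamma (z + of_nat n)) \<le> B"
      using mult_right_mono[OF f norm_ge_zero[of "rGamma (z + of_nat n)"]] B[OF z]
      by (simp add: norm_mult)
    then have r: "cmod (rGamma (z + of_nat n)) \<le> B / fact k" by (simp add: field_simps)
    have "cmod (pochhammer a n * pochhammer b n * rGamma (z + of_nat n) / fact n * w ^ n) =
        (cmod (pochhammer a n) * cmod (pochhammer b n) / fact n * cmod w ^ n) * cmod (rGamma (z + of_nat n))"
      by (simp add: norm_mult norm_divide norm_power)
    also have "\<dots> \<le> (cmod (pochhammer a n) * cmod (pochhammer b n) / fact n * cmod w ^ n) * (B / fact k)"
      by (intro mult_left_mono r) simp
    also have "\<dots> = M n"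
      unfolding M_def t_def k_def[symmetric] by (simp add: nk power_add field_simps)
    finally show ?thesis .
  qed
  ultimately show ?thesis
    by (intro that[of M] eventually_sequentiallyI[of m] ballI)
qed

lemma summable_hyp2f1_reg:
  fixes a b c w :: complex
  assumes "cmod w < 1"
  shows "summable (\<lambda>n. pochhammer a n * pochhammer b n * rGamma (c + of_nat n) / fact n * w ^ n)"
proof -
  obtain M where M: "summable M" "\<forall>\<^sub>F n in sequentially. \<forall>z\<in>cball c 1.
    cmod (pochhammer a n * pochhammer b n * rGamma (z + of_nat n) / fact n * w ^ n) \<le> M n"
    by (rule hyp2f1_reg_locally_dominated[OF assms, where a = a and b = b and c = c])
  then show ?thesis
    by (intro summable_comparison_test_ev[OF _ M(1)]) (auto elim: eventually_mono)
qed

text \<open>The regularised series is entire in c. The continuation in \<lambda> may therefore pass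
  through \<lambda> = -1/2, -3/2, ..., where c = 1/2 + \<lambda> is a non-positive integer.\<close>

lemma holomorphic_on_hyp2f1_reg:
  fixes a b w :: complex
  assumes "cmod w < 1"
  shows "(\<lambda>c. hyp2f1_reg a b c w) holomorphic_on UNIV"
proof (rule holomorphic_uniform_sequence)
  show "(\<lambda>c. \<Sum>i<n. pochhammer a i * pochhammer b i * rGamma (c + of_nat i) / fact i * w ^ i)
      holomorphic_on UNIV" for n
    by (intro holomorphic_intros) auto
  fix c :: complex
  obtain M where "summable M" "\<forall>\<^sub>F n in sequentially. \<forall>z\<in>cball c 1.
    cmod (pochhammer a n * pochhammer b n * rGamma (z + of_nat n) / fact n * w ^ n) \<le> M n"
    by (rule hyp2f1_reg_locally_dominated[OF assms, where a = a and b = b and c = c])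
  then have "uniform_limit (cball c 1)
      (\<lambda>n c. \<Sum>i<n. pochhammer a i * pochhammer b i * rGamma (c + of_nat i) / fact i * w ^ i)
      (\<lambda>c. hyp2f1_reg a b c w) sequentially"
    unfolding hyp2f1_reg_def by (intro Weierstrass_m_test_ev)
  then show "\<exists>d>0. cball c d \<subseteq> UNIV \<and> uniform_limit (cball c d)
      (\<lambda>n c. \<Sum>i<n. pochhammer a i * pochhammer b i * rGamma (c + of_nat i) / fact i * w ^ i)
      (\<lambda>c. hyp2f1_reg a b c w) sequentially"
    by (intro exI[of _ 1]) simp
qed auto

section \<open>The hypergeometric equation and the cosine as a hypergeometric function\<close>

lemma powser_mult_self_diffs:
  fixes y :: complex
  assumes "summable (\<lambda>n. diffs c n * y ^ n)"
  shows "(\<lambda>n. of_nat n * c n * y ^ n) sums (y * (\<Sum>n. diffs c n * y ^ n))"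
proof -
  have "(\<lambda>n. y * (of_nat n * c n * y ^ (n - Suc 0))) sums (y * (\<Sum>n. diffs c n * y ^ n))"
    by (intro sums_mult diffs_equiv assms)
  moreover have "y * (of_nat n * c n * y ^ (n - Suc 0)) = of_nat n * c n * y ^ n" for n
    by (cases n) simp_all
  ultimately show ?thesis by simp
qed

text \<open>With the Euler operator y d/dy, which multiplies the n-th coefficient by n, the equation
  is the recursion (c + n)(n + 1) h_(n+1) = (a + n)(b + n) h_n. Having rGamma in the coefficients
  makes it true for every c.\<close>

lemma hyp2f1_reg_ode:
  fixes a b c :: complex
  obtains T1 T2 where
    "\<And>y. cmod y < 1 \<Longrightarrow> (hyp2f1_reg a b c has_field_derivative T1 y) (at y)"
    "\<And>y. cmod y < 1 \<Longrightarrow> (T1 has_field_derivative T2 y) (at y)"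
    "\<And>y. cmod y < 1 \<Longrightarrow> y * (1 - y) * T2 y + (c - (a + b + 1) * y) * T1 y = a * b * hyp2f1_reg a b c y"
proof
  define h where "h n = pochhammer a n * pochhammer b n * rGamma (c + of_nat n) / fact n" for n
  define T1 where "T1 y = (\<Sum>n. diffs h n * y ^ n)" for y
  define T2 where "T2 y = (\<Sum>n. diffs (diffs h) n * y ^ n)" for y
  have T: "hyp2f1_reg a b c = (\<lambda>y. \<Sum>n. h n * y ^ n)"
    by (simp add: hyp2f1_reg_def h_def fun_eq_iff)
  have s0: "summable (\<lambda>n. h n * y ^ n)" if "cmod y < 1" for y
    unfolding h_def by (rule summable_hyp2f1_reg[OF that])
  have s1: "summable (\<lambda>n. diffs h n * y ^ n)" if "cmod y < 1" for y
    by (rule termdiff_converges[OF that s0])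
  have s2: "summable (\<lambda>n. diffs (diffs h) n * y ^ n)" if "cmod y < 1" for y
    by (rule termdiff_converges[OF that s1])
  show "(hyp2f1_reg a b c has_field_derivative T1 y) (at y)" if "cmod y < 1" for y
    unfolding T T1_def by (rule termdiffs_strong'[OF s0 that])
  show "(T1 has_field_derivative T2 y) (at y)" if "cmod y < 1" for y
    unfolding T1_def T2_def by (rule termdiffs_strong'[OF s1 that])
  show "y * (1 - y) * T2 y + (c - (a + b + 1) * y) * T1 y = a * b * hyp2f1_reg a b c y"
    if y: "cmod y < 1" for y
  proof -
    have A: "(\<lambda>n. diffs h n * y ^ n) sums T1 y"
      unfolding T1_def by (rule summable_sums[OF s1[OF y]])
    have B: "(\<lambda>n. of_nat n * h n * y ^ n) sums (y * T1 y)"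
      unfolding T1_def by (rule powser_mult_self_diffs[OF s1[OF y]])
    have C: "(\<lambda>n. of_nat n * diffs h n * y ^ n) sums (y * T2 y)"
      unfolding T2_def by (rule powser_mult_self_diffs[OF s2[OF y]])
    have "(\<lambda>n. diffs h n * y ^ n + of_nat n * diffs h n * y ^ n) sums (T1 y + y * T2 y)"
      by (rule sums_add[OF A C])
    also have "(\<lambda>n. diffs h n * y ^ n + of_nat n * diffs h n * y ^ n) =
        (\<lambda>n. diffs (\<lambda>n. of_nat n * h n) n * y ^ n)"
      by (auto simp: diffs_def algebra_simps)
    finally have D: "(\<lambda>n. diffs (\<lambda>n. of_nat n * h n) n * y ^ n) sums (T1 y + y * T2 y)" .
    have E: "(\<lambda>n. of_nat n * (of_nat n * h n) * y ^ n) sums (y * (T1 y + y * T2 y))"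
      using powser_mult_self_diffs[OF sums_summable[OF D]] sums_unique[OF D] by simp
    have F: "(\<lambda>n. h n * y ^ n) sums hyp2f1_reg a b c y"
      unfolding T by (rule summable_sums[OF s0[OF y]])
    have L: "(\<lambda>n. of_nat n * diffs h n * y ^ n + c * (diffs h n * y ^ n)) sums (y * T2 y + c * T1 y)"
      by (intro sums_add sums_mult A C)
    have R: "(\<lambda>n. of_nat n * (of_nat n * h n) * y ^ n + (a + b) * (of_nat n * h n * y ^ n)
        + a * b * (h n * y ^ n)) sums (y * (T1 y + y * T2 y) + (a + b) * (y * T1 y) + a * b * hyp2f1_reg a b c y)"
      by (intro sums_add sums_mult B E F)
    have eq: "of_nat n * diffs h n * y ^ n + c * (diffs h n * y ^ n) =
        of_nat n * (of_nat n * h n) * y ^ n + (a + b) * (of_nat n * h n * y ^ n) + a * b * (h n * y ^ n)" for n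
    proof -
      have "(c + of_nat n) * rGamma (c + of_nat (Suc n)) = rGamma (c + of_nat n)"
        using rGamma_plus1[of "c + of_nat n"] by (simp add: algebra_simps)
      moreover have "diffs h n = (a + of_nat n) * (b + of_nat n) * pochhammer a n * pochhammer b n *
          rGamma (c + of_nat (Suc n)) / fact n"
        by (simp add: diffs_def h_def pochhammer_Suc field_simps del: of_nat_Suc)
      ultimately have "(c + of_nat n) * diffs h n = (a + of_nat n) * (b + of_nat n) * h n"
        by (simp add: h_def mult_ac)
      then have "(c + of_nat n) * diffs h n * y ^ n = (a + of_nat n) * (b + of_nat n) * h n * y ^ n"
        by simp
      then show ?thesis by (simp add: algebra_simps)
    qed
    have "y * T2 y + c * T1 y =
        y * (T1 y + y * T2 y) + (a + b) * (y * T1 y) + a * b * hyp2f1_reg a b c y"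
      by (rule sums_unique2[OF L[unfolded eq] R])
    then show ?thesis by (simp add: algebra_simps)
  qed
qed

text \<open>Both sides solve \<open>h'' = - s\<^sup>2 h\<close>; the first integrals \<open>(h' \<plusminus> i s h) exp (\<minusplus> i s \<phi>)\<close> are constant.\<close>

lemma cos_eq_hyp2f1_reg:
  fixes s :: complex and \<phi> :: real
  assumes s: "s \<noteq> 0" and \<phi>: "\<bar>\<phi>\<bar> < pi"
  shows "cos (s * of_real \<phi>) = of_real (sqrt pi) * of_real (cos (\<phi> / 2)) *
    hyp2f1_reg (s + 1 / 2) (1 / 2 - s) (1 / 2) (of_real ((sin (\<phi> / 2))\<^sup>2))"
proof -
  define T where "T = hyp2f1_reg (s + 1 / 2) (1 / 2 - s) (1 / 2)"
  obtain T1 T2 where T1: "\<And>y. cmod y < 1 \<Longrightarrow> (T has_field_derivative T1 y) (at y)"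
    and T2: "\<And>y. cmod y < 1 \<Longrightarrow> (T1 has_field_derivative T2 y) (at y)"
    and ode: "\<And>y. cmod y < 1 \<Longrightarrow> y * (1 - y) * T2 y + (1 / 2 - (s + 1 / 2 + (1 / 2 - s) + 1) * y) * T1 y
        = (s + 1 / 2) * (1 / 2 - s) * T y"
    unfolding T_def by (rule hyp2f1_reg_ode[of "s + 1 / 2" "1 / 2 - s" "1 / 2"]) auto
  define y where "y z = (sin (z / 2))\<^sup>2" for z :: complex
  define H where "H z = cos (z / 2) * T (y z)" for z
  define H1 where "H1 z = - (sin (z / 2) * T (y z)) / 2 + (cos (z / 2))\<^sup>2 * sin (z / 2) * T1 (y z)" for z
  \<comment> \<open>The series is available only where |y| < 1, so the constancy of the first
    integrals is derived on the segment from 0 to \<phi>.\<close>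
  define I where "I = closed_segment 0 (complex_of_real \<phi>)"
  have y1: "cmod (y z) < 1" if z: "z \<in> I" for z
  proof -
    obtain t where t: "z = of_real t" "\<bar>t\<bar> \<le> \<bar>\<phi>\<bar>"
      using z by (auto simp: I_def closed_segment_def abs_mult mult_left_le_one_le scaleR_conv_of_real
          simp flip: of_real_mult)
    have "cos (t / 2) > 0" using t \<phi> by (intro cos_gt_zero_pi) auto
    then have "(sin (t / 2))\<^sup>2 < 1" by (simp add: sin_squared_eq)
    moreover have "y z = of_real ((sin (t / 2))\<^sup>2)"
      using t by (simp add: y_def sin_of_real[symmetric] del: sin_of_real)
    ultimately show ?thesis by (simp del: of_real_power)
  qed
  have dy: "(y has_field_derivative sin (z / 2) * cos (z / 2)) (at z)" for z
    unfolding y_def by (rule derivative_eq_intros refl | simp)+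
  have dT: "((\<lambda>z. T (y z)) has_field_derivative T1 (y z) * (sin (z / 2) * cos (z / 2))) (at z)"
    "((\<lambda>z. T1 (y z)) has_field_derivative T2 (y z) * (sin (z / 2) * cos (z / 2))) (at z)" if "z \<in> I" for z
    using that by (auto intro!: DERIV_chain2[OF T1 dy] DERIV_chain2[OF T2 dy] y1)
  have dH: "(H has_field_derivative H1 z) (at z)" if "z \<in> I" for z
    unfolding H_def H1_def
    by (rule derivative_eq_intros dT[OF that] refl | simp)+ (simp add: algebra_simps power2_eq_square)
  have dH1: "(H1 has_field_derivative - s\<^sup>2 * H z) (at z)" if z: "z \<in> I" for z
  proof -
    define S C where "S = sin (z / 2)" and "C = cos (z / 2)"
    have SC: "C\<^sup>2 = 1 - S\<^sup>2" by (simp add: S_def C_def cos_squared_eq)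
    have "(H1 has_field_derivative
       - (C / 2 * T (y z) + S * (T1 (y z) * (S * C))) / 2
       + ((2 * C * (- S / 2) * S + C\<^sup>2 * (C / 2)) * T1 (y z) + C\<^sup>2 * S * (T2 (y z) * (S * C)))) (at z)"
      unfolding H1_def S_def C_def
      by (rule derivative_eq_intros dT[OF z] refl | simp)+ (simp add: field_simps)
    \<comment> \<open>With y = S^2 and 1 - y = C^2, the second derivative is C times the
      hypergeometric operator applied to T, minus C T/4. The operator returns (1/4 - s^2) T, so only
      -s^2 C T is left.\<close>
    moreover have "- (C / 2 * T (y z) + S * (T1 (y z) * (S * C))) / 2
       + ((2 * C * (- S / 2) * S + C\<^sup>2 * (C / 2)) * T1 (y z) + C\<^sup>2 * S * (T2 (y z) * (S * C)))
       = C * (y z * (1 - y z) * T2 (y z) + (1 / 2 - 2 * y z) * T1 (y z) - T (y z) / 4)"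
    proof -
      have yz: "y z = S\<^sup>2" by (simp add: y_def S_def)
      show ?thesis unfolding SC yz
        by (simp add: field_simps power2_eq_square)
    qed
    moreover have "y z * (1 - y z) * T2 (y z) + (1 / 2 - 2 * y z) * T1 (y z) = (s + 1 / 2) * (1 / 2 - s) * T (y z)"
      using ode[OF y1[OF z]] by simp
    moreover have "C * ((s + 1 / 2) * (1 / 2 - s) * T (y z) - T (y z) / 4) = - s\<^sup>2 * H z"
      by (simp add: H_def C_def field_simps power2_eq_square)
    ultimately show ?thesis by simp
  qed
  have first_int: "H1 z + \<i> * \<sigma> * H z = \<i> * \<sigma> * rGamma (1 / 2) * exp (\<i> * \<sigma> * z)"
    if z: "z \<in> I" and \<sigma>: "\<sigma>\<^sup>2 = s\<^sup>2" for z \<sigma>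
  proof -
    define G where "G z = (H1 z + \<i> * \<sigma> * H z) * exp (- (\<i> * \<sigma> * z))" for z
    have "(G has_field_derivative 0) (at z within I)" if "z \<in> I" for z
    proof (rule has_field_derivative_at_within)
      have "(G has_field_derivative ((- s\<^sup>2 * H z + \<i> * \<sigma> * H1 z) * exp (- (\<i> * \<sigma> * z))
          + exp (- (\<i> * \<sigma> * z)) * (- (\<i> * \<sigma>)) * (H1 z + \<i> * \<sigma> * H z))) (at z)"
        unfolding G_def by (rule derivative_eq_intros dH[OF that] dH1[OF that] refl | simp)+
      moreover have "((- s\<^sup>2 * H z + \<i> * \<sigma> * H1 z) * exp (- (\<i> * \<sigma> * z))
          + exp (- (\<i> * \<sigma> * z)) * (- (\<i> * \<sigma>)) * (H1 z + \<i> * \<sigma> * H z)) =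
          exp (- (\<i> * \<sigma> * z)) * (\<sigma>\<^sup>2 - s\<^sup>2) * H z"
        by (simp add: algebra_simps power2_eq_square)
      ultimately show "(G has_field_derivative 0) (at z)" using \<sigma> by simp
    qed
    then obtain k where k: "\<And>z. z \<in> I \<Longrightarrow> G z = k"
      using has_field_derivative_zero_constant[of I G] by (auto simp: I_def)
    have "T 0 = rGamma (1 / 2)"
      unfolding T_def hyp2f1_reg_def powser_zero by simp
    then have "G 0 = \<i> * \<sigma> * rGamma (1 / 2)"
      by (simp add: G_def H1_def H_def y_def)
    then have "G z = \<i> * \<sigma> * rGamma (1 / 2)"
      using k[of 0] k[OF z] by (simp add: I_def)
    then have "G z * exp (\<i> * \<sigma> * z) = \<i> * \<sigma> * rGamma (1 / 2) * exp (\<i> * \<sigma> * z)" by simp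
    then show ?thesis by (simp add: G_def exp_minus mult.assoc)
  qed
  have phi: "of_real \<phi> \<in> I" by (simp add: I_def)
  \<comment> \<open>Subtracting the first integrals for \<sigma> = s and \<sigma> = -s eliminates
    H1; dividing by 2 i s then uses s \<noteq> 0.\<close>
  have "2 * \<i> * s * H (of_real \<phi>) = (H1 (of_real \<phi>) + \<i> * s * H (of_real \<phi>))
      - (H1 (of_real \<phi>) + \<i> * (- s) * H (of_real \<phi>))" by (simp add: algebra_simps)
  also have "\<dots> = \<i> * s * rGamma (1 / 2) * (exp (\<i> * s * of_real \<phi>) + exp (- (\<i> * s * of_real \<phi>)))"
    using first_int[OF phi, of s] first_int[OF phi, of "- s"] by (simp add: algebra_simps)
  also have "\<dots> = 2 * \<i> * s * (rGamma (1 / 2) * cos (s * of_real \<phi>))"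
    by (simp add: cos_exp_eq mult.assoc)
  finally have "H (of_real \<phi>) = rGamma (1 / 2) * cos (s * of_real \<phi>)" using s by simp
  moreover have "rGamma (1 / 2 :: complex) * of_real (sqrt pi) = 1"
    by (simp add: rGamma_inverse_Gamma Gamma_one_half_complex)
  ultimately have "cos (s * of_real \<phi>) = of_real (sqrt pi) * H (of_real \<phi>)"
    by (metis mult.commute mult.left_commute mult.right_neutral)
  also have "H (of_real \<phi>) = of_real (cos (\<phi> / 2)) * T (of_real ((sin (\<phi> / 2))\<^sup>2))"
    unfolding H_def y_def by (simp add: cos_of_real[symmetric] sin_of_real[symmetric] del: sin_of_real cos_of_real)
  finally show ?thesis by (simp add: T_def mult.assoc)
qed

section \<open>The Mehler--Dirichlet integral\<close>

lemma cos_diff_eq_sin_half_squared: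
  fixes x y :: real
  shows "cos x - cos y = 2 * ((sin (y / 2))\<^sup>2 - (sin (x / 2))\<^sup>2)"
  using cos_double_sin[of "x / 2"] cos_double_sin[of "y / 2"] by simp

text \<open>The substitution t = (sin(\<phi>/2) / sin(\<zeta>/2))^2 gives cos \<phi> - cos \<zeta> =
  2 sin^2(\<zeta>/2) (1 - t), and the factor cos(\<phi>/2) belongs to the Jacobian. What remains is
  Euler's Beta integral.\<close>

lemma has_integral_cos_sin_half_Beta:
  fixes \<zeta> l :: real
  assumes z: "0 < \<zeta>" "\<zeta> < pi" and l: "0 < l"
  shows "((\<lambda>\<phi>. cos (\<phi> / 2) * (sin (\<phi> / 2)) ^ (2 * n) * (cos \<phi> - cos \<zeta>) powr (l - 1)) has_integral
     2 powr (l - 1) * (sin (\<zeta> / 2)) powr (2 * l - 1) * (sin (\<zeta> / 2)) ^ (2 * n) * Beta (real n + 1 / 2) l) {0..\<zeta>}"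
proof -
  define S where "S = sin (\<zeta> / 2)"
  have S: "0 < S" "S < 1"
  proof -
    show "0 < S" using z by (auto simp: S_def intro!: sin_gt_zero)
    have "sin (\<zeta> / 2) < sin (pi / 2)" using z by (intro sin_monotone_2pi) auto
    then show "S < 1" by (simp add: S_def)
  qed
  let ?f = "\<lambda>t::real. t powr (real n - 1 / 2) * (1 - t) powr (l - 1)"
  let ?g = "\<lambda>\<phi>::real. (sin (\<phi> / 2))\<^sup>2 / S\<^sup>2"
  let ?g' = "\<lambda>\<phi>::real. sin (\<phi> / 2) * cos (\<phi> / 2) / S\<^sup>2"
  have pos: "0 < sin (\<phi> / 2)" "sin (\<phi> / 2) < S" "0 < cos (\<phi> / 2)" if "\<phi> \<in> {0<..<\<zeta>}" for \<phi>
    using that z unfolding S_def by (auto intro!: sin_gt_zero cos_gt_zero sin_monotone_2pi)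
  have im: "?g ` {0<..<\<zeta>} = {0<..<1}"
  proof safe
    fix \<phi> assume "\<phi> \<in> {0<..<\<zeta>}"
    from pos[OF this] show "?g \<phi> \<in> {0<..<1}"
      using S by (auto simp: power_strict_mono)
  next
    fix t :: real assume t: "t \<in> {0<..<1}"
    \<comment> \<open>The preimage of t is 2 arcsin(sqrt t S).\<close>
    define x where "x = sqrt t * S"
    have "sqrt t < 1" using t by auto
    then have "sqrt t * S < 1 * S" using S by (intro mult_strict_right_mono)
    then have x: "0 < x" "x < S" using t S by (auto simp: x_def)
    have "arcsin x < arcsin S" using x S by (intro arcsin_less_arcsin) auto
    also have "arcsin S = \<zeta> / 2" unfolding S_def using z by (intro arcsin_sin) auto
    finally have "2 * arcsin x \<in> {0<..<\<zeta>}"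
      using arcsin_less_arcsin[of 0 x] x S by auto
    moreover have "t = ?g (2 * arcsin x)"
    proof -
      have "sin (2 * arcsin x / 2) = x" using x S by simp
      then have "?g (2 * arcsin x) = x\<^sup>2 / S\<^sup>2" by (simp only:)
      also have "\<dots> = t" using S t by (simp add: x_def power_mult_distrib)
      finally show ?thesis by (rule sym)
    qed
    ultimately show "t \<in> ?g ` {0<..<\<zeta>}" by blast
  qed
  have inj: "inj_on ?g {0<..<\<zeta>}"
  proof (rule inj_onI)
    fix x y assume x: "x \<in> {0<..<\<zeta>}" and y: "y \<in> {0<..<\<zeta>}" and "?g x = ?g y"
    then have eq: "sin (x / 2) = sin (y / 2)"
      using S pos[OF x] pos[OF y] by (simp add: power2_eq_iff)
    have bounds: "- (pi / 2) \<le> x / 2" "x / 2 \<le> pi / 2" "- (pi / 2) \<le> y / 2" "y / 2 \<le> pi / 2"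
      using x y z by auto
    from eq have "x / 2 = y / 2" by (rule sin_inj_pi[OF bounds])
    then show "x = y" by simp
  qed
  have der: "(?g has_field_derivative ?g' x) (at x within {0<..<\<zeta>})" for x
    by (rule DERIV_cdivide) (auto intro!: derivative_eq_intros)
  have "(?f has_integral Beta (real n + 1 / 2) l) {0<..<1}"
    using has_integral_Beta_real[of "real n + 1 / 2" l] l by (simp add: has_integral_Icc_iff_Ioo)
  then have "?f absolutely_integrable_on {0<..<1} \<and> integral {0<..<1} ?f = Beta (real n + 1 / 2) l"
    by (auto intro!: nonnegative_absolutely_integrable_1 simp: integral_unique has_integral_integrable)
  then have "(\<lambda>x. \<bar>?g' x\<bar> *\<^sub>R ?f (?g x)) absolutely_integrable_on {0<..<\<zeta>} \<and>
      integral {0<..<\<zeta>} (\<lambda>x. \<bar>?g' x\<bar> *\<^sub>R ?f (?g x)) = Beta (real n + 1 / 2) l"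
    unfolding im[symmetric] by (subst has_absolute_integral_change_of_variables_real[OF _ der inj]) auto
  then have A: "(\<lambda>x. \<bar>?g' x\<bar> *\<^sub>R ?f (?g x)) absolutely_integrable_on {0<..<\<zeta>}"
    and B: "integral {0<..<\<zeta>} (\<lambda>x. \<bar>?g' x\<bar> *\<^sub>R ?f (?g x)) = Beta (real n + 1 / 2) l"
    by blast+
  from integrable_integral[OF set_lebesgue_integral_eq_integral(1)[OF A]]
  have "((\<lambda>x. \<bar>?g' x\<bar> *\<^sub>R ?f (?g x)) has_integral Beta (real n + 1 / 2) l) {0<..<\<zeta>}"
    unfolding B .
  then have "((\<lambda>x. 2 powr (l - 1) * S powr (2 * l - 1) * S ^ (2 * n) * (\<bar>?g' x\<bar> *\<^sub>R ?f (?g x)))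
      has_integral 2 powr (l - 1) * S powr (2 * l - 1) * S ^ (2 * n) * Beta (real n + 1 / 2) l) {0<..<\<zeta>}"
    by (rule has_integral_mult_right)
  moreover have "2 powr (l - 1) * S powr (2 * l - 1) * S ^ (2 * n) * (\<bar>?g' x\<bar> *\<^sub>R ?f (?g x)) =
      cos (x / 2) * (sin (x / 2)) ^ (2 * n) * (cos x - cos \<zeta>) powr (l - 1)" if "x \<in> {0<..<\<zeta>}" for x
  proof -
    define u where "u = sin (x / 2)"
    have u: "0 < u" "u < S" "0 < cos (x / 2)" using pos[OF that] by (simp_all add: u_def)
    have u2: "u\<^sup>2 < S\<^sup>2" using u by (intro power_strict_mono) auto
    have D: "cos x - cos \<zeta> = 2 * (S\<^sup>2 - u\<^sup>2)"
      unfolding u_def S_def by (rule cos_diff_eq_sin_half_squared)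
    have sq: "(c\<^sup>2) powr p = c powr (2 * p)" if "0 < c" for c p :: real
      using that powr_powr[of c 2 p] by simp
    have "1 - u\<^sup>2 / S\<^sup>2 = (S\<^sup>2 - u\<^sup>2) / S\<^sup>2" using S by (simp add: diff_divide_distrib)
    then have "(1 - u\<^sup>2 / S\<^sup>2) powr (l - 1) = (S\<^sup>2 - u\<^sup>2) powr (l - 1) / (S\<^sup>2) powr (l - 1)"
      using S u2 by (simp add: powr_divide)
    then have e1: "(1 - u\<^sup>2 / S\<^sup>2) powr (l - 1) = (S\<^sup>2 - u\<^sup>2) powr (l - 1) / S powr (2 * l - 2)"
      unfolding sq[OF S(1)] by (simp add: right_diff_distrib)
    have half: "c powr (2 * (real n - 1 / 2)) = c ^ (2 * n) / c" if "0 < c" for c :: real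
      using that powr_realpow[of c "2 * n"] by (simp add: right_diff_distrib powr_diff)
    have e2: "(u\<^sup>2 / S\<^sup>2) powr (real n - 1 / 2) = u ^ (2 * n) / u / (S ^ (2 * n) / S)"
      using S u by (simp only: powr_divide sq half)
    have e3: "S powr (2 * l - 1) = S powr (2 * l - 2) * S"
      using S powr_add[of S "2 * l - 2" 1] by simp
    have e4: "(2 * (S\<^sup>2 - u\<^sup>2)) powr (l - 1) = 2 powr (l - 1) * (S\<^sup>2 - u\<^sup>2) powr (l - 1)"
      by (rule powr_mult)
    have "\<bar>?g' x\<bar> = u * cos (x / 2) / S\<^sup>2" using u by (simp add: u_def abs_mult)
    then show ?thesis
      unfolding D e3 e4 u_def[symmetric] e1 e2 using S u
      by (simp add: field_simps power2_eq_square)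
  qed
  ultimately have "((\<lambda>x. cos (x / 2) * (sin (x / 2)) ^ (2 * n) * (cos x - cos \<zeta>) powr (l - 1)) has_integral
     2 powr (l - 1) * S powr (2 * l - 1) * S ^ (2 * n) * Beta (real n + 1 / 2) l) {0<..<\<zeta>}"
    by (rule has_integral_eq[rotated])
  then show ?thesis unfolding S_def by (simp add: has_integral_Icc_iff_Ioo)
qed


text \<open>The cosine is expanded in powers of sin^2(\<phi>/2) and integrated termwise. Convergence
  is uniform because sin^2(\<phi>/2) <= sin^2(\<zeta>/2) < 1 and the kernel is bounded for l >
  1.\<close>

lemma Mehler_Dirichlet:
  fixes \<zeta> l :: real and s :: complex
  assumes z: "0 < \<zeta>" "\<zeta> < pi" and l: "1 < l" and s: "s \<noteq> 0"
  shows "((\<lambda>\<phi>. cos (s * of_real \<phi>) * of_real ((cos \<phi> - cos \<zeta>) powr (l - 1))) has_integral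
     of_real (2 powr (l - 1) * sqrt pi * Gamma l * (sin (\<zeta> / 2)) powr (2 * l - 1)) *
     hyp2f1_reg (s + 1 / 2) (1 / 2 - s) (1 / 2 + of_real l) (of_real ((sin (\<zeta> / 2))\<^sup>2))) {0..\<zeta>}"
proof -
  define S where "S = sin (\<zeta> / 2)"
  have S: "0 < S" "S < 1"
  proof -
    show "0 < S" using z by (auto simp: S_def intro!: sin_gt_zero)
    have "sin (\<zeta> / 2) < sin (pi / 2)" using z by (intro sin_monotone_2pi) auto
    then show "S < 1" by (simp add: S_def)
  qed
  have S2: "S\<^sup>2 < 1" using S by (simp add: power_less_one_iff abs_square_less_1)
  define A where "A n = pochhammer (s + 1 / 2) n * pochhammer (1 / 2 - s) n / fact n" for n
  define h where "h n = of_real (sqrt pi) * A n * rGamma (1 / 2 + of_nat n)" for n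
  define K where "K \<phi> = (cos \<phi> - cos \<zeta>) powr (l - 1)" for \<phi>
  define f where "f n \<phi> = h n * of_real (cos (\<phi> / 2) * (sin (\<phi> / 2)) ^ (2 * n) * K \<phi>)" for n \<phi>
  have bounds: "0 \<le> cos \<phi> - cos \<zeta>" "cos \<phi> - cos \<zeta> \<le> 2" "\<bar>sin (\<phi> / 2)\<bar> \<le> S" "\<bar>\<phi>\<bar> < pi"
    if "\<phi> \<in> {0..\<zeta>}" for \<phi>
  proof -
    show "0 \<le> cos \<phi> - cos \<zeta>" using that z by (simp add: cos_mono_le_eq)
    show "cos \<phi> - cos \<zeta> \<le> 2" using cos_le_one[of \<phi>] cos_ge_minus_one[of \<zeta>] by linarith
    have "0 \<le> sin (\<phi> / 2)" using that z by (intro sin_ge_zero) auto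
    moreover have "sin (\<phi> / 2) \<le> sin (\<zeta> / 2)" using that z by (intro sin_monotone_2pi_le) auto
    ultimately show "\<bar>sin (\<phi> / 2)\<bar> \<le> S" by (simp add: S_def)
    show "\<bar>\<phi>\<bar> < pi" using that z by auto
  qed
  have contK: "continuous_on {0..\<zeta>} K"
    unfolding K_def using l bounds(1) by (intro continuous_on_powr' continuous_intros) auto
  have K: "0 \<le> K \<phi>" "K \<phi> \<le> 2 powr (l - 1)" if "\<phi> \<in> {0..\<zeta>}" for \<phi>
    unfolding K_def using bounds[OF that] l by (auto intro!: powr_mono2)
  have lim: "uniform_limit {0..\<zeta>} (\<lambda>n \<phi>. \<Sum>i<n. f i \<phi>) (\<lambda>\<phi>. \<Sum>i. f i \<phi>) sequentially"
  proof (rule Weierstrass_m_test)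
    have "summable (\<lambda>n. cmod (A n * rGamma (1 / 2 + of_nat n) * of_real (S\<^sup>2) ^ n))"
    proof (rule powser_insidea)
      \<comment> \<open>Convergence at a point strictly between S^2 and 1 gives absolute convergence
        at S^2.\<close>
      define r where "r = (1 + S\<^sup>2) / 2"
      have r: "S\<^sup>2 < r" "r < 1" "0 < r" using S2 zero_le_power2[of S] by (auto simp: r_def add_pos_nonneg)
      show "summable (\<lambda>n. A n * rGamma (1 / 2 + of_nat n) * complex_of_real r ^ n)"
        unfolding A_def using summable_hyp2f1_reg[of "of_real r" "s + 1 / 2" "1 / 2 - s" "1 / 2"] r by simp
      show "cmod (of_real (S\<^sup>2)) < cmod (of_real r)" using r by (simp del: of_real_power)
    qed
    then show "summable (\<lambda>n. sqrt pi * 2 powr (l - 1) * cmod (A n * rGamma (1 / 2 + of_nat n) * of_real (S\<^sup>2) ^ n))"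
      by (rule summable_mult)
    fix n \<phi> assume p: "\<phi> \<in> {0..\<zeta>}"
    have "\<bar>cos (\<phi> / 2) * (sin (\<phi> / 2)) ^ (2 * n) * K \<phi>\<bar> \<le> 1 * S ^ (2 * n) * 2 powr (l - 1)"
      unfolding abs_mult power_abs
      by (intro mult_mono power_mono bounds(3)[OF p])
         (use bounds(3)[OF p] K[OF p] S in \<open>simp_all add: abs_cos_le_one\<close>)
    then have "cmod (f n \<phi>) \<le> cmod (h n) * (S ^ (2 * n) * 2 powr (l - 1))"
      unfolding f_def norm_mult norm_of_real by (intro mult_left_mono) auto
    also have "\<dots> = sqrt pi * 2 powr (l - 1) * cmod (A n * rGamma (1 / 2 + of_nat n) * of_real (S\<^sup>2) ^ n)"
      using S by (simp add: h_def norm_mult norm_power power_mult)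
    finally show "cmod (f n \<phi>) \<le> sqrt pi * 2 powr (l - 1) * cmod (A n * rGamma (1 / 2 + of_nat n) * of_real (S\<^sup>2) ^ n)" .
  qed
  have cont: "continuous_on {0..\<zeta>} (\<lambda>\<phi>. \<Sum>i<n. f i \<phi>)" for n
    unfolding f_def by (intro continuous_intros contK) auto
  obtain I J where I: "\<And>n. ((\<lambda>\<phi>. \<Sum>i<n. f i \<phi>) has_integral I n) {0..\<zeta>}"
    and J: "((\<lambda>\<phi>. \<Sum>i. f i \<phi>) has_integral J) {0..\<zeta>}" and IJ: "I \<longlonglongrightarrow> J"
    using uniform_limit_integral[OF lim cont] by auto
  define c where "c = 2 powr (l - 1) * sqrt pi * Gamma l * S powr (2 * l - 1)"
  have fint: "(f n has_integral of_real c * (A n * rGamma (1 / 2 + of_real l + of_nat n) * of_real (S\<^sup>2) ^ n)) {0..\<zeta>}" for n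
  proof -
    have "((\<lambda>\<phi>. complex_of_real (cos (\<phi> / 2) * (sin (\<phi> / 2)) ^ (2 * n) * K \<phi>)) has_integral
       of_real (2 powr (l - 1) * S powr (2 * l - 1) * S ^ (2 * n) * Beta (real n + 1 / 2) l)) {0..\<zeta>}"
      unfolding K_def S_def using z l by (intro has_integral_of_real has_integral_cos_sin_half_Beta) auto
    then have "(f n has_integral h n *
       of_real (2 powr (l - 1) * S powr (2 * l - 1) * S ^ (2 * n) * Beta (real n + 1 / 2) l)) {0..\<zeta>}"
      unfolding f_def by (rule has_integral_mult_right)
    moreover have "h n * of_real (2 powr (l - 1) * S powr (2 * l - 1) * S ^ (2 * n) * Beta (real n + 1 / 2) l)
      = of_real c * (A n * rGamma (1 / 2 + of_real l + of_nat n) * of_real (S\<^sup>2) ^ n)"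
    proof -
      have "rGamma (1 / 2 + of_nat n) * complex_of_real (Beta (real n + 1 / 2) l) =
          rGamma (complex_of_real (real n + 1 / 2)) * of_real (Beta (real n + 1 / 2) l)"
        by (simp add: add.commute)
      also have "\<dots> = of_real (rGamma (real n + 1 / 2) * Beta (real n + 1 / 2) l)"
        by (simp only: rGamma_complex_of_real of_real_mult)
      \<comment> \<open>Gamma(n + 1/2) cancels; this moves the third hypergeometric parameter from
        1/2 to 1/2 + l.\<close>
      also have "rGamma (real n + 1 / 2) * Beta (real n + 1 / 2) l = Gamma l * rGamma (1 / 2 + l + real n)"
      proof -
        have G: "Gamma (real n + 1 / 2) \<noteq> 0" using Gamma_real_pos[of "real n + 1 / 2"] by linarith
        have "rGamma (real n + 1 / 2) * Beta (real n + 1 / 2) l = Gamma l * rGamma (real n + 1 / 2 + l)"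
          unfolding Beta_def rGamma_inverse_Gamma divide_inverse using G by simp
        also have "real n + 1 / 2 + l = 1 / 2 + l + real n" by simp
        finally show ?thesis .
      qed
      also have "complex_of_real (Gamma l * rGamma (1 / 2 + l + real n)) =
          of_real (Gamma l) * rGamma (1 / 2 + of_real l + of_nat n)"
        by (simp add: rGamma_complex_of_real[symmetric])
      finally have "rGamma (1 / 2 + of_nat n) * complex_of_real (Beta (real n + 1 / 2) l) =
          of_real (Gamma l) * rGamma (1 / 2 + of_real l + of_nat n)" .
      moreover have "complex_of_real (S ^ (2 * n)) = of_real (S\<^sup>2) ^ n"
        by (simp only: power_mult of_real_power)
      ultimately show ?thesis
        unfolding h_def c_def of_real_mult by (simp only: mult_ac)
    qed
    ultimately show ?thesis by simp
  qed
  have "I = (\<lambda>n. \<Sum>i<n. of_real c * (A i * rGamma (1 / 2 + of_real l + of_nat i) * of_real (S\<^sup>2) ^ i))"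
    by (intro ext has_integral_unique[OF I] has_integral_sum fint) auto
  then have "(\<lambda>i. of_real c * (A i * rGamma (1 / 2 + of_real l + of_nat i) * of_real (S\<^sup>2) ^ i)) sums J"
    using IJ by (simp add: sums_def)
  moreover have "(\<lambda>i. of_real c * (A i * rGamma (1 / 2 + of_real l + of_nat i) * of_real (S\<^sup>2) ^ i)) sums
      (of_real c * hyp2f1_reg (s + 1 / 2) (1 / 2 - s) (1 / 2 + of_real l) (of_real (S\<^sup>2)))"
  proof (intro sums_mult)
    have "cmod (of_real (S\<^sup>2)) < 1" using S2 by (simp del: of_real_power)
    from summable_sums[OF summable_hyp2f1_reg[OF this, of "s + 1 / 2" "1 / 2 - s" "1 / 2 + of_real l"]]
    show "(\<lambda>i. A i * rGamma (1 / 2 + of_real l + of_nat i) * of_real (S\<^sup>2) ^ i) sums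
        hyp2f1_reg (s + 1 / 2) (1 / 2 - s) (1 / 2 + of_real l) (of_real (S\<^sup>2))"
      unfolding hyp2f1_reg_def A_def by (simp del: of_real_power)
  qed
  ultimately have Jval: "J = of_real c * hyp2f1_reg (s + 1 / 2) (1 / 2 - s) (1 / 2 + of_real l) (of_real (S\<^sup>2))"
    by (rule sums_unique2)
  have "(\<Sum>i. f i \<phi>) = cos (s * of_real \<phi>) * of_real (K \<phi>)" if p: "\<phi> \<in> {0..\<zeta>}" for \<phi>
  proof -
    define y where "y = complex_of_real ((sin (\<phi> / 2))\<^sup>2)"
    have "(sin (\<phi> / 2))\<^sup>2 \<le> S\<^sup>2" using bounds(3)[OF p] S by (simp add: abs_le_square_iff[symmetric])
    then have y1: "cmod y < 1" using S2 by (simp add: y_def del: of_real_power)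
    have c: "cos (s * of_real \<phi>) = of_real (sqrt pi) * of_real (cos (\<phi> / 2)) *
        hyp2f1_reg (s + 1 / 2) (1 / 2 - s) (1 / 2) y"
      unfolding y_def using s bounds(4)[OF p] by (rule cos_eq_hyp2f1_reg)
    have sums: "(\<lambda>i. of_real (sqrt pi) * of_real (cos (\<phi> / 2)) * of_real (K \<phi>) *
        (pochhammer (s + 1 / 2) i * pochhammer (1 / 2 - s) i * rGamma (1 / 2 + of_nat i) / fact i * y ^ i)) sums
        (of_real (sqrt pi) * of_real (cos (\<phi> / 2)) * of_real (K \<phi>) * hyp2f1_reg (s + 1 / 2) (1 / 2 - s) (1 / 2) y)"
      unfolding hyp2f1_reg_def by (intro sums_mult summable_sums summable_hyp2f1_reg y1)
    have f: "of_real (sqrt pi) * of_real (cos (\<phi> / 2)) * of_real (K \<phi>) *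
        (pochhammer (s + 1 / 2) i * pochhammer (1 / 2 - s) i * rGamma (1 / 2 + of_nat i) / fact i * y ^ i) = f i \<phi>" for i
      by (simp add: f_def h_def A_def y_def power_mult)
    have "(\<Sum>i. f i \<phi>) = of_real (sqrt pi) * of_real (cos (\<phi> / 2)) * of_real (K \<phi>) *
        hyp2f1_reg (s + 1 / 2) (1 / 2 - s) (1 / 2) y"
      using sums unfolding f by (rule sums_unique[symmetric])
    then show ?thesis unfolding c by (simp add: mult_ac)
  qed
  from has_integral_eq[OF this J] show ?thesis
    unfolding Jval c_def K_def S_def .
qed

section \<open>Deformation to the vertical half-lines\<close>

lemma tendsto_integral_lpos:
  fixes f :: "real \<Rightarrow> complex"
  assumes f: "integrable lpos f"
  shows "(\<lambda>n. integral {0..real n} f) \<longlonglongrightarrow> integral\<^sup>L lpos f"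
proof -
  define F where "F = (\<lambda>x. indicator {0<..} x *\<^sub>R f x)"
  have F: "integrable lborel F"
    using f by (simp add: integrable_restrict_space F_def)
  have "(\<lambda>n. \<integral>x. indicator {0<..<real n} x *\<^sub>R F x \<partial>lborel) \<longlonglongrightarrow> (\<integral>x. F x \<partial>lborel)"
  proof (rule integral_dominated_convergence[where w = "\<lambda>x. norm (F x)"])
    show "AE x in lborel. (\<lambda>n. indicator {0<..<real n} x *\<^sub>R F x) \<longlonglongrightarrow> F x"
    proof (rule AE_I2)
      fix x :: real
      obtain K :: nat where K: "x < real K" using reals_Archimedean2 by blast
      have "indicator {0<..<real n} x *\<^sub>R F x = F x" if "n \<ge> K" for n
        using K of_nat_mono[OF that, where 'a = real] by (auto simp: F_def indicator_def)
      then show "(\<lambda>n. indicator {0<..<real n} x *\<^sub>R F x) \<longlonglongrightarrow> F x"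
        by (intro tendsto_eventually eventually_sequentiallyI[of K])
    qed
    show "AE x in lborel. norm (indicator {0<..<real n} x *\<^sub>R F x) \<le> norm (F x)" for n
      by (intro AE_I2) (auto simp: indicator_def)
    show "integrable lborel (\<lambda>x. norm (F x))" using F by (rule integrable_norm)
    show "F \<in> borel_measurable lborel" using F by (rule borel_measurable_integrable)
    then show "(\<lambda>x. indicator {0<..<real n} x *\<^sub>R F x) \<in> borel_measurable lborel" for n
      by simp
  qed
  moreover have "(\<integral>x. indicator {0<..<real n} x *\<^sub>R F x \<partial>lborel) = integral {0..real n} f" for n
  proof -
    have eq: "indicator {0<..<real n} x *\<^sub>R F x = indicator {0<..<real n} x *\<^sub>R f x" for x
      by (auto simp: F_def indicator_def)
    have "set_integrable lborel {0<..<real n} f"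
      unfolding set_integrable_def eq[symmetric] using F by (intro integrable_mult_indicator) auto
    from set_borel_integral_eq_integral(2)[OF this]
    have "(\<integral>x. indicator {0<..<real n} x *\<^sub>R F x \<partial>lborel) = integral {0<..<real n} f"
      unfolding set_lebesgue_integral_def eq .
    also have "\<dots> = integral {0..real n} f" by (rule integral_open_interval_real[symmetric])
    finally show ?thesis .
  qed
  moreover have "(\<integral>x. F x \<partial>lborel) = integral\<^sup>L lpos f"
    by (simp add: F_def integral_restrict_space)
  ultimately show ?thesis by simp
qed

text \<open>\<open>half_cot \<zeta> = i exp (- i \<zeta>) / (2 sin \<zeta>)\<close>.\<close>

definition half_cot :: "real \<Rightarrow> complex" where
  "half_cot \<zeta> = Complex (1 / 2) (cot \<zeta> / 2)"

lemma Re_half_cot: "Re (half_cot \<zeta>) = 1 / 2"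
  by (simp add: half_cot_def)

definition jkernel :: "complex \<Rightarrow> complex \<Rightarrow> complex \<Rightarrow> real \<Rightarrow> complex" where
  "jkernel s l w y = exp (- s * of_real y) * of_real (1 - exp (- y)) powr (l - 1) *
     (1 + w * of_real (exp y - 1)) powr (l - 1)"

lemma norm_powr_le:
  fixes v p :: complex
  assumes "v \<noteq> 0"
  shows "cmod (v powr p) \<le> cmod v powr Re p * exp (pi * \<bar>Im p\<bar>)"
proof -
  have "\<bar>Im p * Im (Ln v)\<bar> \<le> \<bar>Im p\<bar> * pi"
    using Im_Ln_le_pi[OF assms] mpi_less_Im_Ln[OF assms]
    unfolding abs_mult by (intro mult_left_mono) auto
  then have "Re p * ln (cmod v) - Im p * Im (Ln v) \<le> Re p * ln (cmod v) + pi * \<bar>Im p\<bar>"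
    by (simp add: mult.commute abs_le_iff)
  then show ?thesis
    using assms by (simp add: powr_def exp_add[symmetric])
qed

lemma borel_measurable_jkernel: "jkernel s l w \<in> borel_measurable lpos"
  by (rule borel_measurable_lpos) (simp add: jkernel_def[abs_def])

text \<open>The last factor grows or decays like exp((Re l - 1) y), so the majorant is a Beta
  integral with parameters Re l and Re s - Re l + 1. Their positivity is the pair of hypotheses on
  l.\<close>

lemma integrable_jkernel:
  assumes w: "Re w = 1 / 2" and l: "0 < Re l" "Re l < 1 + Re s"
  shows "integrable lpos (jkernel s l w)"
proof -
  define q where "q = Re l - 1"
  define C where "C = ((1 / 2) powr q + (1 + cmod w) powr q) * exp (pi * \<bar>Im l\<bar>)"
  have "integrable lpos (\<lambda>y. C * ((1 - exp (- y)) powr (Re l - 1) * exp (- (Re s - Re l + 1) * y)))"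
    using l by (intro integrable_mult_right integrable_Beta_exp) auto
  then show ?thesis
  proof (rule Bochner_Integration.integrable_bound)
    show "AE y in lpos. cmod (jkernel s l w y) \<le>
        norm (C * ((1 - exp (- y)) powr (Re l - 1) * exp (- (Re s - Re l + 1) * y)))"
    proof (rule AE_I2)
      fix y assume "y \<in> space lpos"
      then have y: "0 < y" by (simp add: space_lpos)
      define v where "v = 1 + w * of_real (exp y - 1)"
      have "Re v = 1 + Re w * (exp y - 1)" unfolding v_def by simp
      also have "\<dots> = exp y / 2 + 1 / 2" unfolding w by (simp add: field_simps)
      finally have Rv: "exp y / 2 \<le> Re v" by simp
      then have lo: "1 / 2 * exp y \<le> cmod v" using complex_Re_le_cmod[of v] by linarith
      have v0: "v \<noteq> 0" using lo exp_gt_zero[of y] by auto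
      have "cmod v \<le> 1 + cmod w * (exp y - 1)"
        using norm_triangle_ineq[of 1 "w * of_real (exp y - 1)"] y
        by (simp add: v_def norm_mult del: of_real_diff)
      also have "\<dots> \<le> exp y + cmod w * exp y"
        using y by (intro add_mono mult_left_mono) auto
      finally have hi: "cmod v \<le> (1 + cmod w) * exp y" by (simp add: algebra_simps)
      \<comment> \<open>Since q may have either sign, |v| is needed from both sides: exp(y)/2 from
        below and (1 + |w|) exp(y) from above. Adding the two constants covers both cases.\<close>
      have vq: "cmod v powr q \<le> ((1 / 2) powr q + (1 + cmod w) powr q) * exp y powr q"
      proof (cases "0 \<le> q")
        case True
        have "cmod v powr q \<le> ((1 + cmod w) * exp y) powr q"
          using hi True by (intro powr_mono2) auto
        also have "\<dots> = (1 + cmod w) powr q * exp y powr q" by (rule powr_mult)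
        also have "\<dots> \<le> ((1 / 2) powr q + (1 + cmod w) powr q) * exp y powr q"
          by (intro mult_right_mono) auto
        finally show ?thesis .
      next
        case False
        have "cmod v powr q \<le> (1 / 2 * exp y) powr q"
          using lo False by (intro powr_mono2') auto
        also have "\<dots> = (1 / 2) powr q * exp y powr q" by (rule powr_mult)
        also have "\<dots> \<le> ((1 / 2) powr q + (1 + cmod w) powr q) * exp y powr q"
          by (intro mult_right_mono) auto
        finally show ?thesis .
      qed
      have ey: "exp y powr q = exp (q * y)" by (simp add: powr_def)
      have "cmod (v powr (l - 1)) \<le> cmod v powr q * exp (pi * \<bar>Im l\<bar>)"
        using norm_powr_le[OF v0, of "l - 1"] by (simp add: q_def)
      also have "\<dots> \<le> C * exp (q * y)"
        using mult_right_mono[OF vq, of "exp (pi * \<bar>Im l\<bar>)"] unfolding ey C_def by (simp add: mult_ac)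
      finally have vp: "cmod (v powr (l - 1)) \<le> C * exp (q * y)" .
      have "cmod (jkernel s l w y) = exp (- Re s * y) * (1 - exp (- y)) powr (Re l - 1) * cmod (v powr (l - 1))"
        using y by (simp add: jkernel_def norm_mult v_def norm_powr_real_powr del: of_real_diff)
      also have "\<dots> \<le> exp (- Re s * y) * (1 - exp (- y)) powr (Re l - 1) * (C * exp (q * y))"
        by (intro mult_left_mono vp) auto
      also have "\<dots> = C * ((1 - exp (- y)) powr (Re l - 1) * (exp (- Re s * y) * exp (q * y)))"
        by (simp only: mult_ac)
      also have "exp (- Re s * y) * exp (q * y) = exp (- (Re s - Re l + 1) * y)"
        unfolding exp_add[symmetric] by (simp add: q_def algebra_simps)
      finally show "cmod (jkernel s l w y) \<le>
        norm (C * ((1 - exp (- y)) powr (Re l - 1) * exp (- (Re s - Re l + 1) * y)))" by simp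
    qed
  qed (rule borel_measurable_jkernel)
qed

lemma holomorphic_on_integral_jkernel:
  assumes w: "Re w = 1 / 2"
  shows "(\<lambda>l. integral\<^sup>L lpos (jkernel s l w)) holomorphic_on {l. 0 < Re l \<and> Re l < 1 + Re s}"
proof -
  let ?v = "\<lambda>y. 1 + w * of_real (exp y - 1)"
  let ?f = "\<lambda>y. exp (- s * of_real y) / (of_real (1 - exp (- y)) * ?v y)"
  let ?g = "\<lambda>y. of_real (ln (1 - exp (- y))) + Ln (?v y)"
  have eq: "jkernel s l w y = ?f y * exp (l * ?g y)" if "y \<in> space lpos" for y l
  proof -
    have y: "0 < y" using that by (simp add: space_lpos)
    have "Re (?v y) > 0" using w y by (simp add: add_pos_nonneg)
    then have v: "?v y \<noteq> 0" by (metis less_irrefl zero_complex.simps(1))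
    have e: "0 < 1 - exp (- y)" using y by simp
    have "of_real (1 - exp (- y)) powr (l - 1) = exp (l * of_real (ln (1 - exp (- y)))) / of_real (1 - exp (- y))"
      unfolding powr_complex_of_real_eq_exp[OF e] left_diff_distrib exp_diff using e
      by (simp add: exp_of_real del: of_real_diff)
    moreover have "?v y powr (l - 1) = exp (l * Ln (?v y)) / ?v y"
      using v by (simp add: powr_def left_diff_distrib exp_diff)
    ultimately show ?thesis
      unfolding jkernel_def by (simp add: distrib_left exp_add)
  qed
  have "(\<lambda>l. \<integral>y. ?f y * exp (l * ?g y) \<partial>lpos) holomorphic_on {l. 0 < Re l \<and> Re l < 1 + Re s}"
  proof (rule holomorphic_on_integral_exp)
    show "open {l. 0 < Re l \<and> Re l < 1 + Re s}"
      by (intro open_Collect_conj open_halfspace_Re_gt open_halfspace_Re_lt)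
    show "?f \<in> borel_measurable lpos" by (rule borel_measurable_lpos) measurable
    show "?g \<in> borel_measurable lpos" by (rule borel_measurable_lpos) measurable
    fix l assume "l \<in> {l. 0 < Re l \<and> Re l < 1 + Re s}"
    then have "integrable lpos (jkernel s l w)" using w by (intro integrable_jkernel) auto
    moreover have "integrable lpos (jkernel s l w) = integrable lpos (\<lambda>y. ?f y * exp (l * ?g y))"
      by (intro Bochner_Integration.integrable_cong refl eq)
    ultimately show "integrable lpos (\<lambda>y. ?f y * exp (l * ?g y))" by blast
  qed
  moreover have "integral\<^sup>L lpos (jkernel s l w) = (\<integral>y. ?f y * exp (l * ?g y) \<partial>lpos)" for l
    by (intro Bochner_Integration.integral_cong refl eq)
  ultimately show ?thesis by simp
qed

section \<open>Branches of the power on the closed half-strip\<close>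

lemma cos_Complex_diff_cos:
  assumes "sin \<zeta> \<noteq> 0"
  shows "cos (Complex \<zeta> y) - of_real (cos \<zeta>) =
    - \<i> * of_real (sin \<zeta> * (1 - exp (- y))) * (1 + half_cot \<zeta> * of_real (exp y - 1))"
proof (rule complex_eqI)
  have e: "exp (- y) * exp y = 1" by (simp add: exp_minus)
  have "cos \<zeta> * (exp y + exp (- y)) / 2 - cos \<zeta> = cos \<zeta> * ((1 - exp (- y)) * (exp y - 1)) / 2"
    using e by (simp add: algebra_simps)
  then show "Re (cos (Complex \<zeta> y) - of_real (cos \<zeta>)) =
    Re (- \<i> * of_real (sin \<zeta> * (1 - exp (- y))) * (1 + half_cot \<zeta> * of_real (exp y - 1)))"
    using assms by (simp add: Re_cos half_cot_def cot_def del: of_real_mult of_real_diff)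
  have "(1 - exp (- y)) * (1 + exp y) = exp y - exp (- y)"
    using e by (simp add: algebra_simps)
  moreover have "sin \<zeta> * (1 - exp (- y)) * (1 + (exp y - 1) / 2) =
      sin \<zeta> * ((1 - exp (- y)) * (1 + exp y)) / 2" by (simp add: field_simps)
  ultimately have "sin \<zeta> * (exp (- y) - exp y) / 2 = - (sin \<zeta> * (1 - exp (- y)) * (1 + (exp y - 1) / 2))"
    by (simp add: right_diff_distrib diff_divide_distrib)
  then show "Im (cos (Complex \<zeta> y) - of_real (cos \<zeta>)) =
    Im (- \<i> * of_real (sin \<zeta> * (1 - exp (- y))) * (1 + half_cot \<zeta> * of_real (exp y - 1)))"
    by (simp add: Im_cos half_cot_def del: of_real_mult of_real_diff)
qed

text \<open>The argument of w lies strictly between -\<pi>/2 and \<pi>/2, so turning it by -e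
  \<pi>/2 does not cross the cut and the principal power is multiplicative. The sign e tells the
  right edge from the left one.\<close>

lemma powr_ii_mult:
  fixes w p :: complex and c e :: real
  assumes c: "0 < c" and w: "0 < Re w" and e: "e = 1 \<or> e = - 1"
  shows "(- \<i> * of_real (e * c) * w) powr p = exp (- \<i> * of_real (e * pi / 2) * p) * of_real c powr p * w powr p"
proof -
  have w0: "w \<noteq> 0" using w by auto
  have "\<bar>Im (Ln w)\<bar> < pi / 2" using Re_Ln_pos_lt[OF w0] w by blast
  then have im: "- pi < Im (Ln w) - e * pi / 2" "Im (Ln w) - e * pi / 2 \<le> pi"
    using e by (auto simp: abs_less_iff)
  have "Ln (- \<i> * of_real (e * c) * w) = of_real (ln c) + Ln w - \<i> * of_real (e * pi / 2)"
  proof (rule Ln_unique)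
    have "exp (- \<i> * of_real (e * pi / 2)) = - \<i> * of_real e"
    proof -
      have half: "exp (\<i> * of_real (pi / 2)) = \<i>" by (simp only: cis_conv_exp[symmetric] cis_pi_half)
      from e show ?thesis
      proof
        assume "e = 1"
        then have "exp (- \<i> * of_real (e * pi / 2)) = inverse (exp (\<i> * of_real (pi / 2)))"
          by (simp only: mult_1 mult_minus_left exp_minus)
        then show ?thesis unfolding half using \<open>e = 1\<close> by simp
      next
        assume "e = - 1"
        then have "exp (- \<i> * of_real (e * pi / 2)) = exp (\<i> * of_real (pi / 2))" by simp
        then show ?thesis unfolding half using \<open>e = - 1\<close> by simp
      qed
    qed
    moreover have "exp (of_real (ln c) + Ln w - \<i> * of_real (e * pi / 2)) =
        exp (of_real (ln c)) * exp (Ln w) * exp (- \<i> * of_real (e * pi / 2))"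
      by (simp only: exp_add[symmetric] diff_conv_add_uminus mult_minus_left)
    ultimately show "exp (of_real (ln c) + Ln w - \<i> * of_real (e * pi / 2)) = - \<i> * of_real (e * c) * w"
      using c w0 by (simp add: exp_of_real)
  qed (use im in auto)
  moreover have "- \<i> * of_real (e * c) * w \<noteq> 0" using c e w0 by auto
  ultimately have "(- \<i> * of_real (e * c) * w) powr p =
      exp (p * (of_real (ln c) + Ln w - \<i> * of_real (e * pi / 2)))"
    by (simp only: powr_def if_False)
  also have "p * (of_real (ln c) + Ln w - \<i> * of_real (e * pi / 2)) =
      - \<i> * of_real (e * pi / 2) * p + p * of_real (ln c) + p * Ln w"
    by (simp add: algebra_simps)
  finally have "(- \<i> * of_real (e * c) * w) powr p =
      exp (- \<i> * of_real (e * pi / 2) * p) * exp (p * of_real (ln c)) * exp (p * Ln w)"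
    by (simp only: exp_add)
  moreover have "w powr p = exp (p * Ln w)" using w0 by (simp add: powr_def)
  ultimately show ?thesis
    by (simp only: powr_complex_of_real_eq_exp[OF c])
qed

definition strip_integrand :: "real \<Rightarrow> complex \<Rightarrow> real \<Rightarrow> complex \<Rightarrow> complex" where
  "strip_integrand \<zeta> s l z = exp (\<i> * s * z) * (cos z - of_real (cos \<zeta>)) powr of_real (l - 1)"

text \<open>On the real segment without its endpoints and on the imaginary axis the real part is
  positive. Elsewhere 0 < |Re z| <= \<zeta> < \<pi> and Im z > 0, so the imaginary part -sin(Re z)
  sinh(Im z) does not vanish.\<close>

lemma strip_base_not_nonpos:
  assumes z: "0 < \<zeta>" "\<zeta> < pi" and "- \<zeta> \<le> Re z" "Re z \<le> \<zeta>" "0 \<le> Im z"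
    and ne: "z \<notin> {Complex (- \<zeta>) 0, Complex \<zeta> 0}"
  shows "cos z - of_real (cos \<zeta>) \<notin> \<real>\<^sub>\<le>\<^sub>0"
proof -
  have "0 < Re (cos z - of_real (cos \<zeta>)) \<or> Im (cos z - of_real (cos \<zeta>)) \<noteq> 0"
  proof (cases "Im z = 0")
    case True
    then have "\<bar>Re z\<bar> < \<zeta>" using assms(3,4) ne by (auto simp: complex_eq_iff)
    then have "cos \<zeta> < cos \<bar>Re z\<bar>" using z by (intro cos_monotone_0_pi) auto
    then show ?thesis using True by (simp add: Re_cos)
  next
    case False
    then have b: "0 < Im z" using assms(5) by simp
    show ?thesis
    proof (cases "Re z = 0")
      case True
      have "cos \<zeta> < cos 0" using z by (intro cos_monotone_0_pi) auto
      moreover have "1 \<le> (exp (Im z) + exp (- Im z)) / 2"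
        using cosh_real_ge_1[of "Im z"] by (simp add: cosh_def)
      ultimately show ?thesis using True by (simp add: Re_cos)
    next
      case False
      have "sin (Re z) \<noteq> 0"
      proof (cases "0 < Re z")
        case True
        then show ?thesis using sin_gt_zero[of "Re z"] assms(4) z by auto
      next
        case neg: False
        then have "0 < sin (- Re z)" using False assms(3) z by (intro sin_gt_zero) auto
        then show ?thesis by simp
      qed
      moreover have "exp (- Im z) < exp (Im z)" using b by simp
      ultimately show ?thesis by (simp add: Im_cos)
    qed
  qed
  then show ?thesis by (auto simp: complex_nonpos_Reals_iff)
qed

lemma strip_integrand_edge:
  assumes z: "0 < \<zeta>" "\<zeta> < pi" and y: "0 < y" and e: "e = 1 \<or> e = - 1"
  shows "strip_integrand \<zeta> s l (Complex (e * \<zeta>) y) =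
    exp (\<i> * of_real e * (s * of_real \<zeta> - of_real (pi / 2) * of_real (l - 1))) * of_real (sin \<zeta> powr (l - 1)) *
    jkernel s (of_real l) (half_cot (e * \<zeta>)) y"
proof -
  have S: "0 < sin \<zeta>" using z by (intro sin_gt_zero)
  have E: "0 < 1 - exp (- y)" using y by simp
  define v where "v = 1 + half_cot (e * \<zeta>) * of_real (exp y - 1)"
  have "0 < 1 + Re (half_cot (e * \<zeta>)) * (exp y - 1)"
    using y unfolding Re_half_cot by (intro add_pos_nonneg) auto
  then have v: "0 < Re v" by (simp add: v_def)
  have ec: "cos (e * \<zeta>) = cos \<zeta>" "sin (e * \<zeta>) = e * sin \<zeta>" using e by auto
  have "cos (Complex (e * \<zeta>) y) - of_real (cos \<zeta>) = - \<i> * of_real (e * (sin \<zeta> * (1 - exp (- y)))) * v"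
    using cos_Complex_diff_cos[of "e * \<zeta>" y] S e unfolding ec v_def by auto
  then have "(cos (Complex (e * \<zeta>) y) - of_real (cos \<zeta>)) powr of_real (l - 1) =
      exp (- \<i> * of_real (e * pi / 2) * of_real (l - 1)) * of_real (sin \<zeta> * (1 - exp (- y))) powr of_real (l - 1) *
      v powr of_real (l - 1)"
    using powr_ii_mult[OF mult_pos_pos[OF S E] v e] by simp
  also have "complex_of_real (sin \<zeta> * (1 - exp (- y))) powr of_real (l - 1) =
      of_real (sin \<zeta> powr (l - 1)) * of_real (1 - exp (- y)) powr of_real (l - 1)"
    using S E by (simp add: powr_of_real powr_mult del: of_real_diff of_real_mult flip: of_real_mult)
  finally have P: "(cos (Complex (e * \<zeta>) y) - of_real (cos \<zeta>)) powr of_real (l - 1) =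
      exp (- \<i> * of_real (e * pi / 2) * of_real (l - 1)) *
      (of_real (sin \<zeta> powr (l - 1)) * of_real (1 - exp (- y)) powr of_real (l - 1)) * v powr of_real (l - 1)" .
  have ez: "\<i> * s * Complex (e * \<zeta>) y = \<i> * of_real e * (s * of_real \<zeta>) + - s * of_real y"
    by (simp add: Complex_eq algebra_simps)
  have ex: "exp (\<i> * of_real e * (s * of_real \<zeta> - of_real (pi / 2) * of_real (l - 1))) =
      exp (\<i> * of_real e * (s * of_real \<zeta>)) * exp (- \<i> * of_real (e * pi / 2) * of_real (l - 1))"
    unfolding exp_add[symmetric] by (simp add: algebra_simps)
  show ?thesis
    unfolding strip_integrand_def P ez ex jkernel_def v_def[symmetric] exp_add
    by (simp add: mult_ac)
qed

text \<open>The integrand is continuous, with zeros at \<open>\<plusminus>\<zeta>\<close>, on the closed half-strip \<open>|Re z| \<le> \<zeta>\<close>,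
  \<open>Im z \<ge> 0\<close>, because \<open>l > 1\<close>; this is why smaller \<open>l\<close> is only reached by continuation.\<close>

lemma integral_strip_integrand:
  fixes \<zeta> l :: real and s :: complex
  assumes z: "0 < \<zeta>" "\<zeta> < pi" and l: "1 < l" "l < 1 + Re s"
  shows "integral {- \<zeta>..\<zeta>} (\<lambda>x. strip_integrand \<zeta> s l (of_real x)) = of_real (sin \<zeta> powr (l - 1)) *
    (exp (\<i> * (s * of_real \<zeta> - of_real l * of_real (pi / 2))) * integral\<^sup>L lpos (jkernel s (of_real l) (half_cot \<zeta>)) +
     exp (- (\<i> * (s * of_real \<zeta> - of_real l * of_real (pi / 2)))) * integral\<^sup>L lpos (jkernel s (of_real l) (half_cot (- \<zeta>))))"
proof -
  define H where "H = strip_integrand \<zeta> s l"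
  define D where "D = {z. - \<zeta> \<le> Re z} \<inter> {z. Re z \<le> \<zeta>} \<inter> {z. 0 \<le> Im z}"
  define I1 where "I1 = integral {- \<zeta>..\<zeta>} (\<lambda>x. H (of_real x))"
  define J where "J e = integral\<^sup>L lpos (jkernel s (of_real l) (half_cot (e * \<zeta>)))" for e
  define c where "c e = exp (\<i> * of_real e * (s * of_real \<zeta> - of_real (pi / 2) * of_real (l - 1))) *
      of_real (sin \<zeta> powr (l - 1))" for e :: real
  define E where "E e n = integral {0..real n} (\<lambda>y. H (Complex (e * \<zeta>) y))" for e and n :: nat
  have convD: "convex D"
    unfolding D_def by (intro convex_Int convex_halfspace_Re_ge convex_halfspace_Re_le convex_halfspace_Im_ge)
  have nonpos: "cos w - of_real (cos \<zeta>) \<notin> \<real>\<^sub>\<le>\<^sub>0" if "w \<in> D" "w \<notin> {Complex (- \<zeta>) 0, Complex \<zeta> 0}" for w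
    using strip_base_not_nonpos[OF z] that by (auto simp: D_def)
  have contH: "continuous_on D H"
    unfolding H_def strip_integrand_def
  proof (intro continuous_on_mult continuous_on_powr_complex continuous_intros)
    \<comment> \<open>At the two corners the base is 0. The condition 0 <= Re admits this, as the
      exponent l - 1 is positive.\<close>
    show "D \<subseteq> {w. 0 \<le> Re (cos w - of_real (cos \<zeta>)) \<or> Im (cos w - of_real (cos \<zeta>)) \<noteq> 0}"
    proof
      fix w assume w: "w \<in> D"
      show "w \<in> {w. 0 \<le> Re (cos w - of_real (cos \<zeta>)) \<or> Im (cos w - of_real (cos \<zeta>)) \<noteq> 0}"
      proof (cases "w \<in> {Complex (- \<zeta>) 0, Complex \<zeta> 0}")
        case True
        then show ?thesis by (auto simp: Re_cos)
      next
        case False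
        from nonpos[OF w this] show ?thesis by (auto simp: complex_nonpos_Reals_iff)
      qed
    qed
  qed (use l in auto)
  have diffH: "H field_differentiable at w" if "w \<in> interior D - {Complex (- \<zeta>) 0, Complex \<zeta> 0}" for w
  proof -
    have nb: "cos w - of_real (cos \<zeta>) \<notin> \<real>\<^sub>\<le>\<^sub>0"
      using that interior_subset[of D] by (intro nonpos) auto
    have d1: "((\<lambda>z. (cos z - of_real (cos \<zeta>)) powr of_real (l - 1)) has_field_derivative
        (of_real (l - 1) * (cos w - of_real (cos \<zeta>)) powr (of_real (l - 1) - 1)) * (- sin w)) (at w)"
      by (rule DERIV_chain2[where g = "\<lambda>z. cos z - of_real (cos \<zeta>)", OF has_field_derivative_powr[OF nb]]) (auto intro!: derivative_eq_intros)
    have d2: "((\<lambda>z. exp (\<i> * s * z)) has_field_derivative exp (\<i> * s * w) * (\<i> * s)) (at w)"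
      by (auto intro!: derivative_eq_intros)
    show ?thesis
      unfolding H_def strip_integrand_def[abs_def] field_differentiable_def
      by (rule exI) (rule DERIV_mult[OF d2 d1])
  qed
  have edge: "H (Complex (e * \<zeta>) y) = c e * jkernel s (of_real l) (half_cot (e * \<zeta>)) y"
    if "y \<in> space lpos" "e = 1 \<or> e = - 1" for y e
    using strip_integrand_edge[OF z, of y e s l] that by (simp add: H_def c_def space_lpos)
  have Elim: "E e \<longlonglongrightarrow> c e * J e" if e: "e = 1 \<or> e = - 1" for e
  proof -
    have int: "integrable lpos (\<lambda>y. c e * jkernel s (of_real l) (half_cot (e * \<zeta>)) y)"
      using l by (intro integrable_mult_right integrable_jkernel) (auto simp: Re_half_cot)
    have "integrable lpos (\<lambda>y. H (Complex (e * \<zeta>) y)) =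
        integrable lpos (\<lambda>y. c e * jkernel s (of_real l) (half_cot (e * \<zeta>)) y)"
      by (intro Bochner_Integration.integrable_cong refl edge e)
    with int have "integrable lpos (\<lambda>y. H (Complex (e * \<zeta>) y))" by blast
    from tendsto_integral_lpos[OF this]
    have "E e \<longlonglongrightarrow> (\<integral>y. H (Complex (e * \<zeta>) y) \<partial>lpos)" unfolding E_def .
    also have "(\<integral>y. H (Complex (e * \<zeta>) y) \<partial>lpos) =
        (\<integral>y. c e * jkernel s (of_real l) (half_cot (e * \<zeta>)) y \<partial>lpos)"
      by (intro Bochner_Integration.integral_cong refl edge e)
    also have "\<dots> = c e * J e" unfolding J_def by (rule integral_mult_right_zero)
    finally show ?thesis .
  qed
  \<comment> \<open>On the top side exp(i s z) contributes exp(-Re s T) and the power at most (2 exp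
    T)^(l-1). The product tends to 0 because l < 1 + Re s.\<close>
  define B where "B T = exp (\<bar>Im s\<bar> * \<zeta>) * 2 powr (l - 1) * exp (- (Re s - l + 1) * T)" for T
  have topbound: "cmod (H w) \<le> B T" if w: "- \<zeta> \<le> Re w" "Re w \<le> \<zeta>" "Im w = T" "0 \<le> T" for w T
  proof -
    have "- (Im s * Re w) \<le> \<bar>Im s\<bar> * \<bar>Re w\<bar>" unfolding abs_mult[symmetric] by (rule abs_ge_minus_self)
    also have "\<dots> \<le> \<bar>Im s\<bar> * \<zeta>" using w by (intro mult_left_mono) auto
    finally have e1: "cmod (exp (\<i> * s * w)) \<le> exp (\<bar>Im s\<bar> * \<zeta> - Re s * T)"
      using w by (simp add: algebra_simps)
    have "cmod (cos w) \<le> exp T"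
    proof -
      have "cmod (cos w) = cmod (exp (\<i> * w) + exp (- (\<i> * w))) / 2"
        unfolding cos_exp_eq by (simp only: norm_divide norm_numeral)
      also have "\<dots> \<le> (cmod (exp (\<i> * w)) + cmod (exp (- (\<i> * w)))) / 2"
        by (intro divide_right_mono norm_triangle_ineq) simp
      also have "\<dots> = (exp (- T) + exp T) / 2" using w by simp
      also have "\<dots> \<le> exp T" using w by simp
      finally show ?thesis .
    qed
    moreover have "cmod (complex_of_real (cos \<zeta>)) \<le> exp T"
    proof -
      have "1 \<le> exp T" using w by simp
      then show ?thesis using abs_cos_le_one[of \<zeta>] unfolding norm_of_real by linarith
    qed
    ultimately have "cmod (cos w - of_real (cos \<zeta>)) \<le> 2 * exp T"
      using norm_triangle_ineq4[of "cos w" "of_real (cos \<zeta>)"] by linarith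
    then have "cmod (cos w - of_real (cos \<zeta>)) powr (l - 1) \<le> (2 * exp T) powr (l - 1)"
      using l by (intro powr_mono2) auto
    also have "\<dots> = 2 powr (l - 1) * exp ((l - 1) * T)"
      unfolding powr_mult by (simp add: powr_def)
    finally have e2: "cmod (cos w - of_real (cos \<zeta>)) powr (l - 1) \<le> 2 powr (l - 1) * exp ((l - 1) * T)" .
    have "cmod (H w) = cmod (exp (\<i> * s * w)) * cmod (cos w - of_real (cos \<zeta>)) powr (l - 1)"
      unfolding H_def strip_integrand_def norm_mult by (simp only: norm_powr_real_powr' Reals_of_real Re_complex_of_real)
    also have "\<dots> \<le> exp (\<bar>Im s\<bar> * \<zeta> - Re s * T) * (2 powr (l - 1) * exp ((l - 1) * T))"
      by (intro mult_mono e1 e2) auto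
    also have "\<dots> = 2 powr (l - 1) * (exp (\<bar>Im s\<bar> * \<zeta> - Re s * T) * exp ((l - 1) * T))" by simp
    also have "exp (\<bar>Im s\<bar> * \<zeta> - Re s * T) * exp ((l - 1) * T) =
        exp (\<bar>Im s\<bar> * \<zeta>) * exp (- (Re s - l + 1) * T)"
      unfolding exp_add[symmetric] by (simp add: algebra_simps)
    finally show ?thesis by (simp only: B_def mult_ac)
  qed
  have Blim: "(\<lambda>n. B (real n) * (2 * \<zeta>)) \<longlonglongrightarrow> 0"
  proof -
    have "filterlim (\<lambda>n. (Re s - l + 1) * real n) at_top sequentially"
      using l by (intro filterlim_tendsto_pos_mult_at_top[OF tendsto_const] filterlim_real_sequentially) auto
    then have "(\<lambda>n. exp (- ((Re s - l + 1) * real n))) \<longlonglongrightarrow> 0"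
      by (intro filterlim_compose[OF exp_at_bot] filterlim_uminus_at_bot[THEN iffD2]) simp
    then have "(\<lambda>n. exp (\<bar>Im s\<bar> * \<zeta>) * 2 powr (l - 1) * exp (- ((Re s - l + 1) * real n)) * (2 * \<zeta>)) \<longlonglongrightarrow>
        exp (\<bar>Im s\<bar> * \<zeta>) * 2 powr (l - 1) * 0 * (2 * \<zeta>)"
      by (intro tendsto_intros)
    then show ?thesis by (simp only: B_def mult_minus_left mult_zero_right mult_zero_left)
  qed
  have contour: "cmod (I1 + \<i> * E 1 n - \<i> * E (- 1) n) \<le> B (real n) * (2 * \<zeta>)" if n: "0 < n" for n
  proof -
    define T where "T = real n"
    have T: "0 < T" using n by (simp add: T_def)
    define a b d f where "a = Complex (- \<zeta>) 0" and "b = Complex \<zeta> 0" and "d = Complex \<zeta> T" and "f = Complex (- \<zeta>) T"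
    have inD: "a \<in> D" "b \<in> D" "d \<in> D" "f \<in> D"
      using z T by (auto simp: D_def a_def b_def d_def f_def)
    have seg: "closed_segment u v \<subseteq> D" if "u \<in> D" "v \<in> D" for u v
      using that convD by (rule closed_segment_subset)
    have cs: "continuous_on (closed_segment u v) H" if "u \<in> D" "v \<in> D" for u v
      using contH seg[OF that] by (rule continuous_on_subset)
    have ci: "H contour_integrable_on linepath u v" if "u \<in> D" "v \<in> D" for u v
      using cs[OF that] by (rule contour_integrable_continuous_linepath)
    define g where "g = linepath a b +++ linepath b d +++ linepath d f +++ linepath f a"
    have "(H has_contour_integral 0) g"
    \<comment> \<open>This form of Cauchy's theorem asks for continuity on D and differentiability
      in its interior only, so the path may run along the edges and through the branch
      points.\<close>
    proof (rule Cauchy_theorem_convex[where K = "{Complex (- \<zeta>) 0, Complex \<zeta> 0}", OF contH convD _ diffH])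
      show "valid_path g" by (simp add: g_def)
      show "path_image g \<subseteq> D" using seg inD by (auto simp: g_def path_image_join)
      show "pathfinish g = pathstart g" by (simp add: g_def)
    qed auto
    then have "0 = contour_integral g H" by (simp add: contour_integral_unique)
    also have "\<dots> = contour_integral (linepath a b) H + (contour_integral (linepath b d) H +
        (contour_integral (linepath d f) H + contour_integral (linepath f a) H))"
      unfolding g_def using ci inD by (simp add: contour_integral_join)
    also have "contour_integral (linepath a b) H = I1"
    proof -
      have "contour_integral (linepath a b) H = integral {Re a..Re b} (\<lambda>x. H (of_real x))"
        using z by (intro contour_integral_linepath_Reals_eq) (auto simp: a_def b_def complex_is_Real_iff)
      then show ?thesis by (simp add: I1_def a_def b_def)
    qed
    also have "contour_integral (linepath b d) H = \<i> * E 1 n"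
    proof -
      have "contour_integral (linepath b d) H = \<i> * integral {0..T} (\<lambda>x. H (Complex \<zeta> x))"
        using T by (intro contour_integral_linepath_same_Re) (auto simp: b_def d_def)
      then show ?thesis by (simp add: E_def T_def)
    qed
    also have "contour_integral (linepath f a) H = - (\<i> * E (- 1) n)"
    proof -
      have "contour_integral (linepath f a) H = - contour_integral (linepath a f) H"
        by (intro contour_integral_reverse_linepath cs inD)
      also have "contour_integral (linepath a f) H = \<i> * integral {0..T} (\<lambda>x. H (Complex (- \<zeta>) x))"
        using T by (intro contour_integral_linepath_same_Re) (auto simp: a_def f_def)
      finally show ?thesis by (simp add: E_def T_def)
    qed
    finally have "I1 + \<i> * E 1 n - \<i> * E (- 1) n = - contour_integral (linepath d f) H"
      by (simp add: algebra_simps eq_neg_iff_add_eq_0)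
    also have "cmod \<dots> \<le> B T * cmod (f - d)"
      unfolding norm_minus_cancel
    proof (rule contour_integral_bound_linepath)
      show "H contour_integrable_on linepath d f" using inD by (intro ci)
      show "0 \<le> B T" by (simp add: B_def)
      fix w assume "w \<in> closed_segment d f"
      then have "Im w = T" "- \<zeta> \<le> Re w" "Re w \<le> \<zeta>"
      proof -
        assume w: "w \<in> closed_segment d f"
        from w seg inD have "w \<in> D" by blast
        then show "- \<zeta> \<le> Re w" "Re w \<le> \<zeta>" by (auto simp: D_def)
        from w show "Im w = T" by (auto simp: closed_segment_def d_def f_def left_diff_distrib)
      qed
      then show "cmod (H w) \<le> B T" using T by (intro topbound) auto
    qed
    also have "cmod (f - d) = 2 * \<zeta>"
      using z by (simp add: f_def d_def cmod_def real_sqrt_mult)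
    finally show ?thesis by (simp only: T_def)
  qed
  have "(\<lambda>n. I1 + \<i> * E 1 n - \<i> * E (- 1) n) \<longlonglongrightarrow> 0"
    by (rule Lim_null_comparison[OF _ Blim]) (use contour in \<open>auto intro!: eventually_sequentiallyI[of 1]\<close>)
  moreover have "(\<lambda>n. I1 + \<i> * E 1 n - \<i> * E (- 1) n) \<longlonglongrightarrow> I1 + \<i> * (c 1 * J 1) - \<i> * (c (- 1) * J (- 1))"
    by (intro tendsto_intros Elim) auto
  ultimately have "I1 + \<i> * (c 1 * J 1) - \<i> * (c (- 1) * J (- 1)) = 0"
    using LIMSEQ_unique by blast
  then have I1: "I1 = - \<i> * c 1 * J 1 + \<i> * c (- 1) * J (- 1)"
    by (simp add: algebra_simps add_eq_0_iff2)
  \<comment> \<open>The factors -i and i come from dz = i dy. Written as exponentials they change l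
    - 1 into l in the phase.\<close>
  have half: "exp (\<i> * of_real (pi / 2)) = \<i>" "exp (- (\<i> * of_real (pi / 2))) = - \<i>"
    by (simp_all only: exp_minus cis_conv_exp[symmetric] cis_pi_half) simp
  have c1: "- \<i> * c 1 = exp (\<i> * (s * of_real \<zeta> - of_real l * of_real (pi / 2))) * of_real (sin \<zeta> powr (l - 1))"
  proof -
    have "- (\<i> * of_real (pi / 2)) + \<i> * of_real 1 * (s * of_real \<zeta> - of_real (pi / 2) * of_real (l - 1)) =
        \<i> * (s * of_real \<zeta> - of_real l * of_real (pi / 2))" by (simp add: field_simps)
    moreover have "- \<i> * c 1 = exp (- (\<i> * of_real (pi / 2))) * c 1" by (simp only: half(2))
    ultimately show ?thesis
      unfolding c_def by (simp only: mult.assoc[symmetric] exp_add[symmetric])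
  qed
  have c2: "\<i> * c (- 1) = exp (- (\<i> * (s * of_real \<zeta> - of_real l * of_real (pi / 2)))) * of_real (sin \<zeta> powr (l - 1))"
  proof -
    have "\<i> * of_real (pi / 2) + \<i> * of_real (- 1) * (s * of_real \<zeta> - of_real (pi / 2) * of_real (l - 1)) =
        - (\<i> * (s * of_real \<zeta> - of_real l * of_real (pi / 2)))" by (simp add: field_simps)
    moreover have "\<i> * c (- 1) = exp (\<i> * of_real (pi / 2)) * c (- 1)" by (simp only: half(1))
    ultimately show ?thesis
      unfolding c_def by (simp only: mult.assoc[symmetric] exp_add[symmetric])
  qed
  show ?thesis
    using I1 unfolding c1 c2 I1_def H_def J_def by (simp add: algebra_simps)
qed

text \<open>The kernel is even, so folding the segment at 0 turns the exponential into twice the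
  cosine of the Mehler--Dirichlet integral.\<close>

lemma integral_strip_integrand_eq_hyp2f1_reg:
  fixes \<zeta> l :: real and s :: complex
  assumes z: "0 < \<zeta>" "\<zeta> < pi" and l: "1 < l" and s: "s \<noteq> 0"
  shows "integral {- \<zeta>..\<zeta>} (\<lambda>x. strip_integrand \<zeta> s l (of_real x)) =
     of_real (2 powr l * sqrt pi * Gamma l * (sin (\<zeta> / 2)) powr (2 * l - 1)) *
     hyp2f1_reg (s + 1 / 2) (1 / 2 - s) (1 / 2 + of_real l) (of_real ((sin (\<zeta> / 2))\<^sup>2))" (is "_ = ?R")
proof -
  define K where "K x = (cos x - cos \<zeta>) powr (l - 1)" for x
  define f where "f x = exp (\<i> * s * of_real x) * of_real (K x)" for x
  have pos: "0 \<le> cos x - cos \<zeta>" if "x \<in> {- \<zeta>..\<zeta>}" for x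
  proof -
    have "cos \<zeta> \<le> cos \<bar>x\<bar>" using that z by (intro cos_monotone_0_pi_le) auto
    then show ?thesis by simp
  qed
  have "integral {- \<zeta>..\<zeta>} (\<lambda>x. strip_integrand \<zeta> s l (of_real x)) = integral {- \<zeta>..\<zeta>} f"
  proof (rule integral_cong)
    fix x assume "x \<in> {- \<zeta>..\<zeta>}"
    then have "of_real (cos x - cos \<zeta>) powr of_real (l - 1) = complex_of_real (K x)"
      unfolding K_def by (intro powr_of_real pos)
    moreover have "cos (complex_of_real x) - of_real (cos \<zeta>) = of_real (cos x - cos \<zeta>)"
      by (simp add: cos_of_real)
    ultimately show "strip_integrand \<zeta> s l (of_real x) = f x"
      unfolding strip_integrand_def f_def by (simp only:)
  qed
  also have "\<dots> = integral {- \<zeta>..0} f + integral {0..\<zeta>} f"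
  proof (rule Henstock_Kurzweil_Integration.integral_combine[symmetric])
    have "continuous_on {- \<zeta>..\<zeta>} f"
      unfolding f_def K_def using l pos by (intro continuous_intros continuous_on_powr') auto
    then show "f integrable_on {- \<zeta>..\<zeta>}" by (rule integrable_continuous_interval)
  qed (use z in auto)
  also have "integral {- \<zeta>..0} f = integral {0..\<zeta>} (\<lambda>x. f (- x))"
    using Henstock_Kurzweil_Integration.integral_reflect_real[of \<zeta> 0 "\<lambda>x. f (- x)"] by simp
  also have "integral {0..\<zeta>} (\<lambda>x. f (- x)) + integral {0..\<zeta>} f = integral {0..\<zeta>} (\<lambda>x. f (- x) + f x)"
  proof (rule integral_add[symmetric])
    have "continuous_on {0..\<zeta>} f" "continuous_on {0..\<zeta>} (\<lambda>x. f (- x))"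
      unfolding f_def K_def using l pos z by (auto intro!: continuous_intros continuous_on_powr')
    then show "(\<lambda>x. f (- x)) integrable_on {0..\<zeta>}" "f integrable_on {0..\<zeta>}"
      by (auto intro: integrable_continuous_interval)
  qed
  also have "(\<lambda>x. f (- x) + f x) = (\<lambda>x. 2 * (cos (s * of_real x) * of_real (K x)))"
  proof
    fix x
    have "2 * cos (s * of_real x) = exp (\<i> * s * of_real x) + exp (\<i> * s * of_real (- x))"
      by (simp add: cos_exp_eq mult.assoc)
    moreover have "K (- x) = K x" by (simp add: K_def)
    ultimately show "f (- x) + f x = 2 * (cos (s * of_real x) * of_real (K x))"
      unfolding f_def by (simp only: mult.assoc[symmetric]) (simp add: algebra_simps)
  qed
  also have "integral {0..\<zeta>} (\<lambda>x. 2 * (cos (s * of_real x) * of_real (K x))) = 2 *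
     (of_real (2 powr (l - 1) * sqrt pi * Gamma l * (sin (\<zeta> / 2)) powr (2 * l - 1)) *
     hyp2f1_reg (s + 1 / 2) (1 / 2 - s) (1 / 2 + of_real l) (of_real ((sin (\<zeta> / 2))\<^sup>2)))"
    unfolding K_def by (intro integral_unique has_integral_mult_right Mehler_Dirichlet assms)
  also have "\<dots> = ?R"
  proof -
    have "2 powr l = 2 * 2 powr (l - 1)" by (simp add: powr_diff)
    then show ?thesis by (simp del: of_real_power)
  qed
  finally show ?thesis .
qed

text \<open>For real l > 1 the two evaluations of the strip integral are compared. With sin \<zeta>
  = 2 sin(\<zeta>/2) cos(\<zeta>/2) the factor sin(\<zeta>)^(l-1) cancels and leaves the half-angle
  powers. Continuation then reaches 0 < Re l < 1, where the Laplace form of the kernel is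
  available.\<close>

lemma ferrers_connection:
  fixes \<zeta> :: real and s l :: complex
  assumes z: "0 < \<zeta>" "\<zeta> < pi" and l: "0 < Re l" "Re l < 1 + Re s" and s: "0 < Re s"
  shows "of_real (sqrt pi) * of_real (sin (\<zeta> / 2)) powr l * of_real (cos (\<zeta> / 2)) powr (1 - l) *
      hyp2f1_reg (s + 1 / 2) (1 / 2 - s) (1 / 2 + l) (of_real ((sin (\<zeta> / 2))\<^sup>2)) =
    rGamma l / 2 *
     (exp (\<i> * (s * of_real \<zeta> - l * of_real (pi / 2))) * integral\<^sup>L lpos (jkernel s l (half_cot \<zeta>)) +
      exp (- (\<i> * (s * of_real \<zeta> - l * of_real (pi / 2)))) * integral\<^sup>L lpos (jkernel s l (half_cot (- \<zeta>))))"
    (is "?L l = ?R l")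
proof -
  define S C where "S = sin (\<zeta> / 2)" and "C = cos (\<zeta> / 2)"
  have S: "0 < S" unfolding S_def using z by (intro sin_gt_zero) auto
  have C: "0 < C" unfolding C_def using z by (intro cos_gt_zero) auto
  have S1: "cmod (of_real (S\<^sup>2)) < 1"
  proof -
    have "S\<^sup>2 = 1 - C\<^sup>2" by (simp add: S_def C_def sin_squared_eq)
    then have "S\<^sup>2 < 1" using C by simp
    then show ?thesis by (simp del: of_real_power)
  qed
  have sin: "sin \<zeta> = 2 * S * C" using sin_double[of "\<zeta> / 2"] by (simp add: S_def C_def)
  define U where "U = {l. 0 < Re l} \<inter> {l. Re l < 1 + Re s}"
  have eq: "?L (of_real x) = ?R (of_real x)" if x: "1 < x" "x < 1 + Re s" for x
  proof -
    let ?F = "hyp2f1_reg (s + 1 / 2) (1 / 2 - s) (1 / 2 + of_real x) (of_real (S\<^sup>2))"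
    let ?B = "exp (\<i> * (s * of_real \<zeta> - of_real x * of_real (pi / 2))) * integral\<^sup>L lpos (jkernel s (of_real x) (half_cot \<zeta>)) +
      exp (- (\<i> * (s * of_real \<zeta> - of_real x * of_real (pi / 2)))) * integral\<^sup>L lpos (jkernel s (of_real x) (half_cot (- \<zeta>)))"
    have s0: "s \<noteq> 0" using s by auto
    have m1: "of_real (sin \<zeta> powr (x - 1)) * ?B = of_real (2 powr x * sqrt pi * Gamma x * S powr (2 * x - 1)) * ?F"
      using integral_strip_integrand[OF z x] integral_strip_integrand_eq_hyp2f1_reg[OF z x(1) s0]
      unfolding S_def by simp
    have m2: "2 powr x * sqrt pi * Gamma x * S powr (2 * x - 1) =
        sin \<zeta> powr (x - 1) * (2 * Gamma x * sqrt pi * (S powr x * C powr (1 - x)))"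
    proof -
      have e1: "(2 * S * C) powr (x - 1) = 2 powr (x - 1) * S powr (x - 1) * C powr (x - 1)"
        by (simp only: powr_mult)
      have e2: "C powr (x - 1) * C powr (1 - x) = 1" using C by (simp add: powr_add[symmetric])
      have e3: "S powr (x - 1) * S powr x = S powr (2 * x - 1)" using S by (simp add: powr_add[symmetric])
      have e4: "2 powr x = 2 * 2 powr (x - 1)" by (simp add: powr_diff)
      have "sin \<zeta> powr (x - 1) * (2 * Gamma x * sqrt pi * (S powr x * C powr (1 - x))) =
          (2 * 2 powr (x - 1)) * sqrt pi * Gamma x * (S powr (x - 1) * S powr x) * (C powr (x - 1) * C powr (1 - x))"
        unfolding sin e1 by (simp only: mult_ac)
      then show ?thesis unfolding e2 e3 e4 by (simp only: mult_1_right)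
    qed
    have "of_real (sin \<zeta> powr (x - 1)) * ?B = of_real (sin \<zeta> powr (x - 1)) *
        (of_real (2 * Gamma x * sqrt pi * (S powr x * C powr (1 - x))) * ?F)"
      using m1 unfolding m2 by (simp only: of_real_mult[of "sin \<zeta> powr (x - 1)"] mult.assoc)
    moreover have "sin \<zeta> powr (x - 1) \<noteq> 0" using S C by (simp add: sin)
    ultimately have B: "?B = of_real (2 * Gamma x * sqrt pi * (S powr x * C powr (1 - x))) * ?F"
      by (simp only: mult_cancel_left of_real_eq_0_iff) blast
    have "rGamma (complex_of_real x) * of_real (Gamma x) = 1"
    proof -
      have "0 < Gamma x" using x by (intro Gamma_real_pos) auto
      then show ?thesis
        by (simp only: rGamma_complex_of_real rGamma_inverse_Gamma[of x] of_real_mult[symmetric]) simp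
    qed
    moreover have "of_real S powr of_real x = complex_of_real (S powr x)"
      "of_real C powr (1 - of_real x) = complex_of_real (C powr (1 - x))"
      using S C powr_of_real[of S x] powr_of_real[of C "1 - x"] by auto
    ultimately show ?thesis
      unfolding B S_def[symmetric] C_def[symmetric] by (simp del: of_real_power add: mult_ac)
  qed
  have "?L l = ?R l"
  proof (rule analytic_continuation_real_interval[where f = ?L and g = ?R and S = U and a = 1 and b = "1 + Re s"])
    show "?L holomorphic_on U"
    proof -
      have "(\<lambda>l. hyp2f1_reg (s + 1 / 2) (1 / 2 - s) (1 / 2 + l) (of_real (S\<^sup>2))) holomorphic_on U"
        by (rule holomorphic_on_compose_gen[of "\<lambda>l. 1 / 2 + l", unfolded o_def, OF _ holomorphic_on_hyp2f1_reg[OF S1]])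
           (auto intro!: holomorphic_intros)
      then show ?thesis unfolding S_def[symmetric] C_def[symmetric]
        using S C by (intro holomorphic_intros) auto
    qed
    have J: "(\<lambda>l. integral\<^sup>L lpos (jkernel s l (half_cot z))) holomorphic_on U" for z
      using holomorphic_on_integral_jkernel[OF Re_half_cot[of z], of s] unfolding U_def Collect_conj_eq .
    then show "?R holomorphic_on U" by (intro holomorphic_intros) auto
    show "open U" unfolding U_def by (intro open_Int open_halfspace_Re_gt open_halfspace_Re_lt)
    show "connected U" unfolding U_def
      by (intro convex_connected convex_Int convex_halfspace_Re_gt convex_halfspace_Re_lt)
    show "l \<in> U" using l by (simp add: U_def)
    show "?L (of_real x) = ?R (of_real x)" if "1 < x" "x < 1 + Re s" for x
      using that by (rule eq)
  qed (use s in \<open>auto simp: U_def\<close>)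
  then show ?thesis .
qed

section \<open>The remainder as a double integral\<close>

lemma
  fixes f :: "real \<Rightarrow> 'b::{banach, real_normed_field, second_countable_topology}" and g :: "real \<Rightarrow> 'b"
  assumes f: "integrable lpos f" and g: "integrable lpos g"
  shows integrable_lpos_product: "integrable (lpos \<Otimes>\<^sub>M lpos) (\<lambda>(x, y). f x * g y)"
    and integral_lpos_product: "(\<integral>(x, y). f x * g y \<partial>(lpos \<Otimes>\<^sub>M lpos)) = integral\<^sup>L lpos f * integral\<^sup>L lpos g"
proof -
  have [measurable]: "f \<in> borel_measurable lpos" "g \<in> borel_measurable lpos"
    using f g by auto
  show int: "integrable (lpos \<Otimes>\<^sub>M lpos) (\<lambda>(x, y). f x * g y)"
  proof (rule lpos2.Fubini_integrable)
    show "(\<lambda>(x, y). f x * g y) \<in> borel_measurable (lpos \<Otimes>\<^sub>M lpos)" by measurable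
    show "integrable lpos (\<lambda>x. \<integral>y. norm (case (x, y) of (x, y) \<Rightarrow> f x * g y) \<partial>lpos)"
      using f by (simp add: norm_mult)
    show "AE x in lpos. integrable lpos (\<lambda>y. case (x, y) of (x, y) \<Rightarrow> f x * g y)"
      using g by (intro AE_I2) simp
  qed
  have "(\<integral>(x, y). f x * g y \<partial>(lpos \<Otimes>\<^sub>M lpos)) = (\<integral>x. \<integral>y. f x * g y \<partial>lpos \<partial>lpos)"
    using lpos2.integral_fst'[OF int] by simp
  then show "(\<integral>(x, y). f x * g y \<partial>(lpos \<Otimes>\<^sub>M lpos)) = integral\<^sup>L lpos f * integral\<^sup>L lpos g"
    by simp
qed

text \<open>Because exp(y) - 1 = exp(y) (1 - exp(-y)), the variables separate: the y-integral is
  Beta(x + k, \<sigma> - k) and the q-integral is Gamma(k + 1 - x). The factor Gamma(\<sigma> + x)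
  clears the denominator of the Beta function. The lemma is used with k = N and with k = N +
  1.\<close>

lemma
  fixes x \<sigma> :: real
  assumes x: "- real k < x" "x < real k + 1" and \<sigma>: "real k < \<sigma>"
  defines "m \<equiv> \<lambda>(y, q). exp (- \<sigma> * y) * (1 - exp (- y)) powr (x - 1) * q powr (- x) * exp (- q) *
      ((exp y - 1) * q) ^ k"
  shows integrable_remainder_majorant: "integrable (lpos \<Otimes>\<^sub>M lpos) m"
    and integral_remainder_majorant: "Gamma (\<sigma> + x) * integral\<^sup>L (lpos \<Otimes>\<^sub>M lpos) m =
      Gamma (real k + x) * Gamma (real k + 1 - x) * Gamma (\<sigma> - real k)"
proof -
  define f where "f y = (1 - exp (- y)) powr (x + real k - 1) * exp (- (\<sigma> - real k) * y)" for y
  define g where "g q = q powr (real k + 1 - x - 1) * exp (- q)" for q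
  have a: "0 < x + real k" "0 < \<sigma> - real k" "0 < real k + 1 - x" using x \<sigma> by auto
  have f: "integrable lpos f" "integral\<^sup>L lpos f = Beta (x + real k) (\<sigma> - real k)"
    unfolding f_def by (rule integrable_Beta_exp[OF a(1,2)], rule integral_Beta_exp[OF a(1,2)])
  have g: "integrable lpos g" "integral\<^sup>L lpos g = Gamma (real k + 1 - x)"
    unfolding g_def by (rule Gamma_real_eq_integral[OF a(3)])+
  have eq: "m p = (case p of (y, q) \<Rightarrow> f y * g q)" if pS: "p \<in> space (lpos \<Otimes>\<^sub>M lpos)" for p
  proof -
    obtain y q where p: "p = (y, q)" "0 < y" "0 < q"
      using pS by (auto simp: space_pair_measure space_lpos)
    define r where "r = 1 - exp (- y)"
    have r: "0 < r" using p by (simp add: r_def)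
    have "exp y - 1 = exp y * r" by (simp add: r_def right_diff_distrib exp_minus)
    then have "((exp y - 1) * q) ^ k = exp (real k * y) * r ^ k * q ^ k"
      by (simp add: power_mult_distrib exp_of_nat_mult)
    moreover have "r powr (x + real k - 1) = r powr (x - 1) * r ^ k"
      using r powr_add[of r "x - 1" "real k"] by (simp add: powr_realpow algebra_simps)
    moreover have "q powr (real k + 1 - x - 1) = q powr (- x) * q ^ k"
      using p powr_add[of q "- x" "real k"] by (simp add: powr_realpow algebra_simps)
    moreover have "exp (- (\<sigma> - real k) * y) = exp (- \<sigma> * y) * exp (real k * y)"
      unfolding exp_add[symmetric] by (simp add: algebra_simps)
    ultimately show ?thesis
      unfolding m_def f_def g_def p(1) prod.case r_def[symmetric] by (simp only: mult_ac)
  qed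
  have "integrable (lpos \<Otimes>\<^sub>M lpos) m = integrable (lpos \<Otimes>\<^sub>M lpos) (\<lambda>(y, q). f y * g q)"
    by (intro Bochner_Integration.integrable_cong refl eq)
  then show "integrable (lpos \<Otimes>\<^sub>M lpos) m"
    using integrable_lpos_product[OF f(1) g(1)] by blast
  have "integral\<^sup>L (lpos \<Otimes>\<^sub>M lpos) m = (\<integral>(y, q). f y * g q \<partial>(lpos \<Otimes>\<^sub>M lpos))"
    by (intro Bochner_Integration.integral_cong refl eq)
  also have "\<dots> = Beta (x + real k) (\<sigma> - real k) * Gamma (real k + 1 - x)"
    unfolding integral_lpos_product[OF f(1) g(1)] f(2) g(2) ..
  finally have I: "integral\<^sup>L (lpos \<Otimes>\<^sub>M lpos) m = Beta (x + real k) (\<sigma> - real k) * Gamma (real k + 1 - x)" .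
  have "0 < Gamma (\<sigma> + x)" using x \<sigma> by (intro Gamma_real_pos) linarith
  moreover have "x + real k + (\<sigma> - real k) = \<sigma> + x" by simp
  ultimately show "Gamma (\<sigma> + x) * integral\<^sup>L (lpos \<Otimes>\<^sub>M lpos) m =
      Gamma (real k + x) * Gamma (real k + 1 - x) * Gamma (\<sigma> - real k)"
    unfolding I Beta_def by (simp add: add.commute)
qed

section \<open>The remainder integral, its bounds and its holomorphy\<close>

definition rem_kernel :: "nat \<Rightarrow> complex \<Rightarrow> complex \<Rightarrow> complex \<Rightarrow> real \<times> real \<Rightarrow> complex" where
  "rem_kernel N s l w = (\<lambda>(y, q). exp (- s * of_real y) * of_real (1 - exp (- y)) powr (l - 1) *
     of_real q powr (- l) * of_real (exp (- q)) * exp_rem N w ((exp y - 1) * q))"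

definition rem_int :: "nat \<Rightarrow> complex \<Rightarrow> complex \<Rightarrow> complex \<Rightarrow> complex" where
  "rem_int N s l w = integral\<^sup>L (lpos \<Otimes>\<^sub>M lpos) (rem_kernel N s l w)"

lemma borel_measurable_lpos_pair:
  assumes "f \<in> borel_measurable (borel \<Otimes>\<^sub>M borel)"
  shows "f \<in> borel_measurable (lpos \<Otimes>\<^sub>M lpos)"
proof -
  have "(\<lambda>p. p) \<in> lpos \<Otimes>\<^sub>M lpos \<rightarrow>\<^sub>M borel \<Otimes>\<^sub>M borel"
    by (intro measurable_pair) (auto simp: o_def intro!: measurable_compose[OF measurable_fst] measurable_compose[OF measurable_snd] measurable_restrict_space1)
  from measurable_compose[OF this assms] show ?thesis .
qed

lemma borel_measurable_exp_rem [measurable]: "exp_rem N w \<in> borel_measurable borel"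
  by (intro borel_measurable_continuous_onI continuous_on_exp_rem)

lemma borel_measurable_rem_kernel: "rem_kernel N s l w \<in> borel_measurable (lpos \<Otimes>\<^sub>M lpos)"
  unfolding rem_kernel_def by (rule borel_measurable_lpos_pair) measurable

lemma norm_rem_kernel_eq:
  assumes "0 < y" "0 < q"
  shows "cmod (exp (- s * of_real y) * of_real (1 - exp (- y)) powr (l - 1) *
     of_real q powr (- l) * of_real (exp (- q)) * v) =
     exp (- Re s * y) * (1 - exp (- y)) powr (Re l - 1) * q powr (- Re l) * exp (- q) * cmod v"
  using assms by (simp add: norm_mult norm_powr_real_powr del: of_real_diff)

text \<open>The estimate is made for the product with Gamma(s + l): the bound Gamma(Re s + Re l) for
  that factor cancels exactly, and the right side no longer depends on Im l, Im s or w.\<close>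

lemma integrable_rem_kernel:
  assumes w: "0 < Re w" and l: "- real N < Re l" "Re l < real N + 1" and s: "real N < Re s"
  shows "integrable (lpos \<Otimes>\<^sub>M lpos) (rem_kernel N s l w)"
    and "cmod (Gamma (s + l) * rem_int N s l w) \<le>
      Gamma (real N + Re l) * Gamma (real N + 1 - Re l) * Gamma (Re s - real N) / fact N"
proof -
  define m where "m = (\<lambda>(y, q). exp (- Re s * y) * (1 - exp (- y)) powr (Re l - 1) * q powr (- Re l) * exp (- q) *
      ((exp y - 1) * q) ^ N)"
  have m: "integrable (lpos \<Otimes>\<^sub>M lpos) m" "Gamma (Re s + Re l) * integral\<^sup>L (lpos \<Otimes>\<^sub>M lpos) m =
      Gamma (real N + Re l) * Gamma (real N + 1 - Re l) * Gamma (Re s - real N)"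
    unfolding m_def by (rule integrable_remainder_majorant[OF l s], rule integral_remainder_majorant[OF l s])
  have le: "cmod (rem_kernel N s l w p) \<le> m p / fact N" if pS: "p \<in> space (lpos \<Otimes>\<^sub>M lpos)" for p
  proof -
    obtain y q where p: "p = (y, q)" "0 < y" "0 < q"
      using pS by (auto simp: space_pair_measure space_lpos)
    have "cmod (exp_rem N w ((exp y - 1) * q)) \<le> ((exp y - 1) * q) ^ N / fact N"
      using p by (intro norm_exp_rem_le w) auto
    then show ?thesis
      unfolding rem_kernel_def m_def p(1) prod.case norm_rem_kernel_eq[OF p(2,3)] times_divide_eq_right[symmetric]
      by (rule mult_left_mono) simp
  qed
  have m': "integrable (lpos \<Otimes>\<^sub>M lpos) (\<lambda>p. m p / fact N)"
    by (intro integrable_divide m)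
  then show int: "integrable (lpos \<Otimes>\<^sub>M lpos) (rem_kernel N s l w)"
  proof (rule Bochner_Integration.integrable_bound)
    show "AE p in lpos \<Otimes>\<^sub>M lpos. cmod (rem_kernel N s l w p) \<le> norm (m p / fact N)"
    proof (rule AE_I2)
      fix p assume "p \<in> space (lpos \<Otimes>\<^sub>M lpos)"
      from le[OF this] show "cmod (rem_kernel N s l w p) \<le> norm (m p / fact N)"
        by (rule order_trans) (simp only: real_norm_def abs_ge_self)
    qed
  qed (rule borel_measurable_rem_kernel)
  have "cmod (rem_int N s l w) \<le> (\<integral>p. m p / fact N \<partial>(lpos \<Otimes>\<^sub>M lpos))"
    unfolding rem_int_def
    by (rule order_trans[OF integral_norm_bound]) (intro integral_mono integrable_norm int m' le)
  also have "\<dots> = integral\<^sup>L (lpos \<Otimes>\<^sub>M lpos) m / fact N" by (rule integral_divide_zero)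
  finally have ri: "cmod (rem_int N s l w) \<le> integral\<^sup>L (lpos \<Otimes>\<^sub>M lpos) m / fact N" .
  have G: "0 < Re (s + l)" using l s by simp
  have "cmod (Gamma (s + l)) * cmod (rem_int N s l w) \<le>
      Gamma (Re (s + l)) * (integral\<^sup>L (lpos \<Otimes>\<^sub>M lpos) m / fact N)"
    by (rule mult_mono[OF norm_Gamma_le_Gamma_Re[OF G] ri less_imp_le[OF Gamma_real_pos[OF G]] norm_ge_zero])
  then show "cmod (Gamma (s + l) * rem_int N s l w) \<le>
      Gamma (real N + Re l) * Gamma (real N + 1 - Re l) * Gamma (Re s - real N) / fact N"
    unfolding m(2)[symmetric] by (simp add: norm_mult)
qed

text \<open>The Lipschitz bound leads to the majorant of order N + 1, whose y-integral converges at
  infinity when Re s > N + 1. This is the modified condition on \<nu>.\<close>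

lemma norm_rem_int_diff_le:
  assumes w: "0 < Re w" "0 < Re w'" and l: "- real N < Re l" "Re l < real N + 1" and s: "real N + 1 < Re s"
  shows "cmod (Gamma (s + l) * (rem_int N s l w - rem_int N s l w')) \<le> cmod (w - w') *
      (Gamma (real N + 1 + Re l) * Gamma (real N + 2 - Re l) * Gamma (Re s - real N - 1)) / fact (Suc N)"
proof -
  define m where "m = (\<lambda>(y, q). exp (- Re s * y) * (1 - exp (- y)) powr (Re l - 1) * q powr (- Re l) * exp (- q) *
      ((exp y - 1) * q) ^ Suc N)"
  have a: "- real (Suc N) < Re l" "Re l < real (Suc N) + 1" "real (Suc N) < Re s" using l s by auto
  have m: "integrable (lpos \<Otimes>\<^sub>M lpos) m" "Gamma (Re s + Re l) * integral\<^sup>L (lpos \<Otimes>\<^sub>M lpos) m =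
      Gamma (real (Suc N) + Re l) * Gamma (real (Suc N) + 1 - Re l) * Gamma (Re s - real (Suc N))"
    unfolding m_def by (rule integrable_remainder_majorant[OF a], rule integral_remainder_majorant[OF a])
  have le: "cmod (rem_kernel N s l w p - rem_kernel N s l w' p) \<le> cmod (w - w') / fact (Suc N) * m p"
    if pS: "p \<in> space (lpos \<Otimes>\<^sub>M lpos)" for p
  proof -
    obtain y q where p: "p = (y, q)" "0 < y" "0 < q"
      using pS by (auto simp: space_pair_measure space_lpos)
    define c where "c = exp (- Re s * y) * (1 - exp (- y)) powr (Re l - 1) * q powr (- Re l) * exp (- q)"
    have "cmod (exp_rem N w ((exp y - 1) * q) - exp_rem N w' ((exp y - 1) * q)) \<le>
        cmod (w - w') * ((exp y - 1) * q) ^ Suc N / fact (Suc N)"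
      using p by (intro norm_exp_rem_diff_le w) auto
    then have "c * cmod (exp_rem N w ((exp y - 1) * q) - exp_rem N w' ((exp y - 1) * q)) \<le>
        c * (cmod (w - w') * ((exp y - 1) * q) ^ Suc N / fact (Suc N))"
      by (rule mult_left_mono) (simp add: c_def)
    also have "\<dots> = cmod (w - w') / fact (Suc N) * m p"
      unfolding m_def p(1) prod.case c_def[symmetric] by (simp only: times_divide_eq_right times_divide_eq_left mult_ac)
    finally show ?thesis
      unfolding rem_kernel_def p(1) prod.case right_diff_distrib[symmetric] norm_rem_kernel_eq[OF p(2,3)] c_def .
  qed
  have int: "integrable (lpos \<Otimes>\<^sub>M lpos) (rem_kernel N s l w)" "integrable (lpos \<Otimes>\<^sub>M lpos) (rem_kernel N s l w')"
    using l s w by (auto intro!: integrable_rem_kernel(1))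
  have "rem_int N s l w - rem_int N s l w' =
      (\<integral>p. rem_kernel N s l w p - rem_kernel N s l w' p \<partial>(lpos \<Otimes>\<^sub>M lpos))"
    unfolding rem_int_def by (rule Bochner_Integration.integral_diff[OF int, symmetric])
  also have "cmod \<dots> \<le> (\<integral>p. cmod (w - w') / fact (Suc N) * m p \<partial>(lpos \<Otimes>\<^sub>M lpos))"
    by (rule order_trans[OF integral_norm_bound])
       (intro integral_mono integrable_norm Bochner_Integration.integrable_diff int integrable_mult_right m(1) le)
  also have "\<dots> = cmod (w - w') / fact (Suc N) * integral\<^sup>L (lpos \<Otimes>\<^sub>M lpos) m"
    by (rule integral_mult_right_zero)
  finally have ri: "cmod (rem_int N s l w - rem_int N s l w') \<le>
      cmod (w - w') / fact (Suc N) * integral\<^sup>L (lpos \<Otimes>\<^sub>M lpos) m" .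
  have G: "0 < Re (s + l)" using l s by simp
  have "cmod (Gamma (s + l)) * cmod (rem_int N s l w - rem_int N s l w') \<le>
      Gamma (Re (s + l)) * (cmod (w - w') / fact (Suc N) * integral\<^sup>L (lpos \<Otimes>\<^sub>M lpos) m)"
    by (rule mult_mono[OF norm_Gamma_le_Gamma_Re[OF G] ri less_imp_le[OF Gamma_real_pos[OF G]] norm_ge_zero])
  also have "\<dots> = cmod (w - w') / fact (Suc N) * (Gamma (Re s + Re l) * integral\<^sup>L (lpos \<Otimes>\<^sub>M lpos) m)"
    by simp
  finally show ?thesis
    unfolding m(2) norm_mult by (simp add: algebra_simps)
qed

lemma holomorphic_on_rem_int:
  assumes w: "0 < Re w" and s: "real N < Re s"
  shows "(\<lambda>l. rem_int N s l w) holomorphic_on ({l. - real N < Re l} \<inter> {l. Re l < real N + 1})"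
proof -
  let ?f = "\<lambda>(y, q). exp (- s * of_real y) / of_real (1 - exp (- y)) * of_real (exp (- q)) * exp_rem N w ((exp y - 1) * q)"
  let ?g = "\<lambda>(y, q). complex_of_real (ln (1 - exp (- y)) - ln q)"
  have eq: "rem_kernel N s l w p = ?f p * exp (l * ?g p)" if pS: "p \<in> space (lpos \<Otimes>\<^sub>M lpos)" for p l
  proof -
    obtain y q where p: "p = (y, q)" "0 < y" "0 < q"
      using pS by (auto simp: space_pair_measure space_lpos)
    have e: "0 < 1 - exp (- y)" using p by simp
    have "of_real (1 - exp (- y)) powr (l - 1) = exp (l * of_real (ln (1 - exp (- y)))) / of_real (1 - exp (- y))"
      unfolding powr_complex_of_real_eq_exp[OF e] left_diff_distrib exp_diff using e
      by (simp add: exp_of_real del: of_real_diff)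
    moreover have "of_real q powr (- l) = exp (- (l * of_real (ln q)))"
      unfolding powr_complex_of_real_eq_exp[OF p(3)] by simp
    moreover have "exp (l * complex_of_real (ln (1 - exp (- y)) - ln q)) =
        exp (l * of_real (ln (1 - exp (- y)))) * exp (- (l * of_real (ln q)))"
      unfolding exp_add[symmetric] of_real_diff right_diff_distrib by simp
    ultimately show ?thesis
      unfolding rem_kernel_def p(1) prod.case by (simp only: times_divide_eq_left times_divide_eq_right mult_ac)
  qed
  have "(\<lambda>l. \<integral>p. ?f p * exp (l * ?g p) \<partial>(lpos \<Otimes>\<^sub>M lpos)) holomorphic_on ({l. - real N < Re l} \<inter> {l. Re l < real N + 1})"
  proof (rule holomorphic_on_integral_exp)
    show "open ({l. - real N < Re l} \<inter> {l. Re l < real N + 1})"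
      by (intro open_Int open_halfspace_Re_gt open_halfspace_Re_lt)
    show "?f \<in> borel_measurable (lpos \<Otimes>\<^sub>M lpos)" by (rule borel_measurable_lpos_pair) measurable
    show "?g \<in> borel_measurable (lpos \<Otimes>\<^sub>M lpos)" by (rule borel_measurable_lpos_pair) measurable
    fix l assume "l \<in> {l. - real N < Re l} \<inter> {l. Re l < real N + 1}"
    then have "integrable (lpos \<Otimes>\<^sub>M lpos) (rem_kernel N s l w)"
      using w s by (intro integrable_rem_kernel) auto
    moreover have "integrable (lpos \<Otimes>\<^sub>M lpos) (rem_kernel N s l w) =
        integrable (lpos \<Otimes>\<^sub>M lpos) (\<lambda>p. ?f p * exp (l * ?g p))"
      by (intro Bochner_Integration.integrable_cong refl eq)
    ultimately show "integrable (lpos \<Otimes>\<^sub>M lpos) (\<lambda>p. ?f p * exp (l * ?g p))" by blast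
  qed
  moreover have "rem_int N s l w = (\<integral>p. ?f p * exp (l * ?g p) \<partial>(lpos \<Otimes>\<^sub>M lpos))" for l
    unfolding rem_int_def by (intro Bochner_Integration.integral_cong refl eq)
  ultimately show ?thesis by simp
qed

section \<open>Reflection formula and exact moments of the Taylor terms\<close>

lemma not_nonpos_Ints_if_Re_pos:
  fixes z :: complex
  assumes "0 < Re z"
  shows "z \<notin> \<int>\<^sub>\<le>\<^sub>0"
proof
  assume "z \<in> \<int>\<^sub>\<le>\<^sub>0"
  then obtain n where "z = of_int n" "n \<le> 0" by (rule nonpos_Ints_cases)
  then show False using assms by simp
qed

text \<open>Each Pochhammer symbol is a quotient of Gamma values, and the two reciprocal Gammas
  combine to the sine. In the strip the shifted arguments have positive real part, so the identity
  holds at its integers too, where both sides are 0.\<close>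

lemma pochhammer_reflection:
  fixes z :: complex
  assumes "- real n < Re z" "Re z < real n + 1"
  shows "pochhammer z n * pochhammer (1 - z) n =
    sin (of_real pi * z) / of_real pi * Gamma (z + of_nat n) * Gamma (1 - z + of_nat n)"
proof -
  have p: "pochhammer u n = rGamma u * Gamma (u + of_nat n)" if "0 < Re (u + of_nat n)" for u :: complex
  proof -
    from not_nonpos_Ints_if_Re_pos[OF that] have "Gamma (u + of_nat n) \<noteq> 0" by (simp add: Gamma_eq_zero_iff)
    then show ?thesis
      using pochhammer_rGamma[of u n] by (simp add: rGamma_inverse_Gamma)
  qed
  have "pochhammer z n * pochhammer (1 - z) n =
      (rGamma z * rGamma (1 - z)) * Gamma (z + of_nat n) * Gamma (1 - z + of_nat n)"
    using p[of z] p[of "1 - z"] assms by simp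
  also have "rGamma z * rGamma (1 - z) = sin (of_real pi * z) / of_real pi"
    by (rule rGamma_reflection_complex)
  finally show ?thesis .
qed

text \<open>For real b this is the real Beta integral, and both sides are holomorphic in b. Only b
  has to be complex, since the expansion is first obtained for real l and complex s.\<close>

lemma
  fixes a :: real and b :: complex
  assumes a: "0 < a" and b: "0 < Re b"
  shows integrable_Beta_exp_complex:
      "integrable lpos (\<lambda>y. of_real ((1 - exp (- y)) powr (a - 1)) * exp (- b * of_real y))"
    and integral_Beta_exp_complex:
      "(\<integral>y. of_real ((1 - exp (- y)) powr (a - 1)) * exp (- b * of_real y) \<partial>lpos) =
        of_real (Gamma a) * Gamma b * rGamma (of_real a + b)"
proof -
  define f where "f y = complex_of_real ((1 - exp (- y)) powr (a - 1))" for y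
  have fm [measurable]: "f \<in> borel_measurable borel" unfolding f_def by measurable
  have int: "integrable lpos (\<lambda>y. f y * exp (b * - of_real y))" if "0 < Re b" for b
    using integrable_Beta_exp[OF a that]
  proof (rule Bochner_Integration.integrable_bound)
    show "(\<lambda>y. f y * exp (b * - of_real y)) \<in> borel_measurable lpos"
      by (rule borel_measurable_lpos) measurable
    show "AE y in lpos. norm (f y * exp (b * - of_real y)) \<le> norm ((1 - exp (- y)) powr (a - 1) * exp (- Re b * y))"
      by (intro AE_I2) (simp add: f_def norm_mult)
  qed
  from int[OF b] show "integrable lpos (\<lambda>y. of_real ((1 - exp (- y)) powr (a - 1)) * exp (- b * of_real y))"
    by (simp add: f_def)
  have "(\<integral>y. f y * exp (b * - of_real y) \<partial>lpos) = of_real (Gamma a) * Gamma b * rGamma (of_real a + b)"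
  proof (rule analytic_continuation_real_interval[where f = "\<lambda>b. \<integral>y. f y * exp (b * - of_real y) \<partial>lpos"
        and g = "\<lambda>b. of_real (Gamma a) * Gamma b * rGamma (of_real a + b)" and S = "{b. 0 < Re b}" and a = 0 and b = 1])
    show "(\<lambda>b. \<integral>y. f y * exp (b * - of_real y) \<partial>lpos) holomorphic_on {b. 0 < Re b}"
    proof (rule holomorphic_on_integral_exp)
      show "(\<lambda>y. - complex_of_real y) \<in> borel_measurable lpos" by (rule borel_measurable_lpos) measurable
    qed (use int in \<open>auto intro!: borel_measurable_lpos open_halfspace_Re_gt\<close>)
    show "(\<lambda>b. of_real (Gamma a) * Gamma b * rGamma (of_real a + b)) holomorphic_on {b. 0 < Re b}"
      by (intro holomorphic_intros) (auto dest: not_nonpos_Ints_if_Re_pos)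
    show "(\<integral>y. f y * exp (of_real x * - of_real y) \<partial>lpos) =
        of_real (Gamma a) * Gamma (of_real x) * rGamma (of_real a + of_real x)" if x: "0 < x" for x
    proof -
      have "(\<integral>y. f y * exp (of_real x * - of_real y) \<partial>lpos) =
          (\<integral>y. complex_of_real ((1 - exp (- y)) powr (a - 1) * exp (- x * y)) \<partial>lpos)"
        by (intro Bochner_Integration.integral_cong) (auto simp: f_def exp_of_real[symmetric])
      also have "\<dots> = of_real (Beta a x)"
        unfolding integral_complex_of_real integral_Beta_exp[OF a x] ..
      also have "\<dots> = of_real (Gamma a) * Gamma (of_real x) * rGamma (of_real a + of_real x)"
        by (simp add: Beta_def Gamma_complex_of_real rGamma_inverse_Gamma divide_inverse flip: of_real_add)
      finally show ?thesis .
    qed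
  qed (use b in \<open>auto intro!: open_halfspace_Re_gt convex_connected convex_halfspace_Re_gt\<close>)
  then show "(\<integral>y. of_real ((1 - exp (- y)) powr (a - 1)) * exp (- b * of_real y) \<partial>lpos) =
        of_real (Gamma a) * Gamma b * rGamma (of_real a + b)" by (simp add: f_def)
qed

text \<open>With N = 0 no polynomial is subtracted, and the q-integral is a Gamma integral with rate
  v = 1 + w (exp(y) - 1), where Re v > 0. This links the double integral to the contour
  integrals.\<close>

lemma rem_int_0:
  assumes w: "0 < Re w" and l: "0 < Re l" "Re l < 1" and s: "0 < Re s"
  shows "rem_int 0 s l w = Gamma (1 - l) * integral\<^sup>L lpos (jkernel s l w)"
proof -
  have int: "integrable (lpos \<Otimes>\<^sub>M lpos) (rem_kernel 0 s l w)"
    using assms by (intro integrable_rem_kernel) auto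
  have "rem_int 0 s l w = (\<integral>y. \<integral>q. rem_kernel 0 s l w (y, q) \<partial>lpos \<partial>lpos)"
    unfolding rem_int_def by (rule lpos2.integral_fst'[OF int, symmetric])
  also have "\<dots> = (\<integral>y. Gamma (1 - l) * jkernel s l w y \<partial>lpos)"
  proof (intro Bochner_Integration.integral_cong refl)
    fix y assume "y \<in> space lpos"
    then have y: "0 < y" by (simp add: space_lpos)
    define v where "v = 1 + w * of_real (exp y - 1)"
    have "Re v = 1 + Re w * (exp y - 1)" by (simp add: v_def)
    also have "\<dots> > 0" using w y by (intro add_pos_nonneg mult_nonneg_nonneg) auto
    finally have v: "0 < Re v" .
    define c where "c = exp (- s * of_real y) * of_real (1 - exp (- y)) powr (l - 1)"
    have "(\<integral>q. rem_kernel 0 s l w (y, q) \<partial>lpos) = (\<integral>q. c * (of_real q powr (1 - l - 1) * exp (- v * of_real q)) \<partial>lpos)"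
    proof (intro Bochner_Integration.integral_cong refl)
      fix q
      have "of_real (exp (- q)) * exp_rem 0 w ((exp y - 1) * q) = exp (- v * of_real q)"
        by (simp add: exp_rem_def v_def exp_of_real[symmetric] exp_add[symmetric] algebra_simps)
      then show "rem_kernel 0 s l w (y, q) = c * (of_real q powr (1 - l - 1) * exp (- v * of_real q))"
        unfolding rem_kernel_def prod.case c_def by (simp add: mult.assoc)
    qed
    also have "\<dots> = c * (Gamma (1 - l) * v powr (- (1 - l)))"
      using integral_Gamma_Laplace[of "1 - l" v] l v by (subst integral_mult_right_zero) simp
    finally show "(\<integral>q. rem_kernel 0 s l w (y, q) \<partial>lpos) = Gamma (1 - l) * jkernel s l w y"
      unfolding c_def jkernel_def v_def[symmetric] by (simp add: mult_ac)
  qed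
  also have "\<dots> = Gamma (1 - l) * integral\<^sup>L lpos (jkernel s l w)" by (rule integral_mult_right_zero)
  finally show ?thesis .
qed

text \<open>These are the integrals of the individual Taylor terms. The variables separate as for
  the majorant, but with s kept complex the values are exact.\<close>

lemma
  fixes l :: real and s :: complex
  assumes l: "- real n < l" "l < real n + 1" and s: "real n < Re s"
  defines "m \<equiv> \<lambda>(y, q). exp (- s * of_real y) * of_real (1 - exp (- y)) powr (of_real l - 1) *
      of_real q powr (- of_real l) * of_real (exp (- q)) * of_real (((exp y - 1) * q) ^ n)"
  shows integrable_remainder_moment: "integrable (lpos \<Otimes>\<^sub>M lpos) m"
    and integral_remainder_moment: "integral\<^sup>L (lpos \<Otimes>\<^sub>M lpos) m = of_real (Gamma (l + real n)) *
      Gamma (s - of_nat n) * rGamma (s + of_real l) * of_real (Gamma (real n + 1 - l))"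
proof -
  define f where "f y = complex_of_real ((1 - exp (- y)) powr (l + real n - 1)) * exp (- (s - of_nat n) * of_real y)" for y
  define g where "g q = complex_of_real (q powr (real n + 1 - l - 1) * exp (- q))" for q
  have a: "0 < l + real n" "0 < Re (s - of_nat n)" "0 < real n + 1 - l" using l s by auto
  have f: "integrable lpos f" "integral\<^sup>L lpos f = of_real (Gamma (l + real n)) * Gamma (s - of_nat n) *
      rGamma (of_real (l + real n) + (s - of_nat n))"
    unfolding f_def by (rule integrable_Beta_exp_complex[OF a(1,2)], rule integral_Beta_exp_complex[OF a(1,2)])
  have g: "integrable lpos g" "integral\<^sup>L lpos g = of_real (Gamma (real n + 1 - l))"
    unfolding g_def complex_of_real_integrable_eq integral_complex_of_real
    using Gamma_real_eq_integral[OF a(3)] by auto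
  have eq: "m p = (case p of (y, q) \<Rightarrow> f y * g q)" if pS: "p \<in> space (lpos \<Otimes>\<^sub>M lpos)" for p
  proof -
    obtain y q where p: "p = (y, q)" "0 < y" "0 < q"
      using pS by (auto simp: space_pair_measure space_lpos)
    define r where "r = 1 - exp (- y)"
    have r: "0 < r" using p by (simp add: r_def)
    have "exp y - 1 = exp y * r" by (simp add: r_def right_diff_distrib exp_minus)
    then have "((exp y - 1) * q) ^ n = exp (real n * y) * r ^ n * q ^ n"
      by (simp add: power_mult_distrib exp_of_nat_mult)
    moreover have "r powr (l + real n - 1) = r powr (l - 1) * r ^ n"
      using r powr_add[of r "l - 1" "real n"] by (simp add: powr_realpow algebra_simps)
    moreover have "q powr (real n + 1 - l - 1) = q powr (- l) * q ^ n"
      using p powr_add[of q "- l" "real n"] by (simp add: powr_realpow algebra_simps)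
    moreover have "exp (- (s - of_nat n) * of_real y) = exp (- s * of_real y) * of_real (exp (real n * y))"
      unfolding exp_of_real[symmetric] exp_add[symmetric] by (simp add: algebra_simps)
    moreover have "of_real r powr (of_real l - 1) = complex_of_real (r powr (l - 1))"
      using powr_of_real[of r "l - 1"] r by simp
    moreover have "of_real q powr (- of_real l) = complex_of_real (q powr (- l))"
      using powr_of_real[of q "- l"] p by simp
    ultimately show ?thesis
      unfolding m_def f_def g_def p(1) prod.case r_def[symmetric] by (simp only: of_real_mult mult_ac)
  qed
  have "integrable (lpos \<Otimes>\<^sub>M lpos) m = integrable (lpos \<Otimes>\<^sub>M lpos) (\<lambda>(y, q). f y * g q)"
    by (intro Bochner_Integration.integrable_cong refl eq)
  then show "integrable (lpos \<Otimes>\<^sub>M lpos) m"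
    using integrable_lpos_product[OF f(1) g(1)] by blast
  have "integral\<^sup>L (lpos \<Otimes>\<^sub>M lpos) m = (\<integral>(y, q). f y * g q \<partial>(lpos \<Otimes>\<^sub>M lpos))"
    by (intro Bochner_Integration.integral_cong refl eq)
  also have "\<dots> = integral\<^sup>L lpos f * integral\<^sup>L lpos g"
    by (rule integral_lpos_product[OF f(1) g(1)])
  also have "\<dots> = of_real (Gamma (l + real n)) * Gamma (s - of_nat n) *
      rGamma (of_real (l + real n) + (s - of_nat n)) * of_real (Gamma (real n + 1 - l))"
    unfolding f(2) g(2) ..
  also have "of_real (l + real n) + (s - of_nat n) = s + of_real l" by simp
  finally show "integral\<^sup>L (lpos \<Otimes>\<^sub>M lpos) m = of_real (Gamma (l + real n)) *
      Gamma (s - of_nat n) * rGamma (s + of_real l) * of_real (Gamma (real n + 1 - l))" .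
qed

text \<open>The prefactor sin(\<pi> l)/\<pi> does two things by reflection: with Gamma(1 - l) it
  produces the rGamma(l) of the connection formula, and with the moments it produces the Pochhammer
  symbols of the coefficients.\<close>

lemma rem_int_expansion:
  fixes l :: real and s w :: complex
  assumes w: "0 < Re w" and l: "0 < l" "l < 1" and s: "real N < Re s"
  shows "sin (of_real pi * of_real l) / of_real pi * Gamma (s + of_real l) * w ^ N * rem_int N s (of_real l) w =
    rGamma (of_real l) * Gamma (s + of_real l) * integral\<^sup>L lpos (jkernel s (of_real l) w) -
    (\<Sum>n<N. pochhammer (of_real l) n * pochhammer (1 - of_real l) n / fact n * Gamma (s - of_nat n) * (- w) ^ n)"
proof -
  define c where "c = sin (of_real pi * complex_of_real l) / of_real pi"
  define m where "m n = (\<lambda>(y, q). exp (- s * of_real y) * of_real (1 - exp (- y)) powr (of_real l - 1) *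
      of_real q powr (- of_real l) * of_real (exp (- q)) * complex_of_real (((exp y - 1) * q) ^ n))" for n :: nat
  have m: "integrable (lpos \<Otimes>\<^sub>M lpos) (m n)" "integral\<^sup>L (lpos \<Otimes>\<^sub>M lpos) (m n) = of_real (Gamma (l + real n)) *
      Gamma (s - of_nat n) * rGamma (s + of_real l) * of_real (Gamma (real n + 1 - l))" if n: "n < N" for n
  proof -
    have a: "- real n < l" "l < real n + 1" "real n < Re s" using l s n by auto
    show "integrable (lpos \<Otimes>\<^sub>M lpos) (m n)" "integral\<^sup>L (lpos \<Otimes>\<^sub>M lpos) (m n) = of_real (Gamma (l + real n)) *
      Gamma (s - of_nat n) * rGamma (s + of_real l) * of_real (Gamma (real n + 1 - l))"
      unfolding m_def by (rule integrable_remainder_moment[OF a], rule integral_remainder_moment[OF a])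
  qed
  have w0: "w \<noteq> 0" using w by auto
  have k0: "integrable (lpos \<Otimes>\<^sub>M lpos) (rem_kernel 0 s (of_real l) w)"
    using w l s by (intro integrable_rem_kernel) auto
  have "w ^ N * rem_int N s (of_real l) w = (\<integral>p. w ^ N * rem_kernel N s (of_real l) w p \<partial>(lpos \<Otimes>\<^sub>M lpos))"
    unfolding rem_int_def by (rule integral_mult_right_zero[symmetric])
  also have "\<dots> = (\<integral>p. rem_kernel 0 s (of_real l) w p - (\<Sum>n<N. (- w) ^ n / fact n * m n p) \<partial>(lpos \<Otimes>\<^sub>M lpos))"
  proof (intro Bochner_Integration.integral_cong refl)
    fix p :: "real \<times> real"
    obtain y q where p: "p = (y, q)" by (cases p)
    define r where "r = (exp y - 1) * q"
    define d where "d = exp (- s * of_real y) * of_real (1 - exp (- y)) powr (of_real l - 1) *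
      of_real q powr (- of_real l) * complex_of_real (exp (- q))"
    \<comment> \<open>Multiplying by w^N undoes the normalisation, and the remainders of order N and
      0 then differ by the Taylor polynomial.\<close>
    have "w ^ N * exp_rem N w r = exp_rem 0 w r - (\<Sum>n<N. (- w) ^ n / fact n * of_real (r ^ n))"
      using w0 by (simp add: exp_rem_def power_mult_distrib[of "- w" "of_real r", simplified])
    then have "d * (w ^ N * exp_rem N w r) = d * exp_rem 0 w r - (\<Sum>n<N. (- w) ^ n / fact n * (d * of_real (r ^ n)))"
      by (simp only: right_diff_distrib sum_distrib_left mult_ac)
    then show "w ^ N * rem_kernel N s (of_real l) w p =
        rem_kernel 0 s (of_real l) w p - (\<Sum>n<N. (- w) ^ n / fact n * m n p)"
      unfolding rem_kernel_def m_def p prod.case d_def[symmetric] r_def[symmetric] by (simp only: mult.left_commute)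
  qed
  also have "\<dots> = rem_int 0 s (of_real l) w - (\<Sum>n<N. (- w) ^ n / fact n * integral\<^sup>L (lpos \<Otimes>\<^sub>M lpos) (m n))"
    unfolding rem_int_def using k0 m(1)
    by (subst Bochner_Integration.integral_diff) (auto simp: Bochner_Integration.integral_sum)
  also have "rem_int 0 s (of_real l) w = Gamma (1 - of_real l) * integral\<^sup>L lpos (jkernel s (of_real l) w)"
    using w l s by (intro rem_int_0) auto
  finally have main: "w ^ N * rem_int N s (of_real l) w = Gamma (1 - of_real l) * integral\<^sup>L lpos (jkernel s (of_real l) w)
      - (\<Sum>n<N. (- w) ^ n / fact n * integral\<^sup>L (lpos \<Otimes>\<^sub>M lpos) (m n))" .
  have c0: "c * Gamma (1 - of_real l) = rGamma (of_real l)"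
  proof -
    have "1 - complex_of_real l \<notin> \<int>\<^sub>\<le>\<^sub>0" using l by (intro not_nonpos_Ints_if_Re_pos) auto
    then have "rGamma (1 - complex_of_real l) * Gamma (1 - of_real l) = 1"
      by (simp add: rGamma_inverse_Gamma Gamma_eq_zero_iff)
    then show ?thesis
      unfolding c_def rGamma_reflection_complex[symmetric] by (simp add: mult.assoc)
  qed
  have G: "Gamma (s + of_real l) * rGamma (s + of_real l) = 1"
  proof -
    have "s + of_real l \<notin> \<int>\<^sub>\<le>\<^sub>0" using l s by (intro not_nonpos_Ints_if_Re_pos) auto
    then show ?thesis by (simp add: rGamma_inverse_Gamma Gamma_eq_zero_iff)
  qed
  have cn: "c * Gamma (s + of_real l) * ((- w) ^ n / fact n * integral\<^sup>L (lpos \<Otimes>\<^sub>M lpos) (m n)) =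
      pochhammer (of_real l) n * pochhammer (1 - of_real l) n / fact n * Gamma (s - of_nat n) * (- w) ^ n"
    if n: "n < N" for n
  proof -
    have "pochhammer (of_real l) n * pochhammer (1 - of_real l) n =
        c * Gamma (of_real l + of_nat n) * Gamma (1 - of_real l + of_nat n)"
      unfolding c_def using l by (intro pochhammer_reflection) auto
    also have "Gamma (of_real l + of_nat n) = complex_of_real (Gamma (l + real n))"
      by (simp add: Gamma_complex_of_real[symmetric])
    also have "Gamma (1 - of_real l + of_nat n) = complex_of_real (Gamma (real n + 1 - l))"
      by (simp add: Gamma_complex_of_real[symmetric] algebra_simps)
    finally have P: "pochhammer (of_real l) n * pochhammer (1 - of_real l) n =
        c * of_real (Gamma (l + real n)) * of_real (Gamma (real n + 1 - l))" .
    have "c * Gamma (s + of_real l) * ((- w) ^ n / fact n * integral\<^sup>L (lpos \<Otimes>\<^sub>M lpos) (m n)) =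
      (c * of_real (Gamma (l + real n)) * of_real (Gamma (real n + 1 - l))) / fact n * Gamma (s - of_nat n) * (- w) ^ n *
      (Gamma (s + of_real l) * rGamma (s + of_real l))"
      unfolding m(2)[OF n] by (simp only: times_divide_eq_left times_divide_eq_right mult_ac)
    then show ?thesis unfolding P G by simp
  qed
  have "c * Gamma (s + of_real l) * w ^ N * rem_int N s (of_real l) w =
      c * Gamma (s + of_real l) * (w ^ N * rem_int N s (of_real l) w)" by (simp only: mult.assoc)
  also have "\<dots> = (c * Gamma (1 - of_real l)) * Gamma (s + of_real l) * integral\<^sup>L lpos (jkernel s (of_real l) w)
      - (\<Sum>n<N. c * Gamma (s + of_real l) * ((- w) ^ n / fact n * integral\<^sup>L (lpos \<Otimes>\<^sub>M lpos) (m n)))"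
    unfolding main right_diff_distrib sum_distrib_left by (simp only: mult_ac)
  also have "\<dots> = rGamma (of_real l) * Gamma (s + of_real l) * integral\<^sup>L lpos (jkernel s (of_real l) w)
      - (\<Sum>n<N. pochhammer (of_real l) n * pochhammer (1 - of_real l) n / fact n * Gamma (s - of_nat n) * (- w) ^ n)"
    unfolding c0 by (intro arg_cong2[where f = "(-)"] refl sum.cong cn) simp
  finally show ?thesis unfolding c_def .
qed

section \<open>The expansion in the full strip\<close>

text \<open>The interval from 0 to 1 lies in the strip for every N, and on it the connection formula
  and the expansion of the kernels both apply. Every factor is holomorphic in the strip; in
  particular Re (s + l) > 0 there, because Re s > N.\<close>

lemma ferrers_expansion:
  fixes \<zeta> :: real and s l :: complex
  assumes z: "0 < \<zeta>" "\<zeta> < pi" and l: "- real N < Re l" "Re l < real N + 1" and s: "real N < Re s"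
  defines "\<gamma> \<equiv> \<lambda>l. s * of_real \<zeta> - l * of_real (pi / 2)"
  shows "Gamma (s + l) * (of_real (sqrt pi) * of_real (sin (\<zeta> / 2)) powr l * of_real (cos (\<zeta> / 2)) powr (1 - l) *
      hyp2f1_reg (s + 1 / 2) (1 / 2 - s) (1 / 2 + l) (of_real ((sin (\<zeta> / 2))\<^sup>2))) =
    (\<Sum>n<N. pochhammer l n * pochhammer (1 - l) n / fact n * Gamma (s - of_nat n) *
       ((exp (\<i> * \<gamma> l) * (- half_cot \<zeta>) ^ n + exp (- (\<i> * \<gamma> l)) * (- half_cot (- \<zeta>)) ^ n) / 2)) +
    sin (of_real pi * l) / (2 * of_real pi) *
      (exp (\<i> * \<gamma> l) * half_cot \<zeta> ^ N * (Gamma (s + l) * rem_int N s l (half_cot \<zeta>)) +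
       exp (- (\<i> * \<gamma> l)) * half_cot (- \<zeta>) ^ N * (Gamma (s + l) * rem_int N s l (half_cot (- \<zeta>))))"
    (is "?L l = ?R l")
proof (rule analytic_continuation_real_interval[where f = ?L and g = ?R and a = 0 and b = 1
      and S = "{l. - real N < Re l} \<inter> {l. Re l < real N + 1}"])
  let ?U = "{l. - real N < Re l} \<inter> {l. Re l < real N + 1}"
  have s0: "0 < Re s" using s by linarith
  have G: "(\<lambda>l. Gamma (s + l)) holomorphic_on ?U"
  proof (intro holomorphic_intros)
    fix l assume "l \<in> ?U"
    then show "s + l \<notin> \<int>\<^sub>\<le>\<^sub>0" using s by (intro not_nonpos_Ints_if_Re_pos) auto
  qed
  have S: "0 < sin (\<zeta> / 2)" using z by (intro sin_gt_zero) auto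
  have C: "0 < cos (\<zeta> / 2)" using z by (intro cos_gt_zero) auto
  have S1: "cmod (of_real ((sin (\<zeta> / 2))\<^sup>2)) < 1"
  proof -
    have "(sin (\<zeta> / 2))\<^sup>2 < 1" using C by (simp add: sin_squared_eq)
    then show ?thesis by (simp del: of_real_power)
  qed
  have F: "(\<lambda>l. hyp2f1_reg (s + 1 / 2) (1 / 2 - s) (1 / 2 + l) (of_real ((sin (\<zeta> / 2))\<^sup>2))) holomorphic_on ?U"
    by (rule holomorphic_on_compose_gen[of "\<lambda>l. 1 / 2 + l", unfolded o_def, OF _ holomorphic_on_hyp2f1_reg[OF S1]])
       (auto intro!: holomorphic_intros)
  show "?L holomorphic_on ?U" using S C by (intro holomorphic_intros G F) auto
  have p1: "(\<lambda>l. pochhammer l n) holomorphic_on ?U" for n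
    unfolding pochhammer_prod by (intro holomorphic_on_prod holomorphic_on_add holomorphic_on_ident holomorphic_on_const)
  have p2: "(\<lambda>l. pochhammer (1 - l) n) holomorphic_on ?U" for n
    unfolding pochhammer_prod
    by (intro holomorphic_on_prod holomorphic_on_add holomorphic_on_diff holomorphic_on_ident holomorphic_on_const)
  have \<gamma>: "\<gamma> holomorphic_on ?U"
    unfolding \<gamma>_def by (intro holomorphic_on_diff holomorphic_on_mult holomorphic_on_ident holomorphic_on_const)
  have ex: "(\<lambda>l. exp (\<i> * \<gamma> l)) holomorphic_on ?U" "(\<lambda>l. exp (- (\<i> * \<gamma> l))) holomorphic_on ?U"
    by (intro holomorphic_on_exp' holomorphic_on_minus holomorphic_on_mult holomorphic_on_const \<gamma>)+
  have sinhol: "(\<lambda>l. sin (complex_of_real pi * l)) holomorphic_on ?U"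
    by (intro holomorphic_on_sin' holomorphic_on_mult holomorphic_on_ident holomorphic_on_const)
  have rem: "(\<lambda>l. rem_int N s l (half_cot c)) holomorphic_on ?U" for c
    using s by (intro holomorphic_on_rem_int) (simp_all add: Re_half_cot)
  show "?R holomorphic_on ?U"
    by (intro holomorphic_on_sum holomorphic_on_add holomorphic_on_mult holomorphic_on_divide
        holomorphic_on_const G rem p1 p2 ex sinhol) simp_all
  show "open ?U" by (intro open_Int open_halfspace_Re_gt open_halfspace_Re_lt)
  show "connected ?U" by (intro convex_connected convex_Int convex_halfspace_Re_gt convex_halfspace_Re_lt)
  show "l \<in> ?U" using l by simp
  show "?L (of_real x) = ?R (of_real x)" if x: "0 < x" "x < 1" for x
  proof -
    define c where "c = sin (of_real pi * complex_of_real x) / of_real pi"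
    define g where "g = Gamma (s + of_real x)"
    define P where "P n = pochhammer (complex_of_real x) n * pochhammer (1 - of_real x) n / fact n * Gamma (s - of_nat n)" for n
    define J R where "J t = integral\<^sup>L lpos (jkernel s (of_real x) (half_cot t))"
      and "R t = rem_int N s (of_real x) (half_cot t)" for t
    define e1 e2 where "e1 = exp (\<i> * \<gamma> (of_real x))" and "e2 = exp (- (\<i> * \<gamma> (of_real x)))"
    have E: "rGamma (of_real x) * g * J t = (\<Sum>n<N. P n * (- half_cot t) ^ n) + c * g * half_cot t ^ N * R t" for t
      using rem_int_expansion[of "half_cot t" x N s] x s
      unfolding c_def[symmetric] g_def[symmetric] J_def[symmetric] R_def[symmetric] P_def[symmetric]
      by (simp add: Re_half_cot algebra_simps)
    have "?L (of_real x) = g * (rGamma (of_real x) / 2 * (e1 * J \<zeta> + e2 * J (- \<zeta>)))"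
    proof -
      have a: "0 < Re (complex_of_real x)" "Re (complex_of_real x) < 1 + Re s" using x s0 by auto
      show ?thesis
        unfolding ferrers_connection[OF z a s0] g_def J_def e1_def e2_def \<gamma>_def ..
    qed
    also have "\<dots> = (e1 * (rGamma (of_real x) * g * J \<zeta>) + e2 * (rGamma (of_real x) * g * J (- \<zeta>))) / 2"
      by (simp add: field_simps)
    also have "\<dots> = (\<Sum>n<N. P n * ((e1 * (- half_cot \<zeta>) ^ n + e2 * (- half_cot (- \<zeta>)) ^ n) / 2)) +
        c / 2 * (e1 * half_cot \<zeta> ^ N * (g * R \<zeta>) + e2 * half_cot (- \<zeta>) ^ N * (g * R (- \<zeta>)))"
    proof -
      have "(\<Sum>n<N. P n * ((e1 * (- half_cot \<zeta>) ^ n + e2 * (- half_cot (- \<zeta>)) ^ n) / 2)) =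
          (e1 * (\<Sum>n<N. P n * (- half_cot \<zeta>) ^ n) + e2 * (\<Sum>n<N. P n * (- half_cot (- \<zeta>)) ^ n)) / 2"
        unfolding sum_distrib_left sum.distrib[symmetric] sum_divide_distrib
        by (intro sum.cong refl) (simp add: algebra_simps)
      then show ?thesis unfolding E by (simp add: field_simps)
    qed
    finally show ?thesis
      unfolding c_def g_def P_def J_def R_def e1_def e2_def by (simp add: mult.commute)
  qed
qed auto

section \<open>Coefficients, limiting values, phases and the normalisation of the Gegenbauer
  function\<close>

lemma acoef_eq_pochhammer:
  fixes x :: "'a::field_char_0"
  shows "acoef n (x - 1 / 2) = (- 1) ^ n * (pochhammer x n * pochhammer (1 - x) n) / (2 ^ n * fact n)"
proof -
  have "(\<Prod>k = 1..n. 4 * (x - 1 / 2)\<^sup>2 - (2 * of_nat k - 1)\<^sup>2) =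
      (- 4) ^ n * (pochhammer x n * pochhammer (1 - x) n)"
  proof (induction n)
    case (Suc n)
    \<comment> \<open>A difference of squares: (2x - 1)^2 - (2k - 1)^2 = -4 (x + k - 1)(k - x), here
      with k = n + 1.\<close>
    have "4 * (x - 1 / 2)\<^sup>2 - (2 * of_nat (Suc n) - 1)\<^sup>2 = - 4 * ((x + of_nat n) * (1 - x + of_nat n))"
      by (simp add: power2_eq_square field_simps)
    moreover have "(\<Prod>k = 1..Suc n. 4 * (x - 1 / 2)\<^sup>2 - (2 * of_nat k - 1)\<^sup>2) =
        (4 * (x - 1 / 2)\<^sup>2 - (2 * of_nat (Suc n) - 1)\<^sup>2) * (\<Prod>k = 1..n. 4 * (x - 1 / 2)\<^sup>2 - (2 * of_nat k - 1)\<^sup>2)"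
      by (subst prod.nat_ivl_Suc') simp_all
    moreover have "(- 4 * (u * v)) * (c * (p * q)) = (- 4 * c) * ((p * u) * (q * v))" for u v c p q :: 'a
      by (simp add: mult_ac)
    ultimately show ?case
      by (simp only: Suc.IH pochhammer_Suc power_Suc)
  qed simp
  moreover have "(- 4 :: 'a) ^ n = (- 1) ^ n * 2 ^ n * 2 ^ n" "(8 :: 'a) ^ n = 2 ^ n * 2 ^ n * 2 ^ n"
    by (simp_all flip: power_mult_distrib)
  ultimately show ?thesis unfolding acoef_def by simp
qed

text \<open>Reflection cancels the sine away from the integers. The resulting Gamma product is
  continuous in the strip, so its value at an integer is the limit; one formula thus covers both
  cases of the definition.\<close>

lemma acoef_sin_ratio_eq:
  assumes "- real k < x" "x < real k + 1"
  shows "acoef_sin_ratio k x = Gamma (real k + x) * Gamma (real k + 1 - x) / (pi * 2 ^ k * fact k)"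
proof -
  define h where "h t = Gamma (real k + t) * Gamma (real k + 1 - t) / (pi * 2 ^ k * fact k)" for t
  have eq: "\<bar>acoef k (t - 1 / 2)\<bar> / \<bar>sin (pi * t)\<bar> = h t"
    if t: "- real k < t" "t < real k + 1" "t \<notin> \<int>" for t
  proof -
    have G: "0 < Gamma (real k + t)" "0 < Gamma (real k + 1 - t)"
      using t by (auto intro!: Gamma_real_pos)
    have "complex_of_real (pochhammer t k * pochhammer (1 - t) k) =
        pochhammer (of_real t) k * pochhammer (1 - of_real t) k"
      by (simp add: pochhammer_of_real[symmetric])
    also have "\<dots> = sin (of_real pi * of_real t) / of_real pi * Gamma (of_real t + of_nat k) * Gamma (1 - of_real t + of_nat k)"
      using t by (intro pochhammer_reflection) auto
    also have "\<dots> = complex_of_real (sin (pi * t) / pi * Gamma (t + real k) * Gamma (1 - t + real k))"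
      by (simp add: Gamma_complex_of_real[symmetric] sin_of_real[symmetric] del: sin_of_real)
    finally have "pochhammer t k * pochhammer (1 - t) k = sin (pi * t) / pi * Gamma (t + real k) * Gamma (1 - t + real k)"
      by (simp only: of_real_eq_iff)
    also have "\<dots> = sin (pi * t) / pi * (Gamma (real k + t) * Gamma (real k + 1 - t))"
      by (simp add: algebra_simps)
    finally have P: "pochhammer t k * pochhammer (1 - t) k = sin (pi * t) / pi * (Gamma (real k + t) * Gamma (real k + 1 - t))" .
    have "sin (pi * t) \<noteq> 0"
    proof
      assume "sin (pi * t) = 0"
      then obtain i :: int where "pi * t = of_int i * pi" by (auto simp: sin_zero_iff_int2)
      then have "t = of_int i" by simp
      then show False using t(3) by simp
    qed
    then show ?thesis
      unfolding acoef_eq_pochhammer P h_def using G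
      by (simp add: abs_mult abs_divide power_abs)
  qed
  show ?thesis
  proof (cases "x \<in> \<int>")
    case False
    then show ?thesis using eq[OF assms False] by (simp add: acoef_sin_ratio_def h_def)
  next
    case True
    have "isCont h x"
      unfolding h_def using assms
      by (intro continuous_intros isCont_Gamma) (auto dest: nonpos_Ints_nonpos)
    then have "(h \<longlongrightarrow> h x) (at x)" by (simp add: isCont_def)
    moreover have "eventually (\<lambda>t. \<bar>acoef k (t - 1 / 2)\<bar> / \<bar>sin (pi * t)\<bar> = h t) (at x)"
    proof -
      \<comment> \<open>Within distance 1 of the integer x there is no other integer.\<close>
      have "eventually (\<lambda>t. t \<in> {- real k<..<real k + 1} \<inter> {x - 1<..<x + 1} - {x}) (at x)"
        using assms by (intro eventually_at_in_open) auto
      then show ?thesis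
      proof eventually_elim
        case (elim t)
        have "t \<notin> \<int>"
        proof
          assume "t \<in> \<int>"
          with True obtain i j :: int where "t = of_int i" "x = of_int j" by (auto elim!: Ints_cases)
          with elim show False by auto
        qed
        then show ?case using elim by (intro eq) auto
      qed
    qed
    ultimately have "((\<lambda>t. \<bar>acoef k (t - 1 / 2)\<bar> / \<bar>sin (pi * t)\<bar>) \<longlongrightarrow> h x) (at x)"
      by (simp add: tendsto_cong)
    then have "Lim (at x) (\<lambda>t. \<bar>acoef k (t - 1 / 2)\<bar> / \<bar>sin (pi * t)\<bar>) = h x"
      by (intro tendsto_Lim) auto
    then show ?thesis using True by (simp add: acoef_sin_ratio_def h_def)
  qed
qed

text \<open>Raising n by one adds \<pi>/2 - \<zeta> to the phase, and exp(i (\<pi>/2 - \<zeta>)) = 2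
  sin \<zeta> \<open>half_cot \<zeta>\<close>. The powers of \<open>half_cot\<close> in the
  expansion thereby become the shifted phases and the powers of 1/sin \<zeta>.\<close>

lemma exp_gamma_phase:
  assumes "sin \<zeta> \<noteq> 0"
  shows "exp (\<i> * gamma_phase \<zeta> l \<nu> n) =
      exp (\<i> * ((\<nu> + l) * of_real \<zeta> - l * of_real (pi / 2))) * half_cot \<zeta> ^ n * of_real (2 * sin \<zeta>) ^ n"
    and "exp (- (\<i> * gamma_phase \<zeta> l \<nu> n)) =
      exp (- (\<i> * ((\<nu> + l) * of_real \<zeta> - l * of_real (pi / 2)))) * half_cot (- \<zeta>) ^ n * of_real (2 * sin \<zeta>) ^ n"
proof -
  have h1: "exp (\<i> * of_real (pi / 2 - \<zeta>)) = half_cot \<zeta> * of_real (2 * sin \<zeta>)"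
    unfolding cis_conv_exp[symmetric] using assms
    by (simp add: complex_eq_iff half_cot_def cot_def cos_diff sin_diff)
  have h2: "exp (\<i> * of_real (\<zeta> - pi / 2)) = half_cot (- \<zeta>) * of_real (2 * sin \<zeta>)"
    unfolding cis_conv_exp[symmetric] using assms
    by (simp add: complex_eq_iff half_cot_def cot_def cos_diff sin_diff)
  have "exp (\<i> * gamma_phase \<zeta> l \<nu> n) =
      exp (\<i> * ((\<nu> + l) * of_real \<zeta> - l * of_real (pi / 2))) * exp (of_nat n * (\<i> * of_real (pi / 2 - \<zeta>)))"
    unfolding exp_add[symmetric] gamma_phase_def by (simp add: algebra_simps del: of_real_divide)
  then show "exp (\<i> * gamma_phase \<zeta> l \<nu> n) =
      exp (\<i> * ((\<nu> + l) * of_real \<zeta> - l * of_real (pi / 2))) * half_cot \<zeta> ^ n * of_real (2 * sin \<zeta>) ^ n"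
    unfolding exp_of_nat_mult h1 power_mult_distrib by (simp only: mult.assoc)
  have "exp (- (\<i> * gamma_phase \<zeta> l \<nu> n)) =
      exp (- (\<i> * ((\<nu> + l) * of_real \<zeta> - l * of_real (pi / 2)))) * exp (of_nat n * (\<i> * of_real (\<zeta> - pi / 2)))"
    unfolding exp_add[symmetric] gamma_phase_def by (simp add: algebra_simps del: of_real_divide)
  then show "exp (- (\<i> * gamma_phase \<zeta> l \<nu> n)) =
      exp (- (\<i> * ((\<nu> + l) * of_real \<zeta> - l * of_real (pi / 2)))) * half_cot (- \<zeta>) ^ n * of_real (2 * sin \<zeta>) ^ n"
    unfolding exp_of_nat_mult h2 power_mult_distrib by (simp only: mult.assoc)
qed

text \<open>In half-angles all bases are positive, so the complex powers can be collected as
  exponentials of ln 2, ln sin(\<zeta>/2) and ln cos(\<zeta>/2). The right side is grouped to match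
  the left side of \<open>ferrers_expansion\<close>.\<close>

lemma gegenbauer_C_eq_hyp2f1_reg:
  fixes \<zeta> :: real and l \<nu> :: complex
  assumes z: "0 < \<zeta>" "\<zeta> < pi"
  shows "gegenbauer_C \<nu> l (cos \<zeta>) = 2 * rGamma l / of_real (2 * sin \<zeta>) powr l * (rGamma (\<nu> + 1) *
    (Gamma (\<nu> + l + l) * (of_real (sqrt pi) * of_real (sin (\<zeta> / 2)) powr l * of_real (cos (\<zeta> / 2)) powr (1 - l) *
      hyp2f1_reg (\<nu> + l + 1 / 2) (1 / 2 - (\<nu> + l)) (1 / 2 + l) (of_real ((sin (\<zeta> / 2))\<^sup>2)))))"
proof -
  define S C where "S = sin (\<zeta> / 2)" and "C = cos (\<zeta> / 2)"
  have S: "0 < S" unfolding S_def using z by (intro sin_gt_zero) auto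
  have C: "0 < C" unfolding C_def using z by (intro cos_gt_zero) auto
  have sin: "sin \<zeta> = 2 * S * C" using sin_double[of "\<zeta> / 2"] by (simp add: S_def C_def)
  have "0 < sin \<zeta>" using S C sin by simp
  then have sq: "sqrt (1 - (cos \<zeta>)\<^sup>2) = sin \<zeta>" by (simp add: sin_squared_eq[symmetric])
  have half: "(1 - cos \<zeta>) / 2 = S\<^sup>2" "1 + cos \<zeta> = 2 * C\<^sup>2" "1 - cos \<zeta> = 2 * S\<^sup>2"
    using cos_double_sin[of "\<zeta> / 2"] cos_double_cos[of "\<zeta> / 2"] by (simp_all add: S_def C_def)
  have ratio: "(1 + cos \<zeta>) / (1 - cos \<zeta>) = (C / S)\<^sup>2"
    unfolding half by (simp add: power_divide)
  have par: "\<nu> + l - 1 / 2 + 1 = \<nu> + l + 1 / 2" "- (\<nu> + l - 1 / 2) = 1 / 2 - (\<nu> + l)" "1 - (1 / 2 - l) = 1 / 2 + l"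
    "\<nu> + 2 * l = \<nu> + l + l" by simp_all
  let ?A = "complex_of_real (ln S)" and ?B = "complex_of_real (ln C)" and ?k = "complex_of_real (ln 2)"
  have lnsin: "ln (2 * sin \<zeta>) = 2 * ln 2 + ln S + ln C"
  proof -
    have "ln (2 * (2 * S * C)) = ln 2 + ln (2 * S * C)" using S C by (subst ln_mult) auto
    moreover have "ln (2 * S * C) = ln 2 + ln S + ln C" using S C by (simp add: ln_mult)
    ultimately show ?thesis unfolding sin by linarith
  qed
  have p0: "0 < 2 * sin \<zeta>" "0 < (C / S)\<^sup>2" using S C sin by simp_all
  have e1: "of_real (2 * sin \<zeta>) powr p = exp (p * (2 * ?k + ?A + ?B))" for p
    unfolding powr_complex_of_real_eq_exp[OF p0(1)] lnsin by simp
  have e2: "of_real ((C / S)\<^sup>2) powr p = exp (p * (2 * (?B - ?A)))" for p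
  proof -
    have "ln ((C / S)\<^sup>2) = 2 * (ln C - ln S)" using S C by (simp add: ln_realpow ln_div)
    then show ?thesis unfolding powr_complex_of_real_eq_exp[OF p0(2)] by simp
  qed
  have two: "exp ?k = 2" by (simp add: exp_of_real)
  have key: "exp ((1 / 2 - l) / 2 * (2 * (?B - ?A))) / exp ((l - 1 / 2) * (2 * ?k + ?A + ?B)) =
      2 / exp (l * (2 * ?k + ?A + ?B)) * (exp (l * ?A) * exp ((1 - l) * ?B))"
  proof -
    have "exp ((1 / 2 - l) / 2 * (2 * (?B - ?A))) / exp ((l - 1 / 2) * (2 * ?k + ?A + ?B)) =
        exp (?k - l * (2 * ?k + ?A + ?B) + (l * ?A + (1 - l) * ?B))"
      unfolding exp_diff[symmetric] by (rule arg_cong[where f = exp]) (simp add: field_simps)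
    then show ?thesis by (simp only: exp_add[of "l * ?A"] exp_add[of "_ - _"] exp_diff[of ?k] two)
  qed
  have arrange: "p * G * r * r' / E1 * (E2 * F) = 2 * r / E3 * (r' * (G * (p * EA * EB * F)))"
    if "E2 / E1 = 2 / E3 * (EA * EB)" for p G r r' E1 E2 E3 EA EB F :: complex
  proof -
    have "p * G * r * r' / E1 * (E2 * F) = p * G * r * r' * F * (E2 / E1)" by simp
    then show ?thesis unfolding that by simp
  qed
  show ?thesis
    unfolding gegenbauer_C_def ferrers_P_def sq ratio half(1) par e1 e2 S_def[symmetric] C_def[symmetric]
      powr_complex_of_real_eq_exp[OF S] powr_complex_of_real_eq_exp[OF C]
    by (rule arrange[OF key])
qed

section \<open>The expansion with its two remainder bounds\<close>

theorem corollary5p2: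
  fixes \<zeta> :: real and N :: nat and l \<nu> :: complex
  assumes "0 < \<zeta>" and "\<zeta> < pi"
    and "\<bar>Re l - 1 / 2\<bar> < real N + 1 / 2"
    and "Re \<nu> > real N - Re l"
  shows "\<exists>R :: complex.
      gegenbauer_C \<nu> l (cos \<zeta>) =
        2 * rGamma l / of_real (2 * sin \<zeta>) powr l *
        ((\<Sum>n<N. acoef n (l - 1 / 2) * (Gamma (\<nu> + l - of_nat n) / Gamma (\<nu> + 1)) *
                 (cos (gamma_phase \<zeta> l \<nu> n) / of_real (sin \<zeta> ^ n))) + R) \<and>
      norm R \<le>
        norm (sin (of_real pi * l)) * acoef_sin_ratio N (Re l) *
        (Gamma (Re \<nu> + Re l - real N) / norm (Gamma (\<nu> + 1))) *
        (cosh (Im (gamma_phase \<zeta> l \<nu> N)) / sin \<zeta> ^ N) \<and>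
      (Re \<nu> > real N - Re l + 1 \<longrightarrow>
        norm R \<le>
          norm (sin (of_real pi * l)) * acoef_sin_ratio N (Re l) *
          (Gamma (Re \<nu> + Re l - real N) / norm (Gamma (\<nu> + 1))) *
          (norm (cos (gamma_phase \<zeta> l \<nu> N)) / sin \<zeta> ^ N)
          + norm (sin (of_real pi * l)) * acoef_sin_ratio (Suc N) (Re l) *
          (Gamma (Re \<nu> + Re l - real N - 1) / norm (Gamma (\<nu> + 1))) *
          (norm (sin (gamma_phase \<zeta> l \<nu> N)) / sin \<zeta> ^ Suc N))"
proof -
  note z = assms(1,2)
  define s where "s = \<nu> + l"
  define x where "x = Re l"
  have l: "- real N < Re l" "Re l < real N + 1" using assms(3) by (auto simp: abs_less_iff)
  have s: "real N < Re s" using assms(4) by (simp add: s_def)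
  have S: "0 < sin \<zeta>" using z by (intro sin_gt_zero)
  have S0: "sin \<zeta> \<noteq> 0" using S by simp
  define g where "g = Gamma (\<nu> + 1)"
  \<comment> \<open>Re l < N + 1 and Re \<nu> > N - Re l give Re \<nu> > -1.\<close>
  have g0: "g \<noteq> 0"
  proof -
    have "\<nu> + 1 \<notin> \<int>\<^sub>\<le>\<^sub>0" using l assms(4) by (intro not_nonpos_Ints_if_Re_pos) simp
    then show ?thesis by (simp add: g_def Gamma_eq_zero_iff)
  qed
  have rg: "rGamma (\<nu> + 1) = inverse g" by (simp add: g_def rGamma_inverse_Gamma)
  define \<gamma> where "\<gamma> = gamma_phase \<zeta> l \<nu>"
  define e1 e2 where "e1 = exp (\<i> * (s * of_real \<zeta> - l * of_real (pi / 2)))"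
    and "e2 = exp (- (\<i> * (s * of_real \<zeta> - l * of_real (pi / 2))))"
  have ph: "exp (\<i> * \<gamma> n) = e1 * half_cot \<zeta> ^ n * of_real (2 * sin \<zeta>) ^ n"
    "exp (- (\<i> * \<gamma> n)) = e2 * half_cot (- \<zeta>) ^ n * of_real (2 * sin \<zeta>) ^ n" for n
    unfolding \<gamma>_def e1_def e2_def s_def by (rule exp_gamma_phase[OF S0])+
  define B where "B t = Gamma (s + l) * rem_int N s l (half_cot t)" for t
  define D where "D = complex_of_real (2 * sin \<zeta>) ^ N"
  have D0: "D \<noteq> 0" using S by (simp add: D_def)
  define sp where "sp = sin (of_real pi * l)"
  \<comment> \<open>The exponentials of the phase at index N already contain the N-th powers of
    \<open>half_cot\<close>, multiplied by D; hence the division by D.\<close>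
  define R where "R = sp / (2 * of_real pi) * inverse g * (exp (\<i> * \<gamma> N) * B \<zeta> + exp (- (\<i> * \<gamma> N)) * B (- \<zeta>)) / D"
  have summand: "inverse g * (pochhammer l n * pochhammer (1 - l) n / fact n * Gamma (s - of_nat n) *
       ((e1 * (- half_cot \<zeta>) ^ n + e2 * (- half_cot (- \<zeta>)) ^ n) / 2)) =
     acoef n (l - 1 / 2) * (Gamma (\<nu> + l - of_nat n) / g) * (cos (\<gamma> n) / of_real (sin \<zeta> ^ n))" for n
  proof -
    define u where "u = complex_of_real (sin \<zeta>) ^ n"
    have u: "u \<noteq> 0" using S by (simp add: u_def)
    define p where "p = pochhammer l n * pochhammer (1 - l) n"
    have c: "cos (\<gamma> n) = (e1 * half_cot \<zeta> ^ n + e2 * half_cot (- \<zeta>) ^ n) * (2 ^ n * u) / 2"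
      unfolding cos_exp_eq ph u_def power_mult_distrib[symmetric] by (simp add: distrib_right)
    have uu: "complex_of_real (sin \<zeta> ^ n) = u" by (simp add: u_def)
    show ?thesis
      unfolding c uu acoef_eq_pochhammer s_def[symmetric] p_def[symmetric] power_minus[of "half_cot \<zeta>"] power_minus[of "half_cot (- \<zeta>)"]
      using u g0 by (simp add: field_simps)
  qed
  have "gegenbauer_C \<nu> l (cos \<zeta>) = 2 * rGamma l / of_real (2 * sin \<zeta>) powr l * (inverse g *
    ((\<Sum>n<N. pochhammer l n * pochhammer (1 - l) n / fact n * Gamma (s - of_nat n) *
       ((e1 * (- half_cot \<zeta>) ^ n + e2 * (- half_cot (- \<zeta>)) ^ n) / 2)) +
    sp / (2 * of_real pi) * (e1 * half_cot \<zeta> ^ N * B \<zeta> + e2 * half_cot (- \<zeta>) ^ N * B (- \<zeta>))))"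
    unfolding gegenbauer_C_eq_hyp2f1_reg[OF z] rg s_def[symmetric] ferrers_expansion[OF z l s]
      B_def sp_def e1_def e2_def ..
  also have "inverse g *
    ((\<Sum>n<N. pochhammer l n * pochhammer (1 - l) n / fact n * Gamma (s - of_nat n) *
       ((e1 * (- half_cot \<zeta>) ^ n + e2 * (- half_cot (- \<zeta>)) ^ n) / 2)) +
    sp / (2 * of_real pi) * (e1 * half_cot \<zeta> ^ N * B \<zeta> + e2 * half_cot (- \<zeta>) ^ N * B (- \<zeta>))) =
    (\<Sum>n<N. acoef n (l - 1 / 2) * (Gamma (\<nu> + l - of_nat n) / g) * (cos (\<gamma> n) / of_real (sin \<zeta> ^ n))) + R"
  proof -
    have "exp (\<i> * \<gamma> N) = e1 * half_cot \<zeta> ^ N * D" "exp (- (\<i> * \<gamma> N)) = e2 * half_cot (- \<zeta>) ^ N * D"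
      unfolding D_def by (rule ph)+
    then have "R = sp / (2 * of_real pi) * inverse g *
        ((e1 * half_cot \<zeta> ^ N * B \<zeta> + e2 * half_cot (- \<zeta>) ^ N * B (- \<zeta>)) * D) / D"
      unfolding R_def by (simp add: algebra_simps)
    also have "\<dots> = inverse g * (sp / (2 * of_real pi) * (e1 * half_cot \<zeta> ^ N * B \<zeta> + e2 * half_cot (- \<zeta>) ^ N * B (- \<zeta>)))"
      using D0 by simp
    finally show ?thesis
      unfolding distrib_left[of "inverse g"] sum_distrib_left[of "inverse g"] summand by simp
  qed
  finally have eq: "gegenbauer_C \<nu> l (cos \<zeta>) = 2 * rGamma l / of_real (2 * sin \<zeta>) powr l *
      ((\<Sum>n<N. acoef n (l - 1 / 2) * (Gamma (\<nu> + l - of_nat n) / g) * (cos (\<gamma> n) / of_real (sin \<zeta> ^ n))) + R)" .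
  define K where "K = cmod sp / (2 * pi) / cmod g / (2 * sin \<zeta>) ^ N"
  have K0: "0 \<le> K" using S by (simp add: K_def)
  have normR: "cmod R = K * cmod (exp (\<i> * \<gamma> N) * B \<zeta> + exp (- (\<i> * \<gamma> N)) * B (- \<zeta>))"
  proof -
    have "cmod (sp / (2 * of_real pi) * inverse g * Z / D) = K * cmod Z" for Z
      unfolding K_def D_def using S by (simp add: norm_mult norm_divide norm_inverse norm_power field_simps)
    then show ?thesis unfolding R_def by blast
  qed
  define b where "b = Gamma (real N + x) * Gamma (real N + 1 - x) * Gamma (Re s - real N) / fact N"
  have Bb: "cmod (B t) \<le> b" for t
    unfolding B_def b_def x_def using l s by (intro integrable_rem_kernel(2)) (auto simp: Re_half_cot)
  have ratio: "acoef_sin_ratio N x = Gamma (real N + x) * Gamma (real N + 1 - x) / (pi * 2 ^ N * fact N)"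
    unfolding x_def using l by (rule acoef_sin_ratio_eq)
  \<comment> \<open>The factor 2 counts the two edges and reduces 1/(2\<pi>) to 1/\<pi>; the power
    (2 sin \<zeta>)^N supplies the 2^N of the coefficient ratio.\<close>
  have Kb: "K * (2 * t * b) = cmod sp * acoef_sin_ratio N x * (Gamma (Re s - real N) / cmod g) * (t / sin \<zeta> ^ N)" for t
    unfolding K_def b_def ratio using S g0 by (simp add: power_mult_distrib field_simps)
  have bound1: "cmod R \<le> cmod sp * acoef_sin_ratio N x * (Gamma (Re s - real N) / cmod g) *
      (cosh (Im (\<gamma> N)) / sin \<zeta> ^ N)"
  proof -
    have "cmod (exp (\<i> * \<gamma> N) * B \<zeta> + exp (- (\<i> * \<gamma> N)) * B (- \<zeta>)) \<le>
        exp (- Im (\<gamma> N)) * cmod (B \<zeta>) + exp (Im (\<gamma> N)) * cmod (B (- \<zeta>))"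
      using norm_triangle_ineq[of "exp (\<i> * \<gamma> N) * B \<zeta>" "exp (- (\<i> * \<gamma> N)) * B (- \<zeta>)"]
      by (simp add: norm_mult)
    also have "\<dots> \<le> exp (- Im (\<gamma> N)) * b + exp (Im (\<gamma> N)) * b"
      by (intro add_mono mult_left_mono Bb) auto
    also have "\<dots> = 2 * cosh (Im (\<gamma> N)) * b" by (simp add: cosh_def algebra_simps)
    finally show ?thesis
      unfolding normR Kb[symmetric] by (rule mult_left_mono) (rule K0)
  qed
  have bound2: "cmod R \<le> cmod sp * acoef_sin_ratio N x * (Gamma (Re s - real N) / cmod g) * (cmod (cos (\<gamma> N)) / sin \<zeta> ^ N)
     + cmod sp * acoef_sin_ratio (Suc N) x * (Gamma (Re s - real N - 1) / cmod g) * (cmod (sin (\<gamma> N)) / sin \<zeta> ^ Suc N)"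
    if s': "real N + 1 < Re s"
  proof -
    define b' where "b' = Gamma (real N + 1 + x) * Gamma (real N + 2 - x) * Gamma (Re s - real N - 1)"
    have b': "0 \<le> b'" unfolding b'_def x_def using l s'
      by (intro mult_nonneg_nonneg less_imp_le[OF Gamma_real_pos]) auto
    \<comment> \<open>The difference is i cot \<zeta>, and |cos \<zeta>| <= 1. This supplies the
      additional 1/sin \<zeta> of the second term.\<close>
    have dw: "cmod (half_cot \<zeta> - half_cot (- \<zeta>)) \<le> 1 / sin \<zeta>"
    proof -
      have "half_cot \<zeta> - half_cot (- \<zeta>) = Complex 0 (cot \<zeta>)"
        by (simp add: half_cot_def complex_eq_iff cot_def)
      then have "cmod (half_cot \<zeta> - half_cot (- \<zeta>)) = \<bar>cos \<zeta>\<bar> / sin \<zeta>"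
        using S by (simp add: cmod_def cot_def)
      then show ?thesis using S by (simp add: divide_right_mono)
    qed
    have "cmod (B \<zeta> - B (- \<zeta>)) \<le> cmod (half_cot \<zeta> - half_cot (- \<zeta>)) * b' / fact (Suc N)"
      unfolding B_def b'_def x_def right_diff_distrib[symmetric]
      using l s' by (intro norm_rem_int_diff_le) (auto simp: Re_half_cot)
    also have "\<dots> \<le> 1 / sin \<zeta> * b' / fact (Suc N)"
      by (intro divide_right_mono mult_right_mono dw b') simp
    finally have dB: "cmod (B \<zeta> - B (- \<zeta>)) \<le> 1 / sin \<zeta> * b' / fact (Suc N)" .
    \<comment> \<open>The difference of the edges enters once, so the 1/2 in K survives and
      completes 2^N to 2^(N+1).\<close>
    have Kb': "K * (t * (1 / sin \<zeta> * b' / fact (Suc N))) =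
        cmod sp * acoef_sin_ratio (Suc N) x * (Gamma (Re s - real N - 1) / cmod g) * (t / sin \<zeta> ^ Suc N)" for t
    proof -
      have "acoef_sin_ratio (Suc N) x =
          Gamma (real (Suc N) + x) * Gamma (real (Suc N) + 1 - x) / (pi * 2 ^ Suc N * fact (Suc N))"
        unfolding x_def using l by (intro acoef_sin_ratio_eq) auto
      also have "real (Suc N) + x = real N + 1 + x" by simp
      also have "real (Suc N) + 1 - x = real N + 2 - x" by simp
      finally have r: "acoef_sin_ratio (Suc N) x =
          Gamma (real N + 1 + x) * Gamma (real N + 2 - x) / (pi * 2 ^ Suc N * fact (Suc N))" .
      show ?thesis unfolding K_def b'_def r power_Suc power_mult_distrib
        using S g0 by (simp add: field_simps del: fact_Suc)
    qed
    \<comment> \<open>The sum of the two integrals is bounded by twice the single bound, and their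
      difference by the Lipschitz bound; this pairs cos with index N and sin with index N +
      1.\<close>
    have "exp (\<i> * \<gamma> N) * B \<zeta> + exp (- (\<i> * \<gamma> N)) * B (- \<zeta>) =
        cos (\<gamma> N) * (B \<zeta> + B (- \<zeta>)) + \<i> * sin (\<gamma> N) * (B \<zeta> - B (- \<zeta>))"
      unfolding cos_exp_eq sin_exp_eq by (simp add: field_simps)
    also have "cmod \<dots> \<le> cmod (cos (\<gamma> N)) * cmod (B \<zeta> + B (- \<zeta>)) + cmod (sin (\<gamma> N)) * cmod (B \<zeta> - B (- \<zeta>))"
      using norm_triangle_ineq[of "cos (\<gamma> N) * (B \<zeta> + B (- \<zeta>))" "\<i> * sin (\<gamma> N) * (B \<zeta> - B (- \<zeta>))"]
      by (simp add: norm_mult)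
    also have "\<dots> \<le> cmod (cos (\<gamma> N)) * (b + b) + cmod (sin (\<gamma> N)) * (1 / sin \<zeta> * b' / fact (Suc N))"
      by (intro add_mono mult_left_mono dB norm_triangle_mono Bb) auto
    also have "\<dots> = 2 * cmod (cos (\<gamma> N)) * b + cmod (sin (\<gamma> N)) * (1 / sin \<zeta> * b' / fact (Suc N))"
      by (simp only: mult_2 distrib_left distrib_right)
    finally have "cmod R \<le> K * (2 * cmod (cos (\<gamma> N)) * b + cmod (sin (\<gamma> N)) * (1 / sin \<zeta> * b' / fact (Suc N)))"
      unfolding normR by (rule mult_left_mono) (rule K0)
    then show ?thesis unfolding distrib_left[of K] Kb Kb' .
  qed
  have Res: "Re \<nu> + x - real N = Re s - real N" by (simp add: s_def x_def)
  show ?thesis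
    unfolding x_def[symmetric] g_def[symmetric] sp_def[symmetric] \<gamma>_def[symmetric] Res
  proof (intro exI[of _ R] conjI impI eq bound1)
    assume "Re \<nu> > real N - x + 1"
    then have "real N + 1 < Re s" by (simp add: s_def x_def)
    then show "cmod R \<le> cmod sp * acoef_sin_ratio N x * (Gamma (Re s - real N) / cmod g) * (cmod (cos (\<gamma> N)) / sin \<zeta> ^ N)
     + cmod sp * acoef_sin_ratio (Suc N) x * (Gamma (Re s - real N - 1) / cmod g) * (cmod (sin (\<gamma> N)) / sin \<zeta> ^ Suc N)"
      by (rule bound2)
  qed
qed

end
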